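(* Let $\delta>1$, let $w\in A_s$, let $\mathcal A$ satisfy the structural conditions listed in the context, and let $f\ge0$, $f\not\equiv0$, be a measurable function on $\Omega$. The problem $$-\operatorname{div}(\mathcal A(x,\nabla u))=\frac{f(x)}{u^\delta}\ \text{in }\Omega,\qquad u>0\ \text{in }\Omega,\qquad u=0\ \text{on }\partial\Omega$$ has at most one weak solution in $W^{1,p}_{loc}(\Omega,w)$ if one of the following holds: (a) $1\le p_s<N$ and $f\in L^m(\Omega)$ with $m=(p_s^* )'$; or (b) $p_s=N$ and $f\in L^m(\Omega)$ for some $m>1$; or (c) $p_s>N$ and $f\in L^1(\Omega)$.
   Context: Setting: $N\ge 2$, $\Omega\subset\mathbb R^N$ is a bounded smooth domain, $1<p<\infty$. Weights: a locally integrable $w:\mathbb R^N\to(0,\infty)$ (with $0<w<\infty$ a.e.) belongs to $A_p$ if there is $c_{p,w}>0$ such that $\left(\frac1{|B|}\int_B w\,dx\right)\left(\frac1{|B|}\int_B w^{-\frac1{p-1}}dx\right)^{p-1}\le c_{p,w}$ for all balls $B\subset\mathbb R^N$. Fix $s\in[\frac1{p-1},\infty)\cap(\frac Np,\infty)$; $w\in A_s$ means $w\in A_p$ and $w^{-s}\in L^1(\Omega)$. Set $p_s=\frac{ps}{s+1}\in[1,p)$ and, if $p_s<N$, $p_s^*=\frac{Np_s}{N-p_s}$. For an exponent $r$, $r'$ is the Hölder conjugate. Spaces: $W^{1,p}(\Omega,w)$ is the space of (weakly differentiable) measurable $u$ with $\|u\|_{1,p,w}=(\int_\Omega|u|^pw\,dx)^{1/p}+(\int_\Omega|\nabla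 u|^pw\,dx)^{1/p}<\infty$; $X=W^{1,p}_0(\Omega,w)$ is the closure of $C_c^\infty(\Omega)$ in it, and $\left(\int_\Omega|\nabla u|^pw\,dx\right)^{1/p}$ is an equivalent norm on $X$. $u\in W^{1,p}_{loc}(\Omega,w)$ means $u\in W^{1,p}(\Omega',w)$ for every $\Omega'\Subset\Omega$. Operator: $\mathcal A:\Omega\times\mathbb R^N\to\mathbb R^N$ is Carathéodory ($\mathcal A(\cdot,\zeta)$ measurable for every $\zeta$; $\mathcal A(x,\cdot)$ continuous for a.e. $x$), and for a.e. $x\in\Omega$ and all vectors in $\mathbb R^N$: (growth) $|\mathcal A(x,\zeta)|\le|\zeta|^{p-1}w(x)$; (degeneracy) $\mathcal A(x,\zeta)\cdot\zeta\ge|\zeta|^pw(x)$; (homogeneity) $\mathcal A(x,t\zeta)=t|t|^{p-2}\mathcal A(x,\zeta)$ for $t\in\mathbb R\setminus\{0\}$; (strong monotonicity) with $\gamma=\max\{p,2\}$ and some constant $c>0$, for $\zeta_1\ne\zeta_2$, $\langle\mathcal A(x,\zeta_1)-\mathcal A(x,\zeta_2),\zeta_1-\zeta_2\rangle\ge c|\zeta_1-\zeta_2|^\gamma\{\overline{\mathcal A}(x,\zeta_1,\zeta_2)\}^{1-\frac\gamma p}w(x)$, where $\overline{\mathcal A}(x,\zeta_1,\zeta_2)=\frac1{w(x)}(\langle\mathcal A(x,\zeta_1),\zeta_1\rangle+\langle\mathcal A(x,\zeta_2),\zeta_2\rangle)$. Weak solution: $u\in W^{1,p}_{loc}(\Omega,w)$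 is a weak solution of the problem if for every $K\Subset\Omega$ there is $c_K>0$ with $u\ge c_K$ in $K$; for all $\phi\in C_c^1(\Omega)$, $\int_\Omega\mathcal A(x,\nabla u)\cdot\nabla\phi\,dx=\int_\Omega\frac{f}{u^\delta}\phi\,dx$; $u>0$ in $\Omega$; and $u=0$ on $\partial\Omega$ in the sense that $u^\alpha\in X$ for some $\alpha\ge1$. *)

theory Defs
  imports "HOL-Analysis.Analysis"
begin

text \<open>
  The space \<open>\<real>\<^sup>N\<close> is a type of class \<open>euclidean_space\<close> with \<open>N = DIM('a)\<close>.  Elements of function
  spaces are represented by Lebesgue measurable functions; all pointwise conditions on them, and
  equality of two of them, are understood almost everywhere.
\<close>


section \<open>Smooth functions, test functions and smooth domains\<close>

text \<open>\<open>C\<^sup>k\<close> regularity; meant for open \<open>S\<close>.\<close>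

fun Ck_on :: "nat \<Rightarrow> 'a::euclidean_space set \<Rightarrow> ('a \<Rightarrow> real) \<Rightarrow> bool" where
  "Ck_on 0 S f \<longleftrightarrow> continuous_on S f"
| "Ck_on (Suc k) S f \<longleftrightarrow>
     (\<forall>x\<in>S. f differentiable (at x)) \<and> (\<forall>v. Ck_on k S (\<lambda>x. frechet_derivative f (at x) v))"

definition smooth_on :: "'a::euclidean_space set \<Rightarrow> ('a \<Rightarrow> real) \<Rightarrow> bool" where
  "smooth_on S f \<longleftrightarrow> (\<forall>k. Ck_on k S f)"

definition grad :: "('a::euclidean_space \<Rightarrow> real) \<Rightarrow> 'a \<Rightarrow> 'a" where
  "grad f x = (\<Sum>b\<in>Basis. frechet_derivative f (at x) b *\<^sub>R b)"

definition compactly_contained :: "'a::euclidean_space set \<Rightarrow> 'a set \<Rightarrow> bool"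
    (infix \<open>\<Subset>\<close> 50) where
  "K \<Subset> \<Omega> \<longleftrightarrow> compact (closure K) \<and> closure K \<subseteq> \<Omega>"

text \<open>Functions with compact support in \<open>\<Omega>\<close> are identified with their extension by zero.\<close>

definition Ccinf :: "'a::euclidean_space set \<Rightarrow> ('a \<Rightarrow> real) set" where
  "Ccinf \<Omega> = {\<phi>. smooth_on UNIV \<phi> \<and> {x. \<phi> x \<noteq> 0} \<Subset> \<Omega>}"

definition Cc1 :: "'a::euclidean_space set \<Rightarrow> ('a \<Rightarrow> real) set" where
  "Cc1 \<Omega> = {\<phi>. Ck_on 1 UNIV \<phi> \<and> {x. \<phi> x \<noteq> 0} \<Subset> \<Omega>}"

text \<open>
  Near each boundary point the domain is the region above the graph of a smooth function \<open>h\<close> of the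
  coordinates orthogonal to some unit vector \<open>e\<close>; the function \<open>h\<close> on the hyperplane orthogonal to
  \<open>e\<close> is given as a function on the whole space, evaluated at the orthogonal projection.
\<close>

definition smooth_boundary :: "'a::euclidean_space set \<Rightarrow> bool" where
  "smooth_boundary \<Omega> \<longleftrightarrow>
     (\<forall>z \<in> frontier \<Omega>. \<exists>r>0. \<exists>e h. norm e = 1 \<and> smooth_on UNIV h \<and>
        \<Omega> \<inter> ball z r = {x \<in> ball z r. h (x - (x \<bullet> e) *\<^sub>R e) < x \<bullet> e})"

definition bounded_smooth_domain :: "'a::euclidean_space set \<Rightarrow> bool" where
  "bounded_smooth_domain \<Omega> \<longleftrightarrow>
     open \<Omega> \<and> connected \<Omega> \<and> \<Omega> \<noteq> {} \<and> bounded \<Omega> \<and> smooth_boundary \<Omega>"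


section \<open>Lebesgue spaces and Muckenhoupt weights\<close>

definition locally_integrable :: "'a::euclidean_space set \<Rightarrow> ('a \<Rightarrow> 'b::euclidean_space) \<Rightarrow> bool"
  where
  "locally_integrable \<Omega> u \<longleftrightarrow>
     u \<in> borel_measurable (lebesgue_on \<Omega>) \<and>
     (\<forall>K. compact K \<and> K \<subseteq> \<Omega> \<longrightarrow> integrable (lebesgue_on K) u)"

definition Lspace :: "real \<Rightarrow> 'a::euclidean_space set \<Rightarrow> ('a \<Rightarrow> real) set" where
  "Lspace m \<Omega> = {f \<in> borel_measurable (lebesgue_on \<Omega>).
     integrable (lebesgue_on \<Omega>) (\<lambda>x. \<bar>f x\<bar> powr m)}"

definition avg :: "'a::euclidean_space set \<Rightarrow> ('a \<Rightarrow> real) \<Rightarrow> real" where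
  "avg B f = (LINT x|lebesgue_on B. f x) / measure lebesgue B"

text \<open>
  The integrability of \<open>w\<^bsup>-1/(p-1)\<^esup>\<close> over balls is implicit in the finiteness of the product; it is
  explicit here because the Bochner integral of a non-integrable function is \<open>0\<close>.
\<close>

definition Ap_weight :: "real \<Rightarrow> ('a::euclidean_space \<Rightarrow> real) \<Rightarrow> bool" where
  "Ap_weight p w \<longleftrightarrow>
     locally_integrable UNIV w \<and> (AE x in lebesgue. 0 < w x) \<and>
     (\<exists>c>0. \<forall>y r. 0 < r \<longrightarrow>
        integrable (lebesgue_on (ball y r)) (\<lambda>x. w x powr (- 1 / (p - 1))) \<and>
        avg (ball y r) w * (avg (ball y r) (\<lambda>x. w x powr (- 1 / (p - 1)))) powr (p - 1) \<le> c)"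

definition As_weight :: "real \<Rightarrow> real \<Rightarrow> 'a::euclidean_space set \<Rightarrow> ('a \<Rightarrow> real) \<Rightarrow> bool" where
  "As_weight p s \<Omega> w \<longleftrightarrow>
     Ap_weight p w \<and> integrable (lebesgue_on \<Omega>) (\<lambda>x. w x powr (- s))"

definition p_sub :: "real \<Rightarrow> real \<Rightarrow> real" where
  "p_sub p s = p * s / (s + 1)"

definition sobolev_exponent :: "real \<Rightarrow> real \<Rightarrow> real" where
  "sobolev_exponent N q = N * q / (N - q)"

definition holder_conjugate :: "real \<Rightarrow> real" where
  "holder_conjugate r = r / (r - 1)"


section \<open>Weighted Sobolev spaces\<close>

definition has_weak_gradient ::
    "'a::euclidean_space set \<Rightarrow> ('a \<Rightarrow> real) \<Rightarrow> ('a \<Rightarrow> 'a) \<Rightarrow> bool" where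
  "has_weak_gradient \<Omega> u g \<longleftrightarrow>
     locally_integrable \<Omega> u \<and> locally_integrable \<Omega> g \<and>
     (\<forall>\<phi>\<in>Ccinf \<Omega>. \<forall>b\<in>Basis.
        (LINT x|lebesgue_on \<Omega>. u x * (grad \<phi> x \<bullet> b)) =
        - (LINT x|lebesgue_on \<Omega>. (g x \<bullet> b) * \<phi> x))"

definition weakly_differentiable :: "'a::euclidean_space set \<Rightarrow> ('a \<Rightarrow> real) \<Rightarrow> bool" where
  "weakly_differentiable \<Omega> u \<longleftrightarrow> (\<exists>g. has_weak_gradient \<Omega> u g)"

text \<open>A weak gradient on an open set is unique up to null sets, so any choice may be taken.\<close>

definition weak_grad :: "'a::euclidean_space set \<Rightarrow> ('a \<Rightarrow> real) \<Rightarrow> 'a \<Rightarrow> 'a" where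
  "weak_grad \<Omega> u = (SOME g. has_weak_gradient \<Omega> u g)"

definition W1p :: "real \<Rightarrow> 'a::euclidean_space set \<Rightarrow> ('a \<Rightarrow> real) \<Rightarrow> ('a \<Rightarrow> real) set" where
  "W1p p \<Omega> w = {u. weakly_differentiable \<Omega> u \<and>
     integrable (lebesgue_on \<Omega>) (\<lambda>x. \<bar>u x\<bar> powr p * w x) \<and>
     integrable (lebesgue_on \<Omega>) (\<lambda>x. norm (weak_grad \<Omega> u x) powr p * w x)}"

definition W1p_norm ::
    "real \<Rightarrow> 'a::euclidean_space set \<Rightarrow> ('a \<Rightarrow> real) \<Rightarrow> ('a \<Rightarrow> real) \<Rightarrow> real" where
  "W1p_norm p \<Omega> w u =
     (LINT x|lebesgue_on \<Omega>. \<bar>u x\<bar> powr p * w x) powr (1 / p) +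
     (LINT x|lebesgue_on \<Omega>. norm (weak_grad \<Omega> u x) powr p * w x) powr (1 / p)"

definition W1p_0 :: "real \<Rightarrow> 'a::euclidean_space set \<Rightarrow> ('a \<Rightarrow> real) \<Rightarrow> ('a \<Rightarrow> real) set" where
  "W1p_0 p \<Omega> w = {u \<in> W1p p \<Omega> w.
     \<forall>\<epsilon>>0. \<exists>\<phi> \<in> Ccinf \<Omega> \<inter> W1p p \<Omega> w. W1p_norm p \<Omega> w (\<lambda>x. u x - \<phi> x) < \<epsilon>}"

definition W1p_loc :: "real \<Rightarrow> 'a::euclidean_space set \<Rightarrow> ('a \<Rightarrow> real) \<Rightarrow> ('a \<Rightarrow> real) set" where
  "W1p_loc p \<Omega> w = {u. \<forall>\<Omega>'. open \<Omega>' \<and> \<Omega>' \<Subset> \<Omega> \<longrightarrow> u \<in> W1p p \<Omega>' w}"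


section \<open>The operator and weak solutions\<close>

definition caratheodory :: "'a::euclidean_space set \<Rightarrow> ('a \<Rightarrow> 'a \<Rightarrow> 'a) \<Rightarrow> bool" where
  "caratheodory \<Omega> A \<longleftrightarrow>
     (\<forall>\<zeta>. (\<lambda>x. A x \<zeta>) \<in> borel_measurable (lebesgue_on \<Omega>)) \<and>
     (AE x in lebesgue_on \<Omega>. continuous_on UNIV (A x))"

definition A_bar :: "('a::euclidean_space \<Rightarrow> real) \<Rightarrow> ('a \<Rightarrow> 'a \<Rightarrow> 'a) \<Rightarrow> 'a \<Rightarrow> 'a \<Rightarrow> 'a \<Rightarrow> real" where
  "A_bar w A x \<zeta>\<^sub>1 \<zeta>\<^sub>2 = 1 / w x * (A x \<zeta>\<^sub>1 \<bullet> \<zeta>\<^sub>1 + A x \<zeta>\<^sub>2 \<bullet> \<zeta>\<^sub>2)"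

definition structural_conditions ::
    "real \<Rightarrow> 'a::euclidean_space set \<Rightarrow> ('a \<Rightarrow> real) \<Rightarrow> ('a \<Rightarrow> 'a \<Rightarrow> 'a) \<Rightarrow> bool" where
  "structural_conditions p \<Omega> w A \<longleftrightarrow>
     caratheodory \<Omega> A \<and>
     (AE x in lebesgue_on \<Omega>. \<forall>\<zeta>. norm (A x \<zeta>) \<le> norm \<zeta> powr (p - 1) * w x) \<and>
     (AE x in lebesgue_on \<Omega>. \<forall>\<zeta>. A x \<zeta> \<bullet> \<zeta> \<ge> norm \<zeta> powr p * w x) \<and>
     (AE x in lebesgue_on \<Omega>. \<forall>\<zeta> t. t \<noteq> 0 \<longrightarrow>
        A x (t *\<^sub>R \<zeta>) = (t * \<bar>t\<bar> powr (p - 2)) *\<^sub>R A x \<zeta>) \<and>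
     (let \<gamma> = max p 2 in
       \<exists>c>0. AE x in lebesgue_on \<Omega>. \<forall>\<zeta>\<^sub>1 \<zeta>\<^sub>2. \<zeta>\<^sub>1 \<noteq> \<zeta>\<^sub>2 \<longrightarrow>
         (A x \<zeta>\<^sub>1 - A x \<zeta>\<^sub>2) \<bullet> (\<zeta>\<^sub>1 - \<zeta>\<^sub>2) \<ge>
           c * norm (\<zeta>\<^sub>1 - \<zeta>\<^sub>2) powr \<gamma> * A_bar w A x \<zeta>\<^sub>1 \<zeta>\<^sub>2 powr (1 - \<gamma> / p) * w x)"

text \<open>
  Weak solutions of \<open>- div (A (x, \<nabla>u)) = f / u\<^sup>\<delta>\<close>, \<open>u > 0\<close> in \<open>\<Omega>\<close>, \<open>u = 0\<close> on \<open>\<partial>\<Omega>\<close>.  That both sides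
  of the weak formulation exist as Lebesgue integrals is part of its meaning, and is stated
  explicitly because the Bochner integral is total.
\<close>

definition weak_solution ::
    "real \<Rightarrow> 'a::euclidean_space set \<Rightarrow> ('a \<Rightarrow> real) \<Rightarrow> ('a \<Rightarrow> 'a \<Rightarrow> 'a) \<Rightarrow> real \<Rightarrow> ('a \<Rightarrow> real) \<Rightarrow>
     ('a \<Rightarrow> real) \<Rightarrow> bool" where
  "weak_solution p \<Omega> w A \<delta> f u \<longleftrightarrow>
     u \<in> W1p_loc p \<Omega> w \<and>
     (\<forall>K. K \<Subset> \<Omega> \<longrightarrow> (\<exists>c>0. AE x in lebesgue_on \<Omega>. x \<in> K \<longrightarrow> c \<le> u x)) \<and>
     (\<forall>\<phi>\<in>Cc1 \<Omega>.
        integrable (lebesgue_on \<Omega>) (\<lambda>x. A x (weak_grad \<Omega> u x) \<bullet> grad \<phi> x) \<and>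
        integrable (lebesgue_on \<Omega>) (\<lambda>x. f x / u x powr \<delta> * \<phi> x) \<and>
        (LINT x|lebesgue_on \<Omega>. A x (weak_grad \<Omega> u x) \<bullet> grad \<phi> x) =
        (LINT x|lebesgue_on \<Omega>. f x / u x powr \<delta> * \<phi> x)) \<and>
     (AE x in lebesgue_on \<Omega>. 0 < u x) \<and>
     (\<exists>\<alpha>\<ge>1. (\<lambda>x. u x powr \<alpha>) \<in> W1p_0 p \<Omega> w)"

end

theory Submission
  imports Defs "HOL-Real_Asymp.Real_Asymp"
begin

text \<open>
  Growth and degeneracy hold with the same constant, so \<open>A(x, \<zeta>) = w(x) \<bar>\<zeta>\<bar>\<^bsup>p-2\<^esup> \<zeta>\<close>.  Testing with
  \<open>(\<phi> - v)\<^sup>+\<close> bounds the energy of a solution \<open>v\<close> on \<open>{v < \<phi>}\<close> by that of the test function \<open>\<phi>\<close>.  With \<open>\<phi>\<close>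
  running through smooth approximations of a multiple of \<open>u\<^sup>\<alpha>\<close>, both \<open>\<nabla>u\<close> and \<open>\<nabla>v\<close> are seen to be in
  \<open>L\<^sup>p(w)\<close> on \<open>{u > v + \<epsilon>}\<close>, although \<open>\<nabla>v\<close> need not be \<open>p\<close>-integrable near the boundary.  Hence
  both equations can be tested with \<open>min (C \<phi>) (u - v - \<epsilon>)\<^sup>+\<close>, and the terms containing \<open>\<nabla>\<phi>\<close> vanish in
  the limit.  By strict monotonicity \<open>\<nabla>u = \<nabla>v\<close> on \<open>{u > v}\<close>, so \<open>(u - v)\<^sup>+\<close> is constant, and a positive
  constant would force \<open>f = 0\<close>.

  Test functions of Sobolev type are approximated by mollification.  The Muckenhoupt condition bounds
  averages over balls of one fixed radius on \<open>L\<^sup>p(w)\<close> by Fubini's theorem, which suffices for weak convergence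
  of the gradients; no maximal function is needed.
\<close>

section \<open>Smooth functions and a bump function\<close>

text \<open>The obstacle is the boundary condition: only a power \<open>u powr \<alpha>\<close> with
  \<alpha> \<ge> 1 has zero boundary values, so u - v is not an admissible test function. The shift
  by \<epsilon> repairs this. Where u > v + \<epsilon> one has u > \<epsilon>, so u^\<alpha> is at
  least \<epsilon>^(\<alpha>-1) u, and a fixed multiple of u^\<alpha> lies above u - v - \<epsilon>:
  the truncation becomes inactive in the limit. The approximations \<phi> have bounded energy, but
  their gradients need not be small. In the error they carry a factor d that tends to 0 on {u > v +
  \<epsilon>}, where the energies of u and v are integrable. Young's inequality with a parameter t
  splits the error into t times an integral that vanishes by dominated convergence and t^(1-p) times
  the energy bound. As p > 1, t is taken large first and the approximation fine afterwards. The
  positive part is replaced by the C^1 function \<open>G\<close>, so the chain rule is needed only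
  for C^1 functions with bounded derivative, where mollification proves it.\<close>

lemma Ck_on_SucI:
  assumes "\<And>x. (f has_derivative D x) (at x)" "\<And>v. Ck_on k UNIV (\<lambda>x. D x v)"
  shows "Ck_on (Suc k) UNIV f"
proof -
  have "frechet_derivative f (at x) = D x" for x
    using frechet_derivative_at[OF assms(1)] by simp
  then show ?thesis
    using assms by (auto simp: differentiable_def)
qed

lemma Ck_on_SucD:
  assumes "Ck_on (Suc k) UNIV f"
  shows "(f has_derivative frechet_derivative f (at x)) (at x)"
    and "Ck_on k UNIV (\<lambda>x. frechet_derivative f (at x) v)"
  using assms by (auto simp: frechet_derivative_works)

lemma Ck_on_imp_continuous: "Ck_on k UNIV f \<Longrightarrow> continuous_on UNIV f"
  by (cases k) (auto intro!: differentiable_imp_continuous_on simp: differentiable_on_def)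

lemma Ck_on_le_Suc: "Ck_on (Suc k) UNIV f \<Longrightarrow> Ck_on k UNIV f"
proof (induction k arbitrary: f)
  case 0
  then show ?case using Ck_on_imp_continuous[OF 0] by simp
next
  case (Suc k)
  show ?case
    by (rule Ck_on_SucI[OF Ck_on_SucD(1)[OF Suc.prems] Suc.IH[OF Ck_on_SucD(2)[OF Suc.prems]]])
qed

lemma Ck_on_const [simp]: "Ck_on k UNIV (\<lambda>x. c)"
proof (induction k arbitrary: c)
  case (Suc k)
  show ?case
    by (rule Ck_on_SucI[where D="\<lambda>x v. 0"]) (use Suc in auto)
qed simp

lemma Ck_on_add: "Ck_on k UNIV f \<Longrightarrow> Ck_on k UNIV g \<Longrightarrow> Ck_on k UNIV (\<lambda>x. f x + g x)"
proof (induction k arbitrary: f g)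
  case 0
  then show ?case by (auto intro: continuous_intros)
next
  case (Suc k)
  show ?case
    by (rule Ck_on_SucI[OF has_derivative_add[OF Ck_on_SucD(1)[OF Suc.prems(1)] Ck_on_SucD(1)[OF Suc.prems(2)]]
          Suc.IH[OF Ck_on_SucD(2)[OF Suc.prems(1)] Ck_on_SucD(2)[OF Suc.prems(2)]]])
qed

lemma Ck_on_mult: "Ck_on k UNIV f \<Longrightarrow> Ck_on k UNIV g \<Longrightarrow> Ck_on k UNIV (\<lambda>x. f x * g x)"
proof (induction k arbitrary: f g)
  case 0
  then show ?case by (auto intro: continuous_intros)
next
  case (Suc k)
  show ?case
  proof (rule Ck_on_SucI[OF has_derivative_mult[OF Ck_on_SucD(1)[OF Suc.prems(1)] Ck_on_SucD(1)[OF Suc.prems(2)]]])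
    show "Ck_on k UNIV (\<lambda>x. f x * frechet_derivative g (at x) v + frechet_derivative f (at x) v * g x)" for v
      by (intro Ck_on_add Suc.IH Ck_on_SucD(2) Suc.prems Ck_on_le_Suc[OF Suc.prems(1)] Ck_on_le_Suc[OF Suc.prems(2)])
  qed
qed

lemma Ck_on_linear:
  assumes "bounded_linear f" shows "Ck_on k UNIV f"
proof (cases k)
  case 0
  then show ?thesis using assms by (simp add: linear_continuous_on)
next
  case (Suc m)
  then show ?thesis
    by (auto simp del: Ck_on.simps intro!: Ck_on_SucI[where D="\<lambda>x. f"] assms bounded_linear_imp_has_derivative)
qed

text \<open>A directional derivative of the composite is again an affine composite, of the
  derivative of f in the direction \<open>a *\<^sub>R v\<close>, so the induction closes.\<close>

lemma Ck_on_affine: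
  assumes "Ck_on k UNIV f" shows "Ck_on k UNIV (\<lambda>x. f (a *\<^sub>R x + c))"
  using assms
proof (induction k arbitrary: f)
  case 0
  then show ?case by (auto intro!: continuous_intros continuous_on_compose2[of UNIV f])
next
  case (Suc k)
  let ?D = "\<lambda>x. frechet_derivative f (at x)"
  have "((\<lambda>x. f (a *\<^sub>R x + c)) has_derivative (\<lambda>v. ?D (a *\<^sub>R x + c) (a *\<^sub>R v))) (at x)" for x
    by (rule has_derivative_compose[OF _ Ck_on_SucD(1)[OF Suc.prems]]) (auto intro!: derivative_eq_intros)
  moreover have "Ck_on k UNIV (\<lambda>x. ?D (a *\<^sub>R x + c) (a *\<^sub>R v))" for v
    by (rule Suc.IH[OF Ck_on_SucD(2)[OF Suc.prems]])
  ultimately show ?case by (rule Ck_on_SucI)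
qed

lemma smooth_on_affine: "smooth_on UNIV f \<Longrightarrow> smooth_on UNIV (\<lambda>x. f (a *\<^sub>R x + c))"
  by (simp add: smooth_on_def Ck_on_affine)

lemma smooth_on_cmult: "smooth_on UNIV f \<Longrightarrow> smooth_on UNIV (\<lambda>x. c * f x)"
  by (simp add: smooth_on_def Ck_on_mult)

text \<open>The factor \<open>1 / t ^ m\<close> makes the family closed under differentiation: each
  derivative is a combination of two members with larger m. Smoothness of exp(-1/t), extended by 0,
  is then one induction on the order, for all m together.\<close>

definition flat :: "nat \<Rightarrow> real \<Rightarrow> real" where
  "flat m t = (if 0 < t then exp (- 1 / t) / t ^ m else 0)"

lemma flat_tendsto_0: "((\<lambda>t. exp (- 1 / t) / t ^ m) \<longlongrightarrow> (0::real)) (at_right 0)"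
  by real_asymp

lemma flat_has_derivative:
  "(flat m has_real_derivative flat (m + 2) t - real m * flat (m + 1) t) (at t)"
proof -
  consider "t < 0" | "t = 0" | "t > 0" by linarith
  then show ?thesis
  proof cases
    case 1
    have "((\<lambda>_. 0) has_real_derivative 0) (at t)" by simp
    moreover have "\<forall>\<^sub>F x in nhds t. 0 = flat m x"
      using eventually_nhds_in_open[of "{..<0}" t] 1
      by (auto elim!: eventually_mono simp: flat_def)
    ultimately show ?thesis
      using 1 DERIV_cong_ev[of t t "\<lambda>_. 0" "flat m" 0 0] by (simp add: flat_def)
  next
    case 2
    \<comment> \<open>At 0 the difference quotient from the right is \<open>flat (m + 1) h\<close>:
      dividing by h only raises the exponent, and exp(-1/h) beats every power.\<close>
    have "((\<lambda>h. flat m h / h) \<longlongrightarrow> 0) (at_right 0)"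
      by (rule Lim_transform_eventually[OF flat_tendsto_0[of "m+1"]])
         (auto simp: eventually_at_filter flat_def intro!: always_eventually)
    moreover have "((\<lambda>h. flat m h / h) \<longlongrightarrow> 0) (at_left 0)"
      by (rule Lim_transform_eventually[OF tendsto_const])
         (auto simp: eventually_at_filter flat_def intro!: always_eventually)
    ultimately show ?thesis
      using 2 by (simp add: DERIV_def flat_def[of _ 0] filterlim_at_split)
  next
    case 3
    have "((\<lambda>x. exp (- 1 / x) / x ^ m) has_real_derivative flat (m + 2) t - real m * flat (m + 1) t) (at t)"
    proof -
      have "((\<lambda>x. exp (- 1 / x) * (1 / x) ^ m) has_real_derivative
          (1 / t\<^sup>2) * exp (- 1 / t) * (1 / t) ^ m + exp (- 1 / t) * (real m * (1 / t) ^ (m - 1) * (- 1 / t\<^sup>2))) (at t)"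
        using 3 by (auto intro!: derivative_eq_intros simp: power2_eq_square)
      moreover have "(1 / t\<^sup>2) * exp (- 1 / t) * (1 / t) ^ m + exp (- 1 / t) * (real m * (1 / t) ^ (m - 1) * (- 1 / t\<^sup>2))
          = flat (m + 2) t - real m * flat (m + 1) t"
        using 3 by (cases m) (simp_all add: flat_def power_add power_divide power2_eq_square mult_ac)
      ultimately show ?thesis by (simp add: power_divide)
    qed
    moreover have "\<forall>\<^sub>F x in nhds t. exp (- 1 / x) / x ^ m = flat m x"
      using eventually_nhds_in_open[of "{0<..}" t] 3
      by (auto elim!: eventually_mono simp: flat_def)
    ultimately show ?thesis
      using DERIV_cong_ev[of t t "\<lambda>x. exp (- 1 / x) / x ^ m" "flat m"] by simp
  qed
qed

text \<open>The standard mollifier exp(-1/(1 - |x|^2)) on the unit ball, not normalised. The inner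
  product keeps the argument of \<open>flat\<close> polynomial in x.\<close>

definition bump :: "'a::euclidean_space \<Rightarrow> real" where
  "bump x = flat 0 (1 - x \<bullet> x)"

lemma smooth_on_bump: "smooth_on UNIV bump"
proof -
  have "Ck_on k UNIV (\<lambda>x::'a. flat m (1 - x \<bullet> x))" for k m
  proof (induction k arbitrary: m)
    case 0
    have "continuous_on UNIV (flat m)"
      by (rule DERIV_continuous_on) (rule has_field_derivative_at_within[OF flat_has_derivative])
    then show ?case
      by (auto intro!: continuous_intros continuous_on_compose2[of UNIV "flat m"])
  next
    case (Suc k)
    let ?q = "\<lambda>x::'a. 1 - x \<bullet> x"
    let ?D = "\<lambda>x::'a. flat (m + 2) (?q x) + (- real m) * flat (m + 1) (?q x)"
    show ?case
    proof (rule Ck_on_SucI)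
      show "((\<lambda>x. flat m (?q x)) has_derivative (\<lambda>v. ?D x * ((- 2) * (x \<bullet> v)))) (at x)" for x
      proof -
        have "(?q has_derivative (\<lambda>v. (- 2) * (x \<bullet> v))) (at x)"
          by (auto intro!: derivative_eq_intros simp: inner_commute)
        from has_derivative_compose[OF this flat_has_derivative[THEN has_field_derivative_imp_has_derivative]]
        show ?thesis by simp
      qed
      show "Ck_on k UNIV (\<lambda>x. ?D x * ((- 2) * (x \<bullet> v)))" for v
        by (intro Ck_on_mult Ck_on_add Suc.IH Ck_on_const Ck_on_linear bounded_linear_inner_left)
    qed
  qed
  then show ?thesis
    by (auto simp: smooth_on_def bump_def[abs_def])
qed

lemma bump_nonneg: "0 \<le> bump x" and bump_le_1: "bump x \<le> 1"
  by (auto simp: bump_def flat_def)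

lemma bump_pos_iff: "0 < bump x \<longleftrightarrow> norm x < 1"
proof -
  have "norm x < 1 \<longleftrightarrow> x \<bullet> x < 1"
    by (simp add: norm_eq_sqrt_inner)
  then show ?thesis by (auto simp: bump_def flat_def)
qed

lemma bump_eq_0: "1 \<le> norm x \<Longrightarrow> bump x = 0"
  using bump_pos_iff[of x] bump_nonneg[of x] by linarith

section \<open>Mollification\<close>

text \<open>Sigma-finiteness of the completed measure is the prerequisite of the Fubini and Tonelli
  exchanges for mollifications.\<close>

interpretation lebesgue: sigma_finite_measure "lebesgue :: 'a::euclidean_space measure"
proof
  show "\<exists>A::'a set set. countable A \<and> A \<subseteq> sets lebesgue \<and> \<Union> A = space lebesgue \<and> (\<forall>a\<in>A. emeasure lebesgue a \<noteq> \<infinity>)"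
  proof (intro exI conjI ballI)
    show "countable (range (\<lambda>n::nat. ball (0::'a) (real n)))" by simp
    show "\<Union> (range (\<lambda>n::nat. ball (0::'a) (real n))) = space lebesgue"
      by (auto simp: reals_Archimedean2)
    show "emeasure lebesgue a \<noteq> \<infinity>" if "a \<in> range (\<lambda>n::nat. ball (0::'a) (real n))" for a
      using that less_imp_neq[OF emeasure_lborel_ball_finite[of "0::'a"]] by auto
  qed auto
qed

interpretation lebesgue_pair: pair_sigma_finite lebesgue lebesgue ..

lemma borel_measurable_lebesgue_compose:
  assumes "f \<in> borel_measurable borel" shows "f \<in> borel_measurable lebesgue"
  using assms by (simp add: measurable_completion)

text \<open>The product here is that of two completed sigma-algebras. The projections are still
  Borel measurable, which covers kernels in x - y.\<close>

lemma fst_lebesgue_borel [measurable]: "fst \<in> borel_measurable ((lebesgue :: 'a::euclidean_space measure) \<Otimes>\<^sub>M M)"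
  using measurable_compose[OF measurable_fst id_borel_measurable_lebesgue] by (simp add: comp_def)

lemma snd_lebesgue_borel [measurable]: "snd \<in> borel_measurable (M \<Otimes>\<^sub>M (lebesgue :: 'a::euclidean_space measure))"
  using measurable_compose[OF measurable_snd id_borel_measurable_lebesgue] by (simp add: comp_def)

lemma nn_integral_lebesgue_reflect:
  fixes f :: "'a::euclidean_space \<Rightarrow> ennreal"
  assumes [measurable]: "f \<in> borel_measurable borel"
  shows "(\<integral>\<^sup>+y. f (x - y) \<partial>lebesgue) = (\<integral>\<^sup>+y. f y \<partial>lebesgue)"
proof -
  have "(\<integral>\<^sup>+y. f y \<partial>lborel) = (\<integral>\<^sup>+y. f y \<partial>density (distr lborel borel (\<lambda>y. x + (-1) *\<^sub>R y)) (\<lambda>_. 1))"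
    using lborel_affine[of "-1" x] by simp
  also have "\<dots> = (\<integral>\<^sup>+y. f (x - y) \<partial>lborel)"
    by (simp add: nn_integral_density nn_integral_distr)
  finally show ?thesis by (simp add: nn_integral_completion)
qed

lemma nn_integral_lebesgue_translate:
  fixes f :: "'a::euclidean_space \<Rightarrow> ennreal"
  assumes [measurable]: "f \<in> borel_measurable borel"
  shows "(\<integral>\<^sup>+y. f (y - x) \<partial>lebesgue) = (\<integral>\<^sup>+y. f y \<partial>lebesgue)"
proof -
  have "(\<integral>\<^sup>+y. f (y - x) \<partial>lebesgue) = (\<integral>\<^sup>+y. f (0 - (x - y)) \<partial>lebesgue)" by simp
  also have "\<dots> = (\<integral>\<^sup>+y. f (0 - y) \<partial>lebesgue)"
    by (rule nn_integral_lebesgue_reflect) simp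
  also have "\<dots> = (\<integral>\<^sup>+y. f y \<partial>lebesgue)"
    by (rule nn_integral_lebesgue_reflect) simp
  finally show ?thesis .
qed

text \<open>Normalised by the actual integral instead of a power of r: unit mass holds by
  construction, and the only quantitative input is a lower bound for that integral.\<close>

definition kern :: "real \<Rightarrow> 'a::euclidean_space \<Rightarrow> real" where
  "kern r z = inverse (LINT z|lebesgue. bump ((1 / r) *\<^sub>R z :: 'a)) * bump ((1 / r) *\<^sub>R z)"

lemma smooth_on_kern: "smooth_on UNIV (kern r)"
  using smooth_on_cmult[OF smooth_on_affine[OF smooth_on_bump, of "1 / r" 0]]
  by (simp add: kern_def[abs_def])

lemma continuous_on_kern: "continuous_on UNIV (kern r)"
  using smooth_on_kern[of r, unfolded smooth_on_def, rule_format, of 0] by simp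

lemma borel_measurable_kern [measurable]: "kern r \<in> borel_measurable borel"
  by (rule borel_measurable_continuous_onI[OF continuous_on_kern])

lemma integrable_bump_scaled:
  assumes "0 < r"
  shows "integrable lebesgue (\<lambda>z::'a::euclidean_space. bump ((1 / r) *\<^sub>R z))"
proof (rule Bochner_Integration.integrable_bound)
  show "integrable lebesgue (indicat_real (cball (0::'a) r))"
    by (simp add: lmeasurable_iff_integrable[symmetric])
  have "continuous_on UNIV (\<lambda>z::'a. bump ((1 / r) *\<^sub>R z))"
    using smooth_on_affine[OF smooth_on_bump, of "1 / r" 0, unfolded smooth_on_def, rule_format, of 0] by simp
  then show "(\<lambda>z::'a. bump ((1 / r) *\<^sub>R z)) \<in> borel_measurable lebesgue"
    by (intro borel_measurable_lebesgue_compose borel_measurable_continuous_onI)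
  show "AE z::'a in lebesgue. norm (bump ((1 / r) *\<^sub>R z)) \<le> norm (indicat_real (cball 0 r) z)"
    using assms
    by (intro AE_I2) (auto simp: indicator_def field_simps bump_nonneg bump_le_1 bump_eq_0)
qed

text \<open>On the ball of half the radius, 1 - |z|^2 exceeds 3/4 for the rescaled point z, so
  \<open>bump\<close> is at least exp(-4/3) there.\<close>

lemma integral_bump_scaled_ge:
  assumes "0 < r"
  shows "exp (- (4 / 3)) * measure lebesgue (ball (0::'a::euclidean_space) (r / 2))
    \<le> (LINT z|lebesgue. bump ((1 / r) *\<^sub>R z :: 'a))"
proof -
  have "exp (- (4 / 3)) * measure lebesgue (ball (0::'a) (r / 2))
      = (LINT z|lebesgue. exp (- (4 / 3)) * indicat_real (ball (0::'a) (r / 2)) z)"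
    by (simp add: )
  also have "\<dots> \<le> (LINT z|lebesgue. bump ((1 / r) *\<^sub>R z :: 'a))"
  proof (rule integral_mono)
    show "integrable lebesgue (\<lambda>z. exp (- (4 / 3)) * indicat_real (ball (0::'a) (r / 2)) z)"
      by (intro integrable_mult_right) (simp add: lmeasurable_iff_integrable[symmetric])
    fix z :: 'a
    show "exp (- (4 / 3)) * indicat_real (ball 0 (r / 2)) z \<le> bump ((1 / r) *\<^sub>R z)"
    proof (cases "norm z < r / 2")
      case True
      let ?z = "(1 / r) *\<^sub>R z"
      have "norm ?z < 1 / 2" using True assms by (simp add: field_simps)
      then have "(norm ?z)\<^sup>2 < (1 / 2)\<^sup>2" by (intro power_strict_mono) auto
      then have *: "?z \<bullet> ?z < 1 / 4" by (simp only: power2_norm_eq_inner) (simp add: power2_eq_square)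
      have "1 / (1 - q) \<le> 4 / 3" "0 < 1 - q" if "q < 1 / 4" for q :: real
        using that by (simp_all add: divide_simps)
      from this[OF *] show ?thesis using True by (simp add: bump_def flat_def)
    qed (simp add: bump_nonneg)
  qed (rule integrable_bump_scaled[OF assms])
  finally show ?thesis .
qed

lemma integral_bump_scaled_pos:
  "0 < r \<Longrightarrow> 0 < (LINT z|lebesgue. bump ((1 / r) *\<^sub>R z :: 'a::euclidean_space))"
  by (rule less_le_trans[OF _ integral_bump_scaled_ge]) (simp_all add: content_ball_pos)

lemma kern_nonneg: "0 < r \<Longrightarrow> 0 \<le> kern r z"
  using integral_bump_scaled_pos[of r, where 'a='a] by (simp add: kern_def bump_nonneg)

lemma kern_eq_0: "0 < r \<Longrightarrow> r \<le> norm z \<Longrightarrow> kern r z = 0"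
  by (simp add: kern_def bump_eq_0 field_simps)

lemma kern_minus: "kern r (x - y) = kern r (y - x)"
  by (simp add: kern_def bump_def inner_diff algebra_simps inner_commute)

text \<open>The height is comparable to the reciprocal volume of a ball of radius r, so
  mollification is controlled by ball averages. This is what links it to the Muckenhoupt
  condition.\<close>

lemma kern_le:
  assumes "0 < r"
  shows "kern r (z::'a::euclidean_space) \<le> exp (4 / 3) / measure lebesgue (ball (0::'a) (r / 2))"
proof -
  let ?m = "measure lebesgue (ball (0::'a) (r / 2))" and ?I = "LINT z|lebesgue. bump ((1 / r) *\<^sub>R z :: 'a)"
  have m: "0 < ?m" using assms by (simp add: content_ball_pos)
  have "kern r z \<le> inverse ?I"
    using integral_bump_scaled_pos[OF assms, where 'a='a] bump_le_1
    by (simp add: kern_def mult_left_le)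
  also have "\<dots> \<le> inverse (exp (- (4 / 3)) * ?m)"
    using integral_bump_scaled_ge[OF assms, where 'a='a] m by (intro le_imp_inverse_le) auto
  also have "\<dots> = exp (4 / 3) / ?m" by (simp add: exp_minus field_simps)
  finally show ?thesis .
qed

lemma integrable_kern: "0 < r \<Longrightarrow> integrable lebesgue (kern r)"
  unfolding kern_def[abs_def] by (intro integrable_mult_right integrable_bump_scaled)

lemma integral_kern: "0 < r \<Longrightarrow> (LINT z|lebesgue. kern r (z::'a::euclidean_space)) = 1"
  using integral_bump_scaled_pos[of r, where 'a='a] unfolding kern_def[abs_def]
  by (subst integral_mult_right_zero) auto

lemma nn_integral_kern:
  assumes "0 < r"
  shows "(\<integral>\<^sup>+z. ennreal (kern r (z - x)) \<partial>lebesgue) = 1" "(\<integral>\<^sup>+z. ennreal (kern r (x - z)) \<partial>lebesgue) = 1"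
proof -
  have "(\<integral>\<^sup>+z. ennreal (kern r z) \<partial>lebesgue) = 1"
    by (subst nn_integral_eq_integral[OF integrable_kern])
       (simp_all add: assms kern_nonneg integral_kern)
  then show "(\<integral>\<^sup>+z. ennreal (kern r (z - x)) \<partial>lebesgue) = 1"
    by (subst nn_integral_lebesgue_translate[of "\<lambda>z. ennreal (kern r z)"]) simp_all
  then show "(\<integral>\<^sup>+z. ennreal (kern r (x - z)) \<partial>lebesgue) = 1"
    by (simp add: kern_minus[of r x])
qed

section \<open>Convolution with the kernel: contraction and pointwise bounds\<close>

definition moll :: "real \<Rightarrow> ('a::euclidean_space \<Rightarrow> 'b::euclidean_space) \<Rightarrow> 'a \<Rightarrow> 'b" where
  "moll r f x = (LINT y|lebesgue. kern r (x - y) *\<^sub>R f y)"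

lemma borel_measurable_moll_integrand:
  assumes [measurable]: "f \<in> borel_measurable lebesgue"
  shows "(\<lambda>y. kern r (x - y) *\<^sub>R (f y :: 'b::euclidean_space)) \<in> borel_measurable lebesgue"
  by (intro borel_measurable_scaleR assms borel_measurable_lebesgue_compose) measurable

lemma borel_measurable_moll_pair:
  assumes [measurable]: "(f :: 'a::euclidean_space \<Rightarrow> 'b::euclidean_space) \<in> borel_measurable lebesgue"
  shows "(\<lambda>(x, y). kern r (x - y) *\<^sub>R f y) \<in> borel_measurable (lebesgue \<Otimes>\<^sub>M lebesgue)"
proof -
  have "(\<lambda>z. kern r (fst z - snd z) *\<^sub>R f (snd z)) \<in> borel_measurable (lebesgue \<Otimes>\<^sub>M lebesgue)"
    by (intro borel_measurable_scaleR measurable_compose[OF _ borel_measurable_kern]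
        measurable_compose[OF measurable_snd assms] borel_measurable_diff
        fst_lebesgue_borel snd_lebesgue_borel)
  then show ?thesis by (simp add: case_prod_unfold)
qed

lemma borel_measurable_moll:
  assumes "f \<in> borel_measurable lebesgue"
  shows "moll r f \<in> borel_measurable lebesgue"
  unfolding moll_def[abs_def]
  by (rule lebesgue.borel_measurable_lebesgue_integral[OF borel_measurable_moll_pair[OF assms]])

lemma integrable_moll_integrand:
  assumes "integrable lebesgue (f :: 'a::euclidean_space \<Rightarrow> 'b::euclidean_space)" "0 < r"
  shows "integrable lebesgue (\<lambda>y. kern r (x - y) *\<^sub>R f y)"
proof -
  let ?M = "exp (4 / 3) / measure lebesgue (ball (0::'a) (r / 2))"
  show ?thesis
  proof (rule Bochner_Integration.integrable_bound)
    show "integrable lebesgue (\<lambda>y. ?M *\<^sub>R f y)" using assms by simp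
    show "(\<lambda>y. kern r (x - y) *\<^sub>R f y) \<in> borel_measurable lebesgue"
      using assms by (intro borel_measurable_moll_integrand) simp
    show "AE y in lebesgue. norm (kern r (x - y) *\<^sub>R f y) \<le> norm (?M *\<^sub>R f y)"
    proof (intro AE_I2)
      fix y
      have "norm (kern r (x - y)) \<le> ?M"
        using kern_le[OF assms(2), of "x - y"] kern_nonneg[OF assms(2), of "x - y"] by simp
      then show "norm (kern r (x - y) *\<^sub>R f y) \<le> norm (?M *\<^sub>R f y)"
        using mult_right_mono[of "norm (kern r (x - y))" ?M "norm (f y)"] by simp
    qed
  qed
qed

lemma norm_moll_le:
  assumes "integrable lebesgue f" "0 < r"
  shows "ennreal (norm (moll r f x)) \<le> (\<integral>\<^sup>+y. ennreal (kern r (x - y)) * ennreal (norm (f y)) \<partial>lebesgue)"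
proof -
  have "ennreal (norm (moll r f x)) \<le> (\<integral>\<^sup>+y. ennreal (norm (kern r (x - y) *\<^sub>R f y)) \<partial>lebesgue)"
    unfolding moll_def by (rule integral_norm_bound_ennreal[OF integrable_moll_integrand[OF assms]])
  also have "\<dots> = (\<integral>\<^sup>+y. ennreal (kern r (x - y)) * ennreal (norm (f y)) \<partial>lebesgue)"
    by (simp add: kern_nonneg assms ennreal_mult)
  finally show ?thesis .
qed

text \<open>Tonelli's theorem: for fixed y the kernel has unit mass in x, so convolution does not
  increase the L1 norm.\<close>

lemma nn_integral_norm_moll_le:
  assumes f: "integrable lebesgue (f :: 'a::euclidean_space \<Rightarrow> 'b::euclidean_space)" and "0 < r"
  shows "(\<integral>\<^sup>+x. ennreal (norm (moll r f x)) \<partial>lebesgue) \<le> (\<integral>\<^sup>+y. ennreal (norm (f y)) \<partial>lebesgue)"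
proof -
  have [measurable]: "f \<in> borel_measurable lebesgue" using f by simp
  have "(\<integral>\<^sup>+x. ennreal (norm (moll r f x)) \<partial>lebesgue)
      \<le> (\<integral>\<^sup>+x. (\<integral>\<^sup>+y. ennreal (kern r (x - y)) * ennreal (norm (f y)) \<partial>lebesgue) \<partial>lebesgue)"
    by (intro nn_integral_mono norm_moll_le assms)
  also have "\<dots> = (\<integral>\<^sup>+y. (\<integral>\<^sup>+x. ennreal (kern r (x - y)) * ennreal (norm (f y)) \<partial>lebesgue) \<partial>lebesgue)"
  proof (rule lebesgue_pair.Fubini'[symmetric])
    have "(\<lambda>z. ennreal (kern r (fst z - snd z)) * ennreal (norm (f (snd z)))) \<in> borel_measurable (lebesgue \<Otimes>\<^sub>M lebesgue)"
      by (intro borel_measurable_times_ennreal measurable_compose[OF _ measurable_ennreal] measurable_compose[OF _ borel_measurable_kern]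
        measurable_compose[OF measurable_snd] borel_measurable_diff borel_measurable_norm
        fst_lebesgue_borel snd_lebesgue_borel) measurable
    then show "(\<lambda>(x, y). ennreal (kern r (x - y)) * ennreal (norm (f y))) \<in> borel_measurable (lebesgue \<Otimes>\<^sub>M lebesgue)"
      by (simp add: case_prod_unfold)
  qed
  also have "\<dots> = (\<integral>\<^sup>+y. ennreal (norm (f y)) \<partial>lebesgue)"
  proof (rule nn_integral_cong)
    fix y :: 'a
    have "(\<lambda>x. ennreal (kern r (x - y))) \<in> borel_measurable lebesgue"
      by (intro borel_measurable_lebesgue_compose) measurable
    then show "(\<integral>\<^sup>+x. ennreal (kern r (x - y)) * ennreal (norm (f y)) \<partial>lebesgue) = ennreal (norm (f y))"
      by (subst nn_integral_multc) (simp_all add: nn_integral_kern assms)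
  qed
  finally show ?thesis .
qed

lemma integrable_moll:
  assumes "integrable lebesgue f" "0 < r"
  shows "integrable lebesgue (moll r f)"
    and "(LINT x|lebesgue. norm (moll r f x)) \<le> (LINT x|lebesgue. norm (f x))"
proof -
  have fin: "(\<integral>\<^sup>+y. ennreal (norm (f y)) \<partial>lebesgue) < \<infinity>"
    using assms by (simp add: integrable_iff_bounded)
  show "integrable lebesgue (moll r f)"
    using nn_integral_norm_moll_le[OF assms] fin assms
    by (auto simp: integrable_iff_bounded borel_measurable_moll)
  note int = this
  have "ennreal (LINT x|lebesgue. norm (moll r f x)) \<le> ennreal (LINT x|lebesgue. norm (f x))"
    using nn_integral_norm_moll_le[OF assms] int assms
    by (simp add: nn_integral_eq_integral)
  then show "(LINT x|lebesgue. norm (moll r f x)) \<le> (LINT x|lebesgue. norm (f x))"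
    by (simp add: integral_nonneg_AE)
qed

lemma moll_add:
  assumes "integrable lebesgue f" "integrable lebesgue g" "0 < r"
  shows "moll r (\<lambda>x. f x + g x) x = moll r f x + moll r g x"
  using integrable_moll_integrand[OF assms(1,3), of x] integrable_moll_integrand[OF assms(2,3), of x]
  by (simp add: moll_def scaleR_add_right)

lemma moll_eq_0:
  assumes "\<And>y. dist x y < r \<Longrightarrow> f y = 0" "0 < r"
  shows "moll r f x = 0"
proof -
  have "kern r (x - y) *\<^sub>R f y = 0" for y
    using assms(1)[of y] kern_eq_0[OF assms(2), of "x - y"] by (cases "dist x y < r") (auto simp: dist_norm)
  then show ?thesis unfolding moll_def by (simp only: integral_zero)
qed

lemma integral_kern_reflect: "0 < r \<Longrightarrow> integrable lebesgue (\<lambda>y. kern r (x - y))"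
  "0 < r \<Longrightarrow> (LINT y|lebesgue. kern r (x - y)) = 1"
proof -
  assume r: "0 < r"
  have m: "(\<lambda>y. kern r (x - y)) \<in> borel_measurable lebesgue"
    by (intro borel_measurable_lebesgue_compose) measurable
  show "integrable lebesgue (\<lambda>y. kern r (x - y))"
    using m nn_integral_kern(2)[OF r, of x] by (simp add: integrable_iff_bounded kern_nonneg r)
  show "(LINT y|lebesgue. kern r (x - y)) = 1"
    using m nn_integral_kern(2)[OF r, of x] by (subst integral_eq_nn_integral) (auto simp: kern_nonneg r)
qed

lemma norm_moll_bounded:
  assumes "integrable lebesgue f" "0 < r" "\<And>y. norm (f y) \<le> M"
  shows "norm (moll r f x) \<le> M"
proof -
  have "norm (moll r f x) \<le> (LINT y|lebesgue. norm (kern r (x - y) *\<^sub>R f y))"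
    unfolding moll_def by (rule integral_norm_bound)
  also have "\<dots> \<le> (LINT y|lebesgue. kern r (x - y) * M)"
    using assms by (intro integral_mono integrable_norm integrable_moll_integrand integrable_mult_left integral_kern_reflect)
      (auto simp: kern_nonneg mult_left_mono)
  also have "\<dots> = M" using integral_kern_reflect[OF assms(2), of x] by simp
  finally show ?thesis .
qed

text \<open>Unit mass turns the difference into an average of f - a over the ball of radius r. Used
  with a value of a continuous function, and with e = 0 to see that a mollified indicator is exactly
  1 well inside the set.\<close>

lemma norm_moll_diff_le:
  assumes "integrable lebesgue f" "0 < r" "\<And>y. dist x y < r \<Longrightarrow> norm (f y - a) \<le> e"
  shows "norm (moll r f x - a) \<le> e"
proof -
  have "moll r f x - a = (LINT y|lebesgue. kern r (x - y) *\<^sub>R (f y - a))"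
    using integrable_moll_integrand[OF assms(1,2), of x] integral_kern_reflect[OF assms(2), of x]
    by (simp add: moll_def scaleR_diff_right)
  also have "norm \<dots> \<le> (LINT y|lebesgue. norm (kern r (x - y) *\<^sub>R (f y - a)))"
    by (rule integral_norm_bound)
  also have "\<dots> \<le> (LINT y|lebesgue. kern r (x - y) * e)"
  proof (intro integral_mono integrable_norm)
    show "integrable lebesgue (\<lambda>y. kern r (x - y) *\<^sub>R (f y - a))"
      using integrable_moll_integrand[OF assms(1,2), of x] integral_kern_reflect[OF assms(2), of x]
      by (simp add: scaleR_diff_right)
    show "norm (kern r (x - y) *\<^sub>R (f y - a)) \<le> kern r (x - y) * e" for y
      using assms(3)[of y] kern_eq_0[OF assms(2), of "x - y"] kern_nonneg[OF assms(2), of "x - y"]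
      by (cases "dist x y < r") (auto simp: dist_norm mult_left_mono)
  qed (use integral_kern_reflect[OF assms(2), of x] in auto)
  also have "\<dots> = e" using integral_kern_reflect[OF assms(2), of x] by simp
  finally show ?thesis .
qed

section \<open>Approximation by continuous functions and L1 convergence of mollifications\<close>

definition clip :: "real \<Rightarrow> 'b::euclidean_space \<Rightarrow> 'b" where
  "clip k y = (k / max k (norm y)) *\<^sub>R y"

lemma norm_clip_le: "0 < k \<Longrightarrow> norm (clip k y) \<le> k"
  by (simp add: clip_def divide_simps)

lemma norm_clip_le_norm: "0 < k \<Longrightarrow> norm (clip k y) \<le> norm y"
  by (auto simp: clip_def divide_simps mult_left_le max_def mult_right_mono)

lemma clip_eq: "norm y \<le> k \<Longrightarrow> clip k y = y"
  by (cases "k = 0") (auto simp: clip_def max_def)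

lemma continuous_on_clip: "0 < k \<Longrightarrow> continuous_on S (clip k)"
  unfolding clip_def[abs_def] by (intro continuous_intros) auto

lemma borel_measurable_clip: "0 < k \<Longrightarrow> clip k \<in> borel_measurable borel"
  by (intro borel_measurable_continuous_onI continuous_on_clip)

lemma integrable_continuous_compact:
  fixes g :: "'a::euclidean_space \<Rightarrow> 'b::euclidean_space"
  assumes "continuous_on UNIV g" "compact K"
  shows "integrable lebesgue (\<lambda>x. indicator K x *\<^sub>R g x)"
proof -
  have "integrable lborel (\<lambda>x. indicator K x *\<^sub>R g x)"
    using borel_integrable_compact[OF assms(2) continuous_on_subset[OF assms(1)]] by simp
  then show ?thesis by (subst integrable_completion) auto
qed

lemma integrable_indicator_compact:
  "compact K \<Longrightarrow> integrable lebesgue (\<lambda>x::'a::euclidean_space. indicator K x * (c::real))"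
  using integrable_continuous_compact[of "\<lambda>_. c" K] by simp

text \<open>Measurability provides continuous functions converging almost everywhere, but without an
  integrable majorant. Composing with the radial truncation \<open>clip k\<close> keeps them
  continuous and bounds them by k, which suffices on a compact set; truncating f itself costs little
  in L1 once k is large.\<close>

lemma continuous_approx_L1:
  fixes f :: "'a::euclidean_space \<Rightarrow> 'b::euclidean_space"
  assumes f: "integrable lebesgue f" and K: "compact K" and e: "0 < e"
  obtains g where "continuous_on UNIV g" "(LINT x|lebesgue. indicator K x * norm (f x - g x)) < e"
proof -
  have [measurable]: "f \<in> borel_measurable lebesgue" using f by simp
  have [measurable]: "K \<in> sets lebesgue" using K by (simp add: borel_compact)
  have mc: "clip k \<in> borel_measurable borel" if "0 < k" for k
    using borel_measurable_clip[OF that] .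
  \<comment> \<open>\<open>Suc k\<close> keeps the truncation radius positive even at k = 0.\<close>
  have "(\<lambda>k. LINT x|lebesgue. indicator K x * norm (f x - clip (real (Suc k)) (f x))) \<longlonglongrightarrow> (LINT x::'a|lebesgue. (0::real))"
  proof (rule integral_dominated_convergence[where f="\<lambda>_. 0 :: real" and w="\<lambda>x. 2 * norm (f x)"])
    show "AE x in lebesgue. (\<lambda>k. indicator K x * norm (f x - clip (real (Suc k)) (f x))) \<longlonglongrightarrow> 0"
    proof (intro AE_I2 tendsto_eventually)
      fix x
      obtain N :: nat where "norm (f x) \<le> real N" using real_arch_simple by blast
      then show "\<forall>\<^sub>F k in sequentially. indicator K x * norm (f x - clip (real (Suc k)) (f x)) = 0"
        by (intro eventually_sequentiallyI[of N]) (simp add: clip_eq)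
    qed
    show "AE x in lebesgue. norm (indicator K x * norm (f x - clip (real (Suc k)) (f x))) \<le> 2 * norm (f x)" for k
    proof (intro AE_I2)
      fix x
      have "norm (f x - clip (real (Suc k)) (f x)) \<le> 2 * norm (f x)"
        using norm_triangle_ineq4[of "f x" "clip (real (Suc k)) (f x)"] norm_clip_le_norm[of "real (Suc k)" "f x"] by simp
      then show "norm (indicator K x * norm (f x - clip (real (Suc k)) (f x))) \<le> 2 * norm (f x)"
        by (auto simp: indicator_def)
    qed
    show "(\<lambda>x. indicator K x * norm (f x - clip (real (Suc k)) (f x))) \<in> borel_measurable lebesgue" for k
      using mc[of "real (Suc k)"] by measurable
  qed (use f in auto)
  then have "\<forall>\<^sub>F k in sequentially. (LINT x|lebesgue. indicator K x * norm (f x - clip (real (Suc k)) (f x))) < e / 2"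
    using e by (intro order_tendstoD(2)) auto
  then obtain k0 where "(LINT x|lebesgue. indicator K x * norm (f x - clip (real (Suc k0)) (f x))) < e / 2"
    by (auto simp: eventually_sequentially)
  then obtain k where k: "0 < k" "(LINT x|lebesgue. indicator K x * norm (f x - clip k (f x))) < e / 2"
    by (metis of_nat_0_less_iff zero_less_Suc)
  note mk = mc[OF k(1)]
  have "f measurable_on UNIV"
    by (simp add: lebesgue_measurable_imp_measurable_on)
  then obtain N g where g: "negligible N" "\<And>n. continuous_on UNIV (g n)" "\<And>x. x \<notin> N \<Longrightarrow> (\<lambda>n. g n x) \<longlonglongrightarrow> f x"
    unfolding measurable_on_def by auto
  have mg [measurable]: "g n \<in> borel_measurable lebesgue" for n
    using g(2) by (intro borel_measurable_lebesgue_compose borel_measurable_continuous_onI)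
  have "(\<lambda>n. LINT x|lebesgue. indicator K x * norm (clip k (f x) - clip k (g n x))) \<longlonglongrightarrow> (LINT x::'a|lebesgue. (0::real))"
  proof (rule integral_dominated_convergence[where f="\<lambda>_. 0 :: real" and w="\<lambda>x. indicator K x * (2 * k)"])
    have "AE x in lebesgue. x \<notin> N"
      using g(1) by (intro AE_not_in) (simp add: negligible_iff_null_sets)
    then show "AE x in lebesgue. (\<lambda>n. indicator K x * norm (clip k (f x) - clip k (g n x))) \<longlonglongrightarrow> 0"
    proof eventually_elim
      case (elim x)
      have "(\<lambda>n. clip k (g n x)) \<longlonglongrightarrow> clip k (f x)"
        by (rule continuous_on_tendsto_compose[OF continuous_on_clip[OF k(1), of UNIV] g(3)[OF elim]]) auto
      from tendsto_mult_right_zero[OF tendsto_norm_zero[OF LIM_zero[OF this]], of "indicator K x"]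
      show ?case by (simp add: norm_minus_commute)
    qed
    show "AE x in lebesgue. norm (indicator K x * norm (clip k (f x) - clip k (g n x))) \<le> indicator K x * (2 * k)" for n
    proof (intro AE_I2)
      fix x
      have "norm (clip k (f x) - clip k (g n x)) \<le> 2 * k"
        using norm_triangle_ineq4[of "clip k (f x)" "clip k (g n x)"] norm_clip_le[OF k(1), of "f x"] norm_clip_le[OF k(1), of "g n x"] by simp
      then show "norm (indicator K x * norm (clip k (f x) - clip k (g n x))) \<le> indicator K x * (2 * k)"
        by (auto simp: indicator_def)
    qed
    show "(\<lambda>x. indicator K x * norm (clip k (f x) - clip k (g n x))) \<in> borel_measurable lebesgue" for n
      using mk by measurable
  qed (use integrable_indicator_compact[OF K] in auto)
  then have "\<forall>\<^sub>F n in sequentially. (LINT x|lebesgue. indicator K x * norm (clip k (f x) - clip k (g n x))) < e / 2"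
    using e by (intro order_tendstoD(2)) auto
  then obtain n where n: "(LINT x|lebesgue. indicator K x * norm (clip k (f x) - clip k (g n x))) < e / 2"
    by (auto simp: eventually_sequentially)
  have i1: "integrable lebesgue (\<lambda>x. indicator K x * norm (f x - clip k (f x)))"
  proof (rule Bochner_Integration.integrable_bound[where f="\<lambda>x. 2 * norm (f x)"])
    show "AE x in lebesgue. norm (indicator K x * norm (f x - clip k (f x))) \<le> norm (2 * norm (f x))"
    proof (intro AE_I2)
      fix x
      have "norm (f x - clip k (f x)) \<le> 2 * norm (f x)"
        using norm_triangle_ineq4[of "f x" "clip k (f x)"] norm_clip_le_norm[OF k(1), of "f x"] by simp
      then show "norm (indicator K x * norm (f x - clip k (f x))) \<le> norm (2 * norm (f x))"
        by (auto simp: indicator_def)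
    qed
    show "(\<lambda>x. indicator K x * norm (f x - clip k (f x))) \<in> borel_measurable lebesgue"
      using mk by measurable
  qed (use f in auto)
  have i2: "integrable lebesgue (\<lambda>x. indicator K x * norm (clip k (f x) - clip k (g n x)))"
  proof (rule Bochner_Integration.integrable_bound[OF integrable_indicator_compact[OF K, of "2 * k"]])
    show "AE x in lebesgue. norm (indicator K x * norm (clip k (f x) - clip k (g n x))) \<le> norm (indicator K x * (2 * k))"
    proof (intro AE_I2)
      fix x
      have "norm (clip k (f x) - clip k (g n x)) \<le> 2 * k"
        using norm_triangle_ineq4[of "clip k (f x)" "clip k (g n x)"] norm_clip_le[OF k(1), of "f x"] norm_clip_le[OF k(1), of "g n x"] by simp
      then show "norm (indicator K x * norm (clip k (f x) - clip k (g n x))) \<le> norm (indicator K x * (2 * k))"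
        by (auto simp: indicator_def)
    qed
    show "(\<lambda>x. indicator K x * norm (clip k (f x) - clip k (g n x))) \<in> borel_measurable lebesgue"
      using mk by measurable
  qed
  show ?thesis
  proof
    show "continuous_on UNIV (\<lambda>x. clip k (g n x))"
      by (rule continuous_on_compose2[OF continuous_on_clip[OF k(1), of UNIV] g(2)]) auto
    have "(LINT x|lebesgue. indicator K x * norm (f x - clip k (g n x)))
      \<le> (LINT x|lebesgue. indicator K x * norm (f x - clip k (f x)) + indicator K x * norm (clip k (f x) - clip k (g n x)))"
    proof (rule integral_mono_AE')
      show "integrable lebesgue (\<lambda>x. indicator K x * norm (f x - clip k (f x)) + indicator K x * norm (clip k (f x) - clip k (g n x)))"
        by (rule Bochner_Integration.integrable_add[OF i1 i2])
      show "AE x in lebesgue. indicator K x * norm (f x - clip k (g n x))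
          \<le> indicator K x * norm (f x - clip k (f x)) + indicator K x * norm (clip k (f x) - clip k (g n x))"
        by (intro AE_I2) (auto simp: indicator_def intro: norm_diff_triangle_le)
    qed auto
    also have "\<dots> < e"
      using k n i1 i2 by simp
    finally show "(LINT x|lebesgue. indicator K x * norm (f x - clip k (g n x))) < e" .
  qed
qed

text \<open>The usual density argument: split f into a remainder d of small L1 norm, for which
  contraction suffices, and a part h that agrees with a continuous function on a large ball and is
  handled by uniform continuity.\<close>

lemma moll_tendsto_L1:
  fixes f :: "'a::euclidean_space \<Rightarrow> 'b::euclidean_space"
  assumes f: "integrable lebesgue f" and supp: "\<And>x. R < norm x \<Longrightarrow> f x = 0"
    and r: "\<And>n::nat. 0 < r n" "r \<longlonglongrightarrow> 0"
  shows "(\<lambda>n. LINT x|lebesgue. norm (moll (r n) f x - f x)) \<longlonglongrightarrow> 0"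
proof (rule LIMSEQ_I)
  fix e :: real assume e: "0 < e"
  \<comment> \<open>Mollification radii stay below 1: outside \<open>?K1\<close> both f and its
    mollification vanish, and for points of \<open>?K1\<close> only values in \<open>?K\<close>
    enter, where h equals g.\<close>
  let ?K = "cball (0::'a) (R + 2)" and ?K1 = "cball (0::'a) (R + 1)"
  define V where "V = measure lebesgue ?K1"
  have V: "0 \<le> V" by (simp add: V_def)
  obtain g where g: "continuous_on UNIV g" "(LINT x|lebesgue. indicator ?K x * norm (f x - g x)) < e / 4"
    using continuous_approx_L1[OF f compact_cball, of "e / 4"] e by (metis divide_pos_pos zero_less_numeral)
  define h where "h = (\<lambda>x. indicator ?K x *\<^sub>R g x)"
  have h: "integrable lebesgue h"
    unfolding h_def by (intro integrable_continuous_compact g compact_cball)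
  define d where "d = (\<lambda>x. f x - h x)"
  have d: "integrable lebesgue d" unfolding d_def using f h by (rule Bochner_Integration.integrable_diff)
  have "norm (d x) = indicator ?K x * norm (f x - g x)" for x
    using supp[of x] by (auto simp: d_def h_def indicator_def)
  then have d1: "(LINT x|lebesgue. norm (d x)) < e / 4" using g(2) by simp
  have "uniformly_continuous_on ?K g"
    by (intro compact_uniformly_continuous continuous_on_subset[OF g(1)] compact_cball) auto
  \<comment> \<open>The uniform error c is integrated over \<open>?K1\<close>, of volume V; V + 1
    keeps the quotient meaningful if V = 0.\<close>
  moreover define c where "c = e / (4 * (V + 1))"
  moreover have c: "0 < c" using e V by (simp add: c_def)
  ultimately obtain s where s: "0 < s" "\<And>x y. x \<in> ?K \<Longrightarrow> y \<in> ?K \<Longrightarrow> dist y x < s \<Longrightarrow> dist (g y) (g x) < c"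
    unfolding uniformly_continuous_on_def by meson
  obtain N where N: "\<And>n. N \<le> n \<Longrightarrow> r n < min 1 s"
    using order_tendstoD(2)[OF r(2), of "min 1 s"] s(1) by (auto simp: eventually_sequentially)
  show "\<exists>no. \<forall>n\<ge>no. norm ((LINT x|lebesgue. norm (moll (r n) f x - f x)) - 0) < e"
  proof (intro exI allI impI)
    fix n assume "N \<le> n"
    then have rn: "r n < 1" "r n < s" "0 < r n" using N r by auto
    have bound: "norm (moll (r n) f x - f x) \<le> norm (moll (r n) d x) + norm (d x) + indicator ?K1 x * c" for x
    proof (cases "x \<in> ?K1")
      case False
      have "moll (r n) f x = 0"
      proof (rule moll_eq_0)
        fix y assume "dist x y < r n"
        then have "norm x \<le> norm y + 1"
          using rn norm_triangle_ineq[of y "x - y"] by (simp add: dist_norm)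
        then show "f y = 0" using False by (intro supp) auto
      qed (use rn in auto)
      moreover have "f x = 0" using False by (intro supp) auto
      ultimately show ?thesis using c by (simp add: add_nonneg_nonneg)
    next
      case True
      have "norm (moll (r n) h x - h x) \<le> c"
      proof (rule norm_moll_diff_le[OF h rn(3)])
        fix y assume y: "dist x y < r n"
        then have "norm y \<le> norm x + 1"
          using rn norm_triangle_ineq[of x "y - x"] by (simp add: dist_norm norm_minus_commute)
        then have "y \<in> ?K" "x \<in> ?K" using True by auto
        then show "norm (h y - h x) \<le> c"
          using s(2)[of x y] y rn by (auto simp: h_def dist_norm norm_minus_commute)
      qed
      moreover have "moll (r n) f x = moll (r n) d x + moll (r n) h x"
        using moll_add[OF d h rn(3), of x] by (simp add: d_def)
      ultimately have "norm (moll (r n) f x - f x) \<le> norm (moll (r n) d x) + (norm (d x) + c)"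
        unfolding d_def
        by (smt (verit) diff_add_eq diff_diff_eq2 norm_triangle_ineq norm_triangle_ineq4 add_diff_eq add.commute diff_add_cancel)
      then show ?thesis using True by simp
    qed
    have "(LINT x|lebesgue. norm (moll (r n) f x - f x)) \<le> (LINT x|lebesgue. norm (moll (r n) d x) + norm (d x) + indicator ?K1 x * c)"
      using integrable_moll(1)[OF d rn(3)] integrable_moll(1)[OF f rn(3)] d f integrable_indicator_compact[of ?K1 c]
      by (intro integral_mono bound) auto
    also have "\<dots> = (LINT x|lebesgue. norm (moll (r n) d x)) + (LINT x|lebesgue. norm (d x)) + V * c"
      using integrable_moll(1)[OF d rn(3)] d integrable_indicator_compact[of ?K1 c]
      by (simp add: V_def)
    also have "\<dots> < e / 4 + e / 4 + e / 4"
    proof -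
      have "V * c < e / 4" using V e by (simp add: c_def field_simps)
      then show ?thesis using integrable_moll(2)[OF d rn(3)] d1 by linarith
    qed
    also have "\<dots> < e" using e by simp
    finally show "norm ((LINT x|lebesgue. norm (moll (r n) f x - f x)) - 0) < e"
      by simp
  qed
qed

lemma moll_subseq_AE:
  fixes f :: "'a::euclidean_space \<Rightarrow> 'b::euclidean_space"
  assumes f: "integrable lebesgue f" and supp: "\<And>x. R < norm x \<Longrightarrow> f x = 0"
    and r: "\<And>n::nat. 0 < r n" "r \<longlonglongrightarrow> 0"
  obtains q where "strict_mono q" "AE x in lebesgue. (\<lambda>n. moll (r (q n)) f x) \<longlonglongrightarrow> f x"
proof -
  have "\<exists>q. strict_mono q \<and> (AE x in lebesgue. (\<lambda>n. moll (r (q n)) f x - f x) \<longlonglongrightarrow> 0)"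
    by (rule tendsto_L1_AE_subseq[where u="\<lambda>n x. moll (r n) f x - f x"])
      (use moll_tendsto_L1[OF assms] integrable_moll(1)[OF f r(1)] f in auto)
  then show ?thesis using that by (auto simp: LIM_zero_iff)
qed

section \<open>Differentiating the mollification\<close>

abbreviation dkern :: "real \<Rightarrow> 'a::euclidean_space \<Rightarrow> 'a \<Rightarrow> real" where
  "dkern r z \<equiv> frechet_derivative (kern r) (at z)"

lemma kern_has_derivative: "(kern r has_derivative dkern r z) (at (z::'a::euclidean_space))"
  and continuous_on_dkern: "continuous_on UNIV (\<lambda>z. dkern r z (v::'a))"
proof -
  have "Ck_on (Suc 0) UNIV (kern r :: 'a \<Rightarrow> real)"
    using smooth_on_kern unfolding smooth_on_def by blast
  from Ck_on_SucD[OF this] show "(kern r has_derivative dkern r z) (at z)" "continuous_on UNIV (\<lambda>z. dkern r z v)"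
    by simp_all
qed

lemma dkern_eq_0:
  fixes z :: "'a::euclidean_space"
  assumes "0 < r" "r < norm z" shows "dkern r z = (\<lambda>_. 0)"
proof -
  have "(kern r has_derivative (\<lambda>_. 0)) (at z)"
  proof (rule has_derivative_transform_within_open[OF has_derivative_const])
    have "- cball (0::'a) r = {z. r < norm z}" by (auto simp: dist_norm)
    then show "open {z::'a. r < norm z}" by (metis closed_cball open_Compl)
  qed (use assms in \<open>auto simp: kern_eq_0\<close>)
  then show ?thesis using frechet_derivative_at by metis
qed

text \<open>Partial derivatives are continuous and vanish off a ball, hence are bounded; the mean
  value inequality gives the Lipschitz bound with the same B. Both serve as majorants when
  differentiating under the integral.\<close>

lemma dkern_bounded:
  assumes "0 < r"
  obtains B where "0 \<le> B" "\<And>z v. \<bar>dkern r (z::'a::euclidean_space) v\<bar> \<le> B * norm v"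
    "\<And>z z'. \<bar>kern r z - kern r (z'::'a)\<bar> \<le> B * norm (z - z')"
proof -
  have "\<exists>C. \<forall>z. \<bar>dkern r (z::'a) b\<bar> \<le> C" for b
  proof -
    have "bounded ((\<lambda>z. dkern r (z::'a) b) ` cball 0 r)"
      by (intro compact_imp_bounded compact_continuous_image continuous_on_subset[OF continuous_on_dkern]) auto
    then obtain C where C: "\<And>z. z \<in> cball 0 r \<Longrightarrow> \<bar>dkern r (z::'a) b\<bar> \<le> C"
      unfolding bounded_iff by (metis imageI real_norm_def)
    have "\<bar>dkern r z b\<bar> \<le> max C 0" for z :: 'a
      using C[of z] dkern_eq_0[OF assms, of z] by (cases "norm z \<le> r") auto
    then show ?thesis by blast
  qed
  then obtain C where C: "\<And>b z. \<bar>dkern r (z::'a) b\<bar> \<le> C b" by metis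
  define B where "B = (\<Sum>b\<in>Basis. C b)"
  have C0: "0 \<le> C b" for b using C[where b=b and z=0] by linarith
  have B: "\<bar>dkern r z v\<bar> \<le> B * norm v" for z v :: 'a
  proof -
    have "linear (dkern r z)"
      using has_derivative_linear[OF kern_has_derivative] .
    then have "dkern r z v = (\<Sum>b\<in>Basis. (v \<bullet> b) * dkern r z b)"
      by (subst euclidean_representation[of v, symmetric]) (simp add: linear_sum linear_cmul)
    also have "\<bar>\<dots>\<bar> \<le> (\<Sum>b\<in>Basis. norm v * C b)"
      using C by (intro order_trans[OF sum_abs] sum_mono) (auto simp: abs_mult intro!: mult_mono Basis_le_norm)
    finally show ?thesis by (simp add: B_def sum_distrib_left mult.commute)
  qed
  have "\<bar>kern r z - kern r z'\<bar> \<le> B * norm (z - z')" for z z' :: 'a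
  proof -
    have "norm (kern r z - kern r z') \<le> B * norm (z - z')"
    proof (rule differentiable_bound[of UNIV _ "dkern r"])
      show "onorm (dkern r x) \<le> B" for x :: 'a
        using B by (intro onorm_le) auto
    qed (auto intro: has_derivative_at_withinI kern_has_derivative)
    then show ?thesis by simp
  qed
  with B C0 that show ?thesis by (metis B_def sum_nonneg)
qed

definition dmoll :: "real \<Rightarrow> ('a::euclidean_space \<Rightarrow> real) \<Rightarrow> 'a \<Rightarrow> 'a \<Rightarrow> real" where
  "dmoll r f x v = (LINT y|lebesgue. dkern r (x - y) v * f y)"

lemma borel_measurable_dkern_shift [measurable]: "(\<lambda>y. dkern r (x - y) v) \<in> borel_measurable lebesgue"
  by (intro borel_measurable_lebesgue_compose borel_measurable_continuous_onI
      continuous_on_compose2[OF continuous_on_dkern]) (auto intro: continuous_intros)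

lemma borel_measurable_kern_shift [measurable]: "(\<lambda>y. kern r (x - y)) \<in> borel_measurable lebesgue"
  by (intro borel_measurable_lebesgue_compose) measurable

lemma integrable_dkern:
  assumes f: "integrable lebesgue f" and r: "0 < r"
  shows "integrable lebesgue (\<lambda>y. dkern r (x - y) v * f y)"
proof -
  obtain B where B: "0 \<le> B" "\<And>z v. \<bar>dkern r (z::'a) v\<bar> \<le> B * norm v"
    using dkern_bounded[OF r, where 'a='a] by metis
  have [measurable]: "f \<in> borel_measurable lebesgue" using f by simp
  show ?thesis
  proof (rule Bochner_Integration.integrable_bound[where f="\<lambda>y. B * norm v * f y"])
    show "AE y in lebesgue. norm (dkern r (x - y) v * f y) \<le> norm (B * norm v * f y)"
      using B by (intro AE_I2) (auto simp: abs_mult intro!: mult_right_mono)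
  qed (use f in auto)
qed

text \<open>Differentiation under the integral sign along arbitrary sequences tending to 0: the
  error quotient of the kernel is at most 2 B uniformly and tends to 0 pointwise, so dominated
  convergence applies with majorant 2 B |f|.\<close>

lemma moll_has_derivative:
  fixes f :: "'a::euclidean_space \<Rightarrow> real"
  assumes f: "integrable lebesgue f" and r: "0 < r"
  shows "(moll r f has_derivative dmoll r f x) (at x)"
proof -
  obtain B where B: "0 \<le> B" "\<And>z v. \<bar>dkern r (z::'a) v\<bar> \<le> B * norm v"
    "\<And>z z'. \<bar>kern r z - kern r (z'::'a)\<bar> \<le> B * norm (z - z')"
    using dkern_bounded[OF r, where 'a='a] by metis
  have [measurable]: "f \<in> borel_measurable lebesgue" using f by simp
  have lin: "linear (dkern r z)" for z :: 'a
    using has_derivative_linear[OF kern_has_derivative] .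
  note int = integrable_dkern[OF f r]
  have lin': "linear (dmoll r f x)"
    by (rule linearI)
       (simp_all add: dmoll_def linear_add[OF lin] linear_cmul[OF lin] distrib_right int mult.assoc)
  have "((\<lambda>h. norm (moll r f (x + h) - moll r f x - dmoll r f x h) / norm h) \<longlongrightarrow> 0) (at 0)"
  proof (rule LIMSEQ_SEQ_conv[THEN iffD1, rule_format], elim conjE)
    fix h :: "nat \<Rightarrow> 'a" assume h0: "\<forall>n. h n \<noteq> 0" and h: "h \<longlonglongrightarrow> 0"
    let ?E = "\<lambda>n y. (kern r (x + h n - y) - kern r (x - y) - dkern r (x - y) (h n)) / norm (h n)"
    have Eb: "\<bar>?E n y\<bar> \<le> 2 * B" for n y
    proof -
      have "\<bar>kern r (x + h n - y) - kern r (x - y) - dkern r (x - y) (h n)\<bar> \<le> B * norm (h n) + B * norm (h n)"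
        using B(3)[of "x + h n - y" "x - y"] B(2)[of "x - y" "h n"] by (simp add: algebra_simps)
      then show ?thesis using h0 by (simp add: field_simps)
    qed
    have "(\<lambda>n. LINT y|lebesgue. ?E n y * f y) \<longlonglongrightarrow> (LINT y::'a|lebesgue. (0::real))"
    proof (rule integral_dominated_convergence[where f="\<lambda>_. 0 :: real" and w="\<lambda>y. 2 * B * norm (f y)"])
      show "AE y in lebesgue. (\<lambda>n. ?E n y * f y) \<longlonglongrightarrow> 0"
      proof (intro AE_I2 tendsto_mult_left_zero)
        fix y
        have "((\<lambda>h. norm (kern r ((x - y) + h) - kern r (x - y) - dkern r (x - y) h) / norm h) \<longlongrightarrow> 0) (at 0)"
          using kern_has_derivative[of r "x - y"] by (simp add: has_derivative_at)
        then have "(\<lambda>n. norm (kern r ((x - y) + h n) - kern r (x - y) - dkern r (x - y) (h n)) / norm (h n)) \<longlonglongrightarrow> 0"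
          using h0 h by (intro LIMSEQ_SEQ_conv[THEN iffD2, rule_format]) auto
        then have "(\<lambda>n. norm (?E n y)) \<longlonglongrightarrow> 0" by (simp add: algebra_simps)
        then show "(\<lambda>n. ?E n y) \<longlonglongrightarrow> 0" by (rule tendsto_norm_zero_cancel)
      qed
      show "AE y in lebesgue. norm (?E n y * f y) \<le> 2 * B * norm (f y)" for n
      proof (intro AE_I2)
        fix y
        show "norm (?E n y * f y) \<le> 2 * B * norm (f y)"
          using mult_right_mono[OF Eb[of n y], of "norm (f y)"] by (simp add: abs_mult)
      qed
    qed (use f in auto)
    note lim = this
    have eq: "(LINT y|lebesgue. ?E n y * f y) = (moll r f (x + h n) - moll r f x - dmoll r f x (h n)) / norm (h n)" for n
      using integrable_moll_integrand[OF f r, of x] integrable_moll_integrand[OF f r, of "x + h n"] int[of x "h n"]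
      by (simp add: moll_def dmoll_def diff_divide_distrib left_diff_distrib)
    from tendsto_norm_zero[OF lim[unfolded eq integral_zero]]
    show "(\<lambda>n. norm (moll r f (x + h n) - moll r f x - dmoll r f x (h n)) / norm (h n)) \<longlonglongrightarrow> 0"
      by simp
  qed
  then show ?thesis
    using lin' by (simp add: has_derivative_at linear_conv_bounded_linear)
qed

lemma continuous_on_dmoll:
  assumes f: "integrable lebesgue f" and r: "0 < r"
  shows "continuous_on UNIV (\<lambda>x. dmoll r f x v)"
proof -
  obtain B where B: "0 \<le> B" "\<And>z v. \<bar>dkern r (z::'a) v\<bar> \<le> B * norm v"
    using dkern_bounded[OF r, where 'a='a] by metis
  have [measurable]: "f \<in> borel_measurable lebesgue" using f by simp
  have "(\<lambda>n. dmoll r f (s n) v) \<longlonglongrightarrow> dmoll r f x v" if "s \<longlonglongrightarrow> x" for s x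
    unfolding dmoll_def
  proof (rule integral_dominated_convergence[where w="\<lambda>y. B * norm v * norm (f y)"])
    show "AE y in lebesgue. (\<lambda>n. dkern r (s n - y) v * f y) \<longlonglongrightarrow> dkern r (x - y) v * f y"
      by (intro AE_I2 tendsto_mult continuous_on_tendsto_compose[OF continuous_on_dkern] tendsto_diff that tendsto_const) auto
    show "AE y in lebesgue. norm (dkern r (s n - y) v * f y) \<le> B * norm v * norm (f y)" for n
      using B by (intro AE_I2) (auto simp: abs_mult intro!: mult_right_mono)
  qed (use f in auto)
  then show ?thesis by (simp add: continuous_on_sequentially comp_def)
qed

lemma Ck_on_1_moll:
  assumes "integrable lebesgue f" "0 < r" shows "Ck_on 1 UNIV (moll r f)"
  unfolding One_nat_def
  by (rule Ck_on_SucI[OF moll_has_derivative[OF assms]]) (simp add: continuous_on_dmoll[OF assms])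

section \<open>Weak gradients\<close>

text \<open>K' is the closed d-neighbourhood of K, compact as a Minkowski sum. It is the room in
  which functions near K can be mollified without leaving \<Omega>.\<close>

lemma compact_in_open_cball:
  fixes K :: "'a::euclidean_space set"
  assumes "compact K" "open \<Omega>" "K \<subseteq> \<Omega>"
  obtains K' d where "compact K'" "K' \<subseteq> \<Omega>" "0 < d" "K \<subseteq> K'" "\<And>x. x \<in> K \<Longrightarrow> cball x d \<subseteq> K'"
proof -
  obtain d where d: "0 < d" "(\<Union>x\<in>K. cball x d) \<subseteq> \<Omega>"
    using compact_subset_open_imp_cball_epsilon_subset[OF assms] by metis
  have "(\<Union>x\<in>K. cball x d) = {x + y |x y. x \<in> K \<and> y \<in> cball 0 d}"
  proof (intro set_eqI iffI)
    fix z assume "z \<in> (\<Union>x\<in>K. cball x d)"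
    then obtain x where "x \<in> K" "dist x z \<le> d" by auto
    then show "z \<in> {x + y |x y. x \<in> K \<and> y \<in> cball 0 d}"
      by (intro CollectI exI[of _ x] exI[of _ "z - x"]) (auto simp: dist_norm norm_minus_commute)
  qed (auto simp: dist_norm intro!: bexI)
  then have "compact (\<Union>x\<in>K. cball x d)"
    using compact_sums[OF assms(1) compact_cball, of 0 d] by simp
  then show ?thesis using that[of "\<Union>x\<in>K. cball x d" d] d by force
qed

lemma sets_lebesgue_compact: "compact K \<Longrightarrow> K \<in> sets lebesgue"
  by (simp add: borel_compact)

lemma sets_lebesgue_open: "open S \<Longrightarrow> S \<in> sets lebesgue"
  by simp

section \<open>Passing between \<Omega> and the whole space by indicators\<close>

lemma integrable_lebesgue_on_iff:
  fixes f :: "'a::euclidean_space \<Rightarrow> 'b::euclidean_space"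
  shows "S \<in> sets lebesgue \<Longrightarrow> integrable (lebesgue_on S) f \<longleftrightarrow> integrable lebesgue (\<lambda>x. indicator S x *\<^sub>R f x)"
  by (rule integrable_restrict_space) simp

lemma integral_lebesgue_on_eq:
  fixes f :: "'a::euclidean_space \<Rightarrow> 'b::euclidean_space"
  assumes "S \<in> sets lebesgue"
  shows "(LINT x|lebesgue_on S. f x) = (LINT x|lebesgue. indicator S x *\<^sub>R f x)"
  by (rule integral_restrict_space) (simp add: assms)

lemma AE_lebesgue_on_iff:
  "S \<in> sets lebesgue \<Longrightarrow> (AE x in lebesgue_on S. P x) \<longleftrightarrow> (AE x in lebesgue. x \<in> S \<longrightarrow> P x)"
  by (rule AE_restrict_space_iff) simp

lemma borel_measurable_lebesgue_on_iff:
  fixes f :: "'a::euclidean_space \<Rightarrow> 'b::euclidean_space"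
  shows "S \<in> sets lebesgue \<Longrightarrow> f \<in> borel_measurable (lebesgue_on S) \<longleftrightarrow> (\<lambda>x. indicator S x *\<^sub>R f x) \<in> borel_measurable lebesgue"
  by (rule borel_measurable_restrict_space_iff) simp

lemma integrable_mult_bounded:
  fixes f :: "'a::euclidean_space \<Rightarrow> 'b::euclidean_space"
  assumes f: "integrable lebesgue f" and h: "h \<in> borel_measurable lebesgue" "\<And>x. \<bar>h x\<bar> \<le> M"
  shows "integrable lebesgue (\<lambda>x. h x *\<^sub>R f x)"
proof (rule Bochner_Integration.integrable_bound[where f="\<lambda>x. M *\<^sub>R f x"])
  show "AE x in lebesgue. norm (h x *\<^sub>R f x) \<le> norm (M *\<^sub>R f x)"
  proof (intro AE_I2)
    fix x
    have "\<bar>h x\<bar> \<le> \<bar>M\<bar>" using h(2)[of x] by linarith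
    then show "norm (h x *\<^sub>R f x) \<le> norm (M *\<^sub>R f x)" by (simp add: mult_right_mono)
  qed
qed (use f h in auto)

lemma integrable_indicator_subset:
  fixes f :: "'a::euclidean_space \<Rightarrow> 'b::euclidean_space"
  assumes "integrable lebesgue (\<lambda>x. indicator S x *\<^sub>R f x)" "T \<subseteq> S" "T \<in> sets lebesgue"
  shows "integrable lebesgue (\<lambda>x. indicator T x *\<^sub>R f x)"
proof -
  have "integrable lebesgue (\<lambda>x. indicat_real T x *\<^sub>R (indicat_real S x *\<^sub>R f x))"
    by (rule integrable_mult_bounded[OF assms(1), of _ 1]) (use assms in \<open>auto simp: indicator_def\<close>)
  moreover have "(\<lambda>x. indicat_real T x *\<^sub>R (indicat_real S x *\<^sub>R f x)) = (\<lambda>x. indicator T x *\<^sub>R f x)"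
    using assms(2) by (auto simp: indicator_def fun_eq_iff)
  ultimately show ?thesis by metis
qed

text \<open>Interiors of a compact exhaustion. Open members are required because
  \<open>W1p_loc\<close> speaks of open subdomains; each compact set lies in a single member, so an
  argument with compact support takes place in one subdomain.\<close>

lemma open_exhaustion:
  fixes \<Omega> :: "'a::euclidean_space set"
  assumes "open \<Omega>"
  obtains O' :: "nat \<Rightarrow> 'a set" where "\<And>n. open (O' n)" "\<And>n. O' n \<Subset> \<Omega>" "\<And>n. O' n \<subseteq> O' (Suc n)"
    "(\<Union>n. O' n) = \<Omega>" "\<And>K. compact K \<Longrightarrow> K \<subseteq> \<Omega> \<Longrightarrow> \<exists>n. K \<subseteq> O' n"
proof -
  obtain C where C: "\<And>n. compact (C n)" "\<And>n. C n \<subseteq> \<Omega>" "\<And>n. C n \<subseteq> interior (C (Suc n))"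
    "\<Union> (range C) = \<Omega>" "\<And>K. compact K \<Longrightarrow> K \<subseteq> \<Omega> \<Longrightarrow> \<exists>N. \<forall>n\<ge>N. K \<subseteq> C n"
    by (rule open_Union_compact_subsets[OF assms]) (rule that)
  show ?thesis
  proof
    show "interior (C n) \<Subset> \<Omega>" for n
    proof -
      have "closure (interior (C n)) \<subseteq> C n"
        by (intro closure_minimal interior_subset compact_imp_closed C(1))
      moreover have "compact (closure (interior (C n)))"
        using bounded_interior[OF compact_imp_bounded[OF C(1)]] by (simp add: compact_closure)
      ultimately show ?thesis using C(2) by (auto simp: compactly_contained_def)
    qed
    show "interior (C n) \<subseteq> interior (C (Suc n))" for n
      by (rule order_trans[OF interior_subset C(3)])
    show "(\<Union>n. interior (C n)) = \<Omega>"
    proof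
      show "(\<Union>n. interior (C n)) \<subseteq> \<Omega>" by (intro UN_least order_trans[OF interior_subset C(2)])
      show "\<Omega> \<subseteq> (\<Union>n. interior (C n))"
        unfolding C(4)[symmetric] using C(3) by blast
    qed
    show "\<exists>n. K \<subseteq> interior (C n)" if K: "compact K" "K \<subseteq> \<Omega>" for K
    proof -
      obtain N where "\<forall>n\<ge>N. K \<subseteq> C n" using C(5)[OF K] by blast
      then have "K \<subseteq> C N" by simp
      also have "C N \<subseteq> interior (C (Suc N))" by (rule C(3))
      finally show ?thesis by blast
    qed
  qed simp
qed

text \<open>Integrability over compact subsets already yields measurability on \<Omega>: the
  function is the pointwise limit of its cut-offs to an exhaustion.\<close>

lemma locally_integrable_iff:
  fixes u :: "'a::euclidean_space \<Rightarrow> 'b::euclidean_space"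
  assumes "open \<Omega>"
  shows "locally_integrable \<Omega> u \<longleftrightarrow> (\<forall>K. compact K \<and> K \<subseteq> \<Omega> \<longrightarrow> integrable lebesgue (\<lambda>x. indicator K x *\<^sub>R u x))"
proof -
  have eq: "integrable (lebesgue_on K) u \<longleftrightarrow> integrable lebesgue (\<lambda>x. indicator K x *\<^sub>R u x)" if "compact K" for K
    using that by (intro integrable_lebesgue_on_iff sets_lebesgue_compact)
  have "u \<in> borel_measurable (lebesgue_on \<Omega>)"
    if loc: "\<And>K. compact K \<Longrightarrow> K \<subseteq> \<Omega> \<Longrightarrow> integrable lebesgue (\<lambda>x. indicator K x *\<^sub>R u x)"
  proof -
  obtain C where C: "\<And>n. compact (C n)" "\<And>n. C n \<subseteq> \<Omega>" "\<And>n. C n \<subseteq> interior (C (Suc n))"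
    "\<Union> (range C) = \<Omega>" "\<And>K. compact K \<Longrightarrow> K \<subseteq> \<Omega> \<Longrightarrow> \<exists>N. \<forall>n\<ge>N. K \<subseteq> C n"
      by (rule open_Union_compact_subsets[OF assms]) (rule that)
    have "(\<lambda>x. indicator \<Omega> x *\<^sub>R u x) \<in> borel_measurable lebesgue"
    proof (rule borel_measurable_LIMSEQ_metric)
      show "(\<lambda>x. indicator (C n) x *\<^sub>R u x) \<in> borel_measurable lebesgue" for n
        using loc[OF C(1,2)] by simp
      show "(\<lambda>n. indicator (C n) x *\<^sub>R u x) \<longlonglongrightarrow> indicator \<Omega> x *\<^sub>R u x" for x
      proof (cases "x \<in> \<Omega>")
        case True
        then obtain N where "\<forall>n\<ge>N. {x} \<subseteq> C n" using C(5)[of "{x}"] by auto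
        then show ?thesis
          using True by (intro tendsto_eventually eventually_sequentiallyI[of N]) auto
      next
        case False
        then have "x \<notin> C n" for n using C(2) by auto
        then show ?thesis using False by simp
      qed
    qed
    then show ?thesis using assms by (simp add: borel_measurable_lebesgue_on_iff)
  qed
  then show ?thesis
    unfolding locally_integrable_def using eq by blast
qed

section \<open>Classical gradients and test functions\<close>

lemma Ccinf_subset_Cc1: "Ccinf \<Omega> \<subseteq> Cc1 \<Omega>"
  unfolding Ccinf_def Cc1_def smooth_on_def by blast

lemma Ccinf_mono: "\<Omega>' \<subseteq> \<Omega> \<Longrightarrow> Ccinf \<Omega>' \<subseteq> Ccinf \<Omega>"
  by (auto simp: Ccinf_def compactly_contained_def)

lemma grad_inner: "b \<in> Basis \<Longrightarrow> grad f x \<bullet> b = frechet_derivative f (at x) b"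
  by (simp add: grad_def)

lemma has_derivative_grad:
  fixes f :: "'a::euclidean_space \<Rightarrow> real"
  assumes "f differentiable (at x)"
  shows "(f has_derivative (\<lambda>v. grad f x \<bullet> v)) (at x)"
proof -
  have D: "(f has_derivative frechet_derivative f (at x)) (at x)"
    using assms by (simp add: frechet_derivative_works)
  have lin: "linear (frechet_derivative f (at x))" by (rule has_derivative_linear[OF D])
  have "frechet_derivative f (at x) v = grad f x \<bullet> v" for v
  proof -
    have "frechet_derivative f (at x) v = frechet_derivative f (at x) (\<Sum>b\<in>Basis. (v \<bullet> b) *\<^sub>R b)"
      by (simp add: euclidean_representation)
    also have "\<dots> = (\<Sum>b\<in>Basis. (v \<bullet> b) * frechet_derivative f (at x) b)"
      by (simp add: linear_sum[OF lin] linear_cmul[OF lin])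
    also have "\<dots> = grad f x \<bullet> v"
      by (simp add: grad_def inner_sum_left inner_commute[of v] mult.commute)
    finally show ?thesis .
  qed
  then have "frechet_derivative f (at x) = (\<lambda>v. grad f x \<bullet> v)" by (rule ext)
  with D show ?thesis by (simp only:)
qed

lemma grad_eqI:
  assumes "(f has_derivative (\<lambda>v. g \<bullet> v)) (at x)" shows "grad f x = g"
proof (rule euclidean_eqI)
  fix b :: 'a assume "b \<in> Basis"
  then show "grad f x \<bullet> b = g \<bullet> b"
    by (simp only: grad_inner frechet_derivative_at[OF assms, symmetric])
qed

lemma Ck_on_1_iff:
  "Ck_on 1 UNIV f \<longleftrightarrow> (\<forall>x. f differentiable (at x)) \<and> continuous_on UNIV (grad f)"
proof
  assume f: "Ck_on 1 UNIV f"
  then have "continuous_on UNIV (\<lambda>x. frechet_derivative f (at x) b *\<^sub>R b)" for b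
    using f by (intro continuous_on_scaleR continuous_on_const) simp
  then have "continuous_on UNIV (grad f)"
    unfolding grad_def[abs_def] by (intro continuous_on_sum)
  then show "(\<forall>x. f differentiable (at x)) \<and> continuous_on UNIV (grad f)" using f by simp
next
  assume f: "(\<forall>x. f differentiable (at x)) \<and> continuous_on UNIV (grad f)"
  show "Ck_on 1 UNIV f"
    unfolding One_nat_def
  proof (rule Ck_on_SucI)
    show "(f has_derivative (\<lambda>v. grad f x \<bullet> v)) (at x)" for x
      using f by (intro has_derivative_grad) simp
    show "Ck_on 0 UNIV (\<lambda>x. grad f x \<bullet> v)" for v
      using f by (simp add: continuous_on_inner)
  qed
qed

text \<open>What is used of a C^1 test function in one package; K will be its closed support and M a
  common bound for the function and its gradient. That the gradient vanishes off K comes from the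
  complement of the support being open.\<close>

definition support_bound :: "'a::euclidean_space set \<Rightarrow> 'a set \<Rightarrow> real \<Rightarrow> ('a \<Rightarrow> real) \<Rightarrow> bool" where
  "support_bound \<Omega> K M \<phi> \<longleftrightarrow> compact K \<and> K \<subseteq> \<Omega> \<and> (\<forall>x. x \<notin> K \<longrightarrow> \<phi> x = 0) \<and> (\<forall>x. x \<notin> K \<longrightarrow> grad \<phi> x = 0) \<and>
     (\<forall>x. \<bar>\<phi> x\<bar> \<le> M) \<and> (\<forall>x. norm (grad \<phi> x) \<le> M) \<and> 0 \<le> M \<and>
     continuous_on UNIV \<phi> \<and> continuous_on UNIV (grad \<phi>) \<and>
     (\<forall>x. (\<phi> has_derivative (\<lambda>v. grad \<phi> x \<bullet> v)) (at x))"

lemma support_boundD: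
  assumes "support_bound \<Omega> K M \<phi>"
  shows "compact K" "K \<subseteq> \<Omega>" "\<And>x. x \<notin> K \<Longrightarrow> \<phi> x = 0" "\<And>x. x \<notin> K \<Longrightarrow> grad \<phi> x = 0"
    "\<And>x. \<bar>\<phi> x\<bar> \<le> M" "\<And>x. norm (grad \<phi> x) \<le> M" "0 \<le> M"
    "continuous_on UNIV \<phi>" "continuous_on UNIV (grad \<phi>)"
    "\<And>x. (\<phi> has_derivative (\<lambda>v. grad \<phi> x \<bullet> v)) (at x)"
  using assms by (simp_all add: support_bound_def)

lemma Cc1D:
  fixes \<phi> :: "'a::euclidean_space \<Rightarrow> real"
  assumes "\<phi> \<in> Cc1 \<Omega>"
  obtains K M where "support_bound \<Omega> K M \<phi>"
proof -
  define S where "S = closure {x. \<phi> x \<noteq> 0}"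
  from assms have cc: "Ck_on 1 UNIV \<phi> \<and> {x. \<phi> x \<noteq> 0} \<Subset> \<Omega>"
    unfolding Cc1_def mem_Collect_eq .
  note C1 = cc[THEN conjunct1]
  note K = cc[THEN conjunct2, unfolded compactly_contained_def, folded S_def, THEN conjunct1]
    cc[THEN conjunct2, unfolded compactly_contained_def, folded S_def, THEN conjunct2]
  have D: "(\<phi> has_derivative (\<lambda>v. grad \<phi> x \<bullet> v)) (at x)" for x
    using C1 unfolding One_nat_def Ck_on.simps by (intro has_derivative_grad) blast
  have 0: "\<phi> x = 0" if "x \<notin> S" for x
    using subsetD[OF closure_subset, of x "{x. \<phi> x \<noteq> 0}"] that unfolding S_def by (auto simp only: mem_Collect_eq)
  have g0: "grad \<phi> x = 0" if "x \<notin> S" for x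
  proof -
    have "(\<phi> has_derivative (\<lambda>_. 0)) (at x)"
    proof (rule has_derivative_transform_within_open[OF has_derivative_const])
      show "open (- S)" using K(1) by (simp add: compact_imp_closed open_Compl)
      show "x \<in> - S" using that by simp
      show "0 = \<phi> y" if "y \<in> - S" for y using 0[of y] that by simp
    qed
    then have "(\<phi> has_derivative (\<lambda>v. 0 \<bullet> v)) (at x)" by simp
    then show ?thesis by (rule grad_eqI)
  qed
  have c: "continuous_on UNIV \<phi>" "continuous_on UNIV (grad \<phi>)"
    using Ck_on_imp_continuous[OF C1] C1 unfolding Ck_on_1_iff by auto
  have "bounded (\<phi> ` S)" "bounded (grad \<phi> ` S)"
    by (rule compact_imp_bounded[OF compact_continuous_image[OF continuous_on_subset[OF c(1) subset_UNIV] K(1)]],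
        rule compact_imp_bounded[OF compact_continuous_image[OF continuous_on_subset[OF c(2) subset_UNIV] K(1)]])
  then obtain M1 M2 where M: "\<And>x. x \<in> S \<Longrightarrow> norm (\<phi> x) \<le> M1" "\<And>x. x \<in> S \<Longrightarrow> norm (grad \<phi> x) \<le> M2"
    unfolding bounded_iff by (metis imageI)
  let ?M = "max 0 (max M1 M2)"
  have MM: "\<bar>\<phi> x\<bar> \<le> ?M" "norm (grad \<phi> x) \<le> ?M" for x
  proof -
    show "\<bar>\<phi> x\<bar> \<le> ?M" using M(1)[of x] 0[of x] by (cases "x \<in> S") (simp_all add: max.coboundedI1 max.coboundedI2)
    show "norm (grad \<phi> x) \<le> ?M" using M(2)[of x] g0[of x] by (cases "x \<in> S") (simp_all add: max.coboundedI1 max.coboundedI2)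
  qed
  have "support_bound \<Omega> S ?M \<phi>"
    unfolding support_bound_def using K 0 g0 MM c D by (intro conjI allI impI) (assumption | simp)+
  then show ?thesis by (rule that)
qed

lemma integrable_mult_test:
  fixes f :: "'a::euclidean_space \<Rightarrow> 'b::euclidean_space"
  assumes f: "integrable lebesgue (\<lambda>x. indicator K x *\<^sub>R f x)"
    and h: "continuous_on UNIV h" "\<And>x. x \<notin> K \<Longrightarrow> h x = 0" "\<And>x. \<bar>h x\<bar> \<le> M"
  shows "integrable lebesgue (\<lambda>x. h x *\<^sub>R f x)"
proof -
  have "h \<in> borel_measurable lebesgue"
    using h(1) by (intro borel_measurable_lebesgue_compose borel_measurable_continuous_onI)
  from integrable_mult_bounded[OF f this h(3)]
  have "integrable lebesgue (\<lambda>x. h x *\<^sub>R (indicat_real K x *\<^sub>R f x))" .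
  moreover have "(\<lambda>x. h x *\<^sub>R (indicat_real K x *\<^sub>R f x)) = (\<lambda>x. h x *\<^sub>R f x)"
    using h(2) by (auto simp: indicator_def fun_eq_iff)
  ultimately show ?thesis by metis
qed

lemma less_norm_if_notin_cball: "cball x r \<subseteq> K \<Longrightarrow> y \<notin> K \<Longrightarrow> r < norm (x - y)"
  by (rule ccontr) (auto simp: dist_norm subset_iff not_less)

text \<open>Test functions and their gradients vanish off \<Omega>, so the integrals may be taken
  over the whole space. In this form translations and mollifications need no domain of their
  own.\<close>

lemma has_weak_gradient_iff:
  fixes \<Omega> :: "'a::euclidean_space set"
  assumes "open \<Omega>"
  shows "has_weak_gradient \<Omega> u g \<longleftrightarrow> locally_integrable \<Omega> u \<and> locally_integrable \<Omega> g \<and>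
     (\<forall>\<phi>\<in>Ccinf \<Omega>. \<forall>b\<in>Basis.
        (LINT x|lebesgue. u x * (grad \<phi> x \<bullet> b)) = - (LINT x|lebesgue. (g x \<bullet> b) * \<phi> x))"
proof -
  have "(LINT x|lebesgue_on \<Omega>. u x * (grad \<phi> x \<bullet> b)) = (LINT x|lebesgue. u x * (grad \<phi> x \<bullet> b))"
     "(LINT x|lebesgue_on \<Omega>. (g x \<bullet> b) * \<phi> x) = (LINT x|lebesgue. (g x \<bullet> b) * \<phi> x)"
    if \<phi>: "\<phi> \<in> Ccinf \<Omega>" for \<phi> b
  proof -
    obtain K M where "support_bound \<Omega> K M \<phi>"
      by (rule Cc1D[OF subsetD[OF Ccinf_subset_Cc1 \<phi>]])
    note KM = support_boundD[OF this]
    note K = KM(2,3,4)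
    have "indicator \<Omega> x *\<^sub>R (u x * (grad \<phi> x \<bullet> b)) = u x * (grad \<phi> x \<bullet> b)"
      "indicator \<Omega> x *\<^sub>R ((g x \<bullet> b) * \<phi> x) = (g x \<bullet> b) * \<phi> x" for x
      using K(1) K(2)[of x] K(3)[of x] by (cases "x \<in> \<Omega>"; force)+
    then show "(LINT x|lebesgue_on \<Omega>. u x * (grad \<phi> x \<bullet> b)) = (LINT x|lebesgue. u x * (grad \<phi> x \<bullet> b))"
     "(LINT x|lebesgue_on \<Omega>. (g x \<bullet> b) * \<phi> x) = (LINT x|lebesgue. (g x \<bullet> b) * \<phi> x)"
      using assms by (simp_all only: integral_lebesgue_on_eq sets_lebesgue_open)
  qed
  then show ?thesis by (simp add: has_weak_gradient_def)
qed

lemma has_weak_gradientD: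
  assumes "open \<Omega>" "has_weak_gradient \<Omega> u g"
  shows "\<And>K. compact K \<Longrightarrow> K \<subseteq> \<Omega> \<Longrightarrow> integrable lebesgue (\<lambda>x. indicator K x * u x)"
    and "\<And>K. compact K \<Longrightarrow> K \<subseteq> \<Omega> \<Longrightarrow> integrable lebesgue (\<lambda>x. indicator K x *\<^sub>R g x)"
    and "\<And>\<phi> b. \<phi> \<in> Ccinf \<Omega> \<Longrightarrow> b \<in> Basis \<Longrightarrow>
        (LINT x|lebesgue. u x * (grad \<phi> x \<bullet> b)) = - (LINT x|lebesgue. (g x \<bullet> b) * \<phi> x)"
  using assms by (auto simp: has_weak_gradient_iff locally_integrable_iff)

lemma has_weak_gradientI:
  assumes "open \<Omega>"
    and "\<And>K. compact K \<Longrightarrow> K \<subseteq> \<Omega> \<Longrightarrow> integrable lebesgue (\<lambda>x. indicator K x * u x)"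
    and "\<And>K. compact K \<Longrightarrow> K \<subseteq> \<Omega> \<Longrightarrow> integrable lebesgue (\<lambda>x. indicator K x *\<^sub>R g x)"
    and "\<And>\<phi> b. \<phi> \<in> Ccinf \<Omega> \<Longrightarrow> b \<in> Basis \<Longrightarrow>
        (LINT x|lebesgue. u x * (grad \<phi> x \<bullet> b)) = - (LINT x|lebesgue. (g x \<bullet> b) * \<phi> x)"
  shows "has_weak_gradient \<Omega> u g"
  using assms by (auto simp: has_weak_gradient_iff locally_integrable_iff)

lemma has_weak_gradient_subset:
  assumes "open \<Omega>" "open \<Omega>'" "\<Omega>' \<subseteq> \<Omega>" "has_weak_gradient \<Omega> u g"
  shows "has_weak_gradient \<Omega>' u g"
  using has_weak_gradientD[OF assms(1,4)] assms(2,3) Ccinf_mono[OF assms(3)]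
  by (intro has_weak_gradientI) auto

lemma kern_in_Ccinf:
  assumes "0 < r" "cball x r \<subseteq> \<Omega>" shows "(\<lambda>y. kern r (x - y)) \<in> Ccinf \<Omega>"
proof -
  have "{y. kern r (x - y) \<noteq> 0} \<subseteq> cball x r"
    using kern_eq_0[OF assms(1)] by (force simp: dist_norm)
  then have "closure {y. kern r (x - y) \<noteq> 0} \<subseteq> cball x r"
    by (simp add: closure_minimal)
  then have "{y. kern r (x - y) \<noteq> 0} \<Subset> \<Omega>"
    using assms(2) unfolding compactly_contained_def
    by (metis bounded_cball bounded_subset closed_closure compact_eq_bounded_closed order_trans)
  moreover have "smooth_on UNIV (\<lambda>y. kern r (x - y))"
    using smooth_on_affine[OF smooth_on_kern, of r "-1" x] by simp
  ultimately show ?thesis by (simp add: Ccinf_def)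
qed

lemma grad_kern_shift:
  assumes "b \<in> Basis" shows "grad (\<lambda>y. kern r (x - y)) y \<bullet> b = - dkern r (x - y) b"
proof -
  have "((\<lambda>y. kern r (x - y)) has_derivative (\<lambda>v. dkern r (x - y) (- v))) (at y)"
    by (rule has_derivative_compose[OF _ kern_has_derivative]) (auto intro!: derivative_eq_intros)
  then have "frechet_derivative (\<lambda>y. kern r (x - y)) (at y) b = dkern r (x - y) (- b)"
    by (metis frechet_derivative_at)
  then show ?thesis
    using assms linear_neg[OF has_derivative_linear[OF kern_has_derivative[of r "x - y"]]] by (simp add: grad_inner)
qed

text \<open>The reflected kernel around x is itself an admissible test function as long as its ball
  lies in K. The sign of the weak formulation cancels the sign from differentiating
  \<open>kern r (x - y)\<close> in y, so mollification commutes with the gradient in the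
  interior.\<close>

lemma dmoll_weak_gradient:
  assumes "open \<Omega>" and wg: "has_weak_gradient \<Omega> u g" and K: "compact K" "K \<subseteq> \<Omega>" "cball x r \<subseteq> K"
    and r: "0 < r" and b: "b \<in> Basis"
  shows "dmoll r (\<lambda>y. indicator K y * u y) x b = moll r (\<lambda>y. indicator K y *\<^sub>R g y) x \<bullet> b"
proof -
  have "dmoll r (\<lambda>y. indicator K y * u y) x b = - (LINT y|lebesgue. u y * (grad (\<lambda>y. kern r (x - y)) y \<bullet> b))"
  proof -
    have "dkern r (x - y) b * (indicator K y * u y) = - (u y * (grad (\<lambda>y. kern r (x - y)) y \<bullet> b))" for y
    proof (cases "y \<in> K")
      case False
      then have "r < norm (x - y)" using less_norm_if_notin_cball[OF K(3)] by simp
      then show ?thesis using dkern_eq_0[OF r, of "x - y"] b by (simp add: grad_kern_shift)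
    qed (simp add: grad_kern_shift[OF b] mult.commute)
    then show ?thesis by (simp add: dmoll_def)
  qed
  also have "\<dots> = (LINT y|lebesgue. (g y \<bullet> b) * kern r (x - y))"
    using has_weak_gradientD(3)[OF assms(1,2) kern_in_Ccinf[OF r, of x] b] K by auto
  also have "\<dots> = (LINT y|lebesgue. (kern r (x - y) *\<^sub>R (indicator K y *\<^sub>R g y)) \<bullet> b)"
  proof (intro Bochner_Integration.integral_cong refl)
    fix y show "(g y \<bullet> b) * kern r (x - y) = (kern r (x - y) *\<^sub>R (indicator K y *\<^sub>R g y)) \<bullet> b"
    proof (cases "y \<in> K")
      case False
      then have "r \<le> norm (x - y)" using less_norm_if_notin_cball[OF K(3)] by (simp add: less_imp_le)
      then show ?thesis using kern_eq_0[OF r, of "x - y"] by simp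
    qed simp
  qed
  also have "\<dots> = moll r (\<lambda>y. indicator K y *\<^sub>R g y) x \<bullet> b"
    unfolding moll_def
    by (rule integral_inner_left)
      (use integrable_moll_integrand[OF has_weak_gradientD(2)[OF assms(1,2) K(1,2)] r] in auto)
  finally show ?thesis .
qed

text \<open>The fundamental lemma of the calculus of variations: on K all mollifications of f
  vanish, being integrals against shifted kernels, and along a subsequence they converge to f almost
  everywhere. An exhaustion then covers \<Omega>.\<close>

lemma AE_0_if_integral_test_0:
  fixes f :: "'a::euclidean_space \<Rightarrow> real"
  assumes \<Omega>: "open \<Omega>" and loc: "\<And>K. compact K \<Longrightarrow> K \<subseteq> \<Omega> \<Longrightarrow> integrable lebesgue (\<lambda>x. indicator K x * f x)"
    and test: "\<And>\<phi>. \<phi> \<in> Ccinf \<Omega> \<Longrightarrow> (LINT x|lebesgue. f x * \<phi> x) = 0"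
  shows "AE x in lebesgue. x \<in> \<Omega> \<longrightarrow> f x = 0"
proof -
  have compact_case: "AE x in lebesgue. x \<in> K \<longrightarrow> f x = 0" if K: "compact K" "K \<subseteq> \<Omega>" for K
  proof -
    obtain K' d where K': "compact K'" "K' \<subseteq> \<Omega>" "0 < d" "K \<subseteq> K'" "\<And>x. x \<in> K \<Longrightarrow> cball x d \<subseteq> K'"
      by (rule compact_in_open_cball[OF K(1) \<Omega> K(2)]) (rule that)
    let ?f = "\<lambda>x. indicator K' x * f x"
    define r where "r n = d / real (Suc n)" for n
    have r: "0 < r n" "r n \<le> d" for n using K'(3) by (auto simp: r_def divide_simps)
    have r0: "r \<longlonglongrightarrow> 0"
      unfolding r_def by (rule LIMSEQ_Suc[OF lim_const_over_n])
    obtain R where R: "\<And>x. x \<in> K' \<Longrightarrow> norm x \<le> R"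
      using compact_imp_bounded[OF K'(1)] unfolding bounded_iff by blast
    have supp: "?f x = 0" if "R < norm x" for x
      using R[of x] that by (cases "x \<in> K'") auto
    obtain q where q: "strict_mono q" "AE x in lebesgue. (\<lambda>n. moll (r (q n)) ?f x) \<longlonglongrightarrow> ?f x"
      by (rule moll_subseq_AE[where R=R and r=r, OF loc[OF K'(1,2)] _ r(1) r0]) (erule supp, rule that)
    have 0: "moll (r n) ?f x = 0" if "x \<in> K" for n x
    proof -
      have cb: "cball x (r n) \<subseteq> K'" using K'(5)[OF that] r(2)[of n] by force
      have "kern (r n) (x - y) *\<^sub>R ?f y = f y * kern (r n) (x - y)" for y
      proof (cases "y \<in> K'")
        case False
        then have "r n \<le> norm (x - y)" using less_norm_if_notin_cball[OF cb] by (simp add: less_imp_le)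
        then show ?thesis using kern_eq_0[OF r(1), of n "x - y"] by simp
      qed simp
      then have "moll (r n) ?f x = (LINT y|lebesgue. f y * kern (r n) (x - y))"
        unfolding moll_def by (simp only:)
      also have "\<dots> = 0"
        by (rule test[OF kern_in_Ccinf[OF r(1)]]) (use cb K' in auto)
      finally show ?thesis .
    qed
    show ?thesis using q(2)
    proof eventually_elim
      case (elim x)
      show ?case
      proof
        assume x: "x \<in> K"
        then have "(\<lambda>n. 0) \<longlonglongrightarrow> ?f x" using elim 0[OF x] by simp
        then have "?f x = 0" using LIMSEQ_const_iff by metis
        then show "f x = 0" using x K'(4) by auto
      qed
    qed
  qed
  obtain C where C: "\<And>n::nat. compact (C n)" "\<And>n. C n \<subseteq> \<Omega>" "\<And>n. C n \<subseteq> interior (C (Suc n))"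
    "\<Union> (range C) = \<Omega>" "\<And>K. compact K \<Longrightarrow> K \<subseteq> \<Omega> \<Longrightarrow> \<exists>N. \<forall>n\<ge>N. K \<subseteq> C n"
    by (rule open_Union_compact_subsets[OF \<Omega>]) (rule that)
  have "AE x in lebesgue. \<forall>n. x \<in> C n \<longrightarrow> f x = 0"
    unfolding AE_all_countable using compact_case[OF C(1,2)] by blast
  then show ?thesis by eventually_elim (use C(4) in auto)
qed

text \<open>\<open>weak_grad\<close> picks an arbitrary weak gradient; this makes the choice
  harmless up to null sets and justifies computing it from any explicit candidate.\<close>

lemma weak_gradient_unique:
  fixes \<Omega> :: "'a::euclidean_space set"
  assumes \<Omega>: "open \<Omega>" and g: "has_weak_gradient \<Omega> u g" and h: "has_weak_gradient \<Omega> u h"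
  shows "AE x in lebesgue. x \<in> \<Omega> \<longrightarrow> g x = h x"
proof -
  have "AE x in lebesgue. x \<in> \<Omega> \<longrightarrow> (g x - h x) \<bullet> b = 0" if b: "b \<in> Basis" for b
  proof (rule AE_0_if_integral_test_0[OF \<Omega>])
    have *: "integrable lebesgue (\<lambda>x. indicator K x * (g x \<bullet> b))" "integrable lebesgue (\<lambda>x. indicator K x * (h x \<bullet> b))"
      if K: "compact K" "K \<subseteq> \<Omega>" for K
      using integrable_inner_left[OF has_weak_gradientD(2)[OF \<Omega> g K], of b]
        integrable_inner_left[OF has_weak_gradientD(2)[OF \<Omega> h K], of b] by simp_all
    show "integrable lebesgue (\<lambda>x. indicator K x * ((g x - h x) \<bullet> b))"
      if K: "compact K" "K \<subseteq> \<Omega>" for K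
      using Bochner_Integration.integrable_diff[OF *[OF K]]
      by (simp add: inner_diff_left right_diff_distrib)
    fix \<phi> assume \<phi>: "\<phi> \<in> Ccinf \<Omega>"
    obtain K M where "support_bound \<Omega> K M \<phi>"
      by (rule Cc1D[OF subsetD[OF Ccinf_subset_Cc1 \<phi>]])
    note KM = support_boundD[OF this]
    note K = KM(1,2,3,5,8)
    have i: "integrable lebesgue (\<lambda>x. (g x \<bullet> b) * \<phi> x)" "integrable lebesgue (\<lambda>x. (h x \<bullet> b) * \<phi> x)"
      using integrable_mult_test[of K "\<lambda>x. g x \<bullet> b", OF _ K(5,3,4)]
        integrable_mult_test[of K "\<lambda>x. h x \<bullet> b", OF _ K(5,3,4)] *[OF K(1,2)] by (simp_all add: mult.commute)
    have "(LINT x|lebesgue. (g x \<bullet> b) * \<phi> x) = (LINT x|lebesgue. (h x \<bullet> b) * \<phi> x)"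
      using has_weak_gradientD(3)[OF \<Omega> g \<phi> b] has_weak_gradientD(3)[OF \<Omega> h \<phi> b] by simp
    then show "(LINT x|lebesgue. ((g x - h x) \<bullet> b) * \<phi> x) = 0"
      using i by (simp add: inner_diff_left left_diff_distrib)
  qed
  then have "AE x in lebesgue. \<forall>b\<in>Basis. x \<in> \<Omega> \<longrightarrow> (g x - h x) \<bullet> b = 0"
    by (intro AE_finite_allI) auto
  then show ?thesis
  proof eventually_elim
    case (elim x)
    show ?case
    proof (rule impI, rule euclidean_eqI)
      fix b :: 'a assume "x \<in> \<Omega>" "b \<in> Basis"
      then show "g x \<bullet> b = h x \<bullet> b" using elim by (simp add: inner_diff_left)
    qed
  qed
qed

lemma weak_grad_works:
  "has_weak_gradient \<Omega> u g \<Longrightarrow> has_weak_gradient \<Omega> u (weak_grad \<Omega> u)"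
  unfolding weak_grad_def by (rule someI[of "has_weak_gradient \<Omega> u"])

lemma has_weak_gradient_linear:
  assumes \<Omega>: "open \<Omega>" and u: "has_weak_gradient \<Omega> u g" and v: "has_weak_gradient \<Omega> v h"
  shows "has_weak_gradient \<Omega> (\<lambda>x. a * u x + c * v x) (\<lambda>x. a *\<^sub>R g x + c *\<^sub>R h x)"
proof (rule has_weak_gradientI[OF \<Omega>])
  fix K :: "'a set" assume K: "compact K" "K \<subseteq> \<Omega>"
  have "integrable lebesgue (\<lambda>x. a * (indicator K x * u x) + c * (indicator K x * v x))"
    using has_weak_gradientD(1)[OF \<Omega> u K] has_weak_gradientD(1)[OF \<Omega> v K] by simp
  then show "integrable lebesgue (\<lambda>x. indicator K x * (a * u x + c * v x))"
    by (simp add: algebra_simps)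
  have "integrable lebesgue (\<lambda>x. a *\<^sub>R (indicator K x *\<^sub>R g x) + c *\<^sub>R (indicator K x *\<^sub>R h x))"
    by (intro Bochner_Integration.integrable_add integrable_scaleR_right
        has_weak_gradientD(2)[OF \<Omega> u K] has_weak_gradientD(2)[OF \<Omega> v K])
  then show "integrable lebesgue (\<lambda>x. indicator K x *\<^sub>R (a *\<^sub>R g x + c *\<^sub>R h x))"
    by (simp add: algebra_simps)
next
  fix \<phi> and b :: 'a assume \<phi>: "\<phi> \<in> Ccinf \<Omega>" and b: "b \<in> Basis"
  obtain K M where "support_bound \<Omega> K M \<phi>"
    by (rule Cc1D[OF subsetD[OF Ccinf_subset_Cc1 \<phi>]])
  note KM = support_boundD[OF this]
  note K = KM(1-6,8,9)
  have "\<bar>grad \<phi> x \<bullet> b\<bar> \<le> M" for x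
    using Basis_le_norm[OF b, of "grad \<phi> x"] K(6)[of x] by linarith
  moreover have "continuous_on UNIV (\<lambda>x. grad \<phi> x \<bullet> b)"
    using K(8) by (intro continuous_intros)
  ultimately have t: "integrable lebesgue (\<lambda>x. f x * (grad \<phi> x \<bullet> b))"
    if "integrable lebesgue (\<lambda>x. indicator K x * f x)" for f :: "'a \<Rightarrow> real"
    using integrable_mult_test[of K f "\<lambda>x. grad \<phi> x \<bullet> b" M] that K(4) by (simp add: mult.commute)
  have t': "integrable lebesgue (\<lambda>x. (f x \<bullet> b) * \<phi> x)"
    if "integrable lebesgue (\<lambda>x. indicator K x *\<^sub>R f x)" for f :: "'a \<Rightarrow> 'a"
    using integrable_inner_left[OF integrable_mult_test[OF that K(7,3,5)], of b] by (simp add: mult.commute)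
  have 1: "(LINT x|lebesgue. (a * u x + c * v x) * (grad \<phi> x \<bullet> b)) =
     a * (LINT x|lebesgue. u x * (grad \<phi> x \<bullet> b)) + c * (LINT x|lebesgue. v x * (grad \<phi> x \<bullet> b))"
    using t[OF has_weak_gradientD(1)[OF \<Omega> u K(1,2)]] t[OF has_weak_gradientD(1)[OF \<Omega> v K(1,2)]]
    by (simp add: distrib_right mult.assoc)
  have 2: "(LINT x|lebesgue. ((a *\<^sub>R g x + c *\<^sub>R h x) \<bullet> b) * \<phi> x) =
     a * (LINT x|lebesgue. (g x \<bullet> b) * \<phi> x) + c * (LINT x|lebesgue. (h x \<bullet> b) * \<phi> x)"
    using t'[OF has_weak_gradientD(2)[OF \<Omega> u K(1,2)]] t'[OF has_weak_gradientD(2)[OF \<Omega> v K(1,2)]]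
    by (simp add: inner_add_left distrib_right mult.assoc)
  show "(LINT x|lebesgue. (a * u x + c * v x) * (grad \<phi> x \<bullet> b)) =
     - (LINT x|lebesgue. ((a *\<^sub>R g x + c *\<^sub>R h x) \<bullet> b) * \<phi> x)"
    unfolding 1 2 using has_weak_gradientD(3)[OF \<Omega> u \<phi> b] has_weak_gradientD(3)[OF \<Omega> v \<phi> b] by simp
qed

section \<open>The chain rule\<close>

lemma integral_lebesgue_translate:
  fixes f :: "'a::euclidean_space \<Rightarrow> real"
  assumes [measurable]: "f \<in> borel_measurable borel"
  shows "(LINT x|lebesgue. f (c + x)) = (LINT x|lebesgue. f x)"
    and "integrable lebesgue f \<Longrightarrow> integrable lebesgue (\<lambda>x. f (c + x))"
proof -
  have "(LINT x|lborel. f x) = (LINT x|distr lborel borel ((+) c). f x)"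
    by (simp only: lborel_distr_plus)
  also have "\<dots> = (LINT x|lborel. f (c + x))"
    by (rule integral_distr) simp_all
  finally show "(LINT x|lebesgue. f (c + x)) = (LINT x|lebesgue. f x)"
    by (simp add: integral_completion)
  assume "integrable lebesgue f"
  then have "integrable lborel f" by (simp add: integrable_completion)
  then have "integrable (distr lborel borel ((+) c)) f"
    by (simp only: lborel_distr_plus)
  then have "integrable lborel (\<lambda>x. f (c + x))"
    by (subst (asm) integrable_distr_eq) simp_all
  then show "integrable lebesgue (\<lambda>x. f (c + x))"
    by (simp add: integrable_completion)
qed

lemma Cc1_integrable:
  assumes "\<phi> \<in> Cc1 \<Omega>"
  shows "integrable lebesgue \<phi>" "integrable lebesgue (\<lambda>x. grad \<phi> x \<bullet> b)"
proof -
  obtain K M where "support_bound \<Omega> K M \<phi>"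
    by (rule Cc1D[OF assms])
  note KM = support_boundD[OF this]
  have "(\<lambda>x. indicat_real K x *\<^sub>R \<phi> x) = \<phi>" "(\<lambda>x. indicat_real K x *\<^sub>R (grad \<phi> x \<bullet> b)) = (\<lambda>x. grad \<phi> x \<bullet> b)"
    using KM(3,4) by (auto simp: fun_eq_iff indicator_def)
  moreover have "continuous_on UNIV (\<lambda>x. grad \<phi> x \<bullet> b)" using KM(9) by (intro continuous_on_inner continuous_on_const)
  ultimately show "integrable lebesgue \<phi>" "integrable lebesgue (\<lambda>x. grad \<phi> x \<bullet> b)"
    using integrable_continuous_compact[OF KM(8) KM(1)]
      integrable_continuous_compact[of "\<lambda>x. grad \<phi> x \<bullet> b", OF _ KM(1)] by metis+
qed

text \<open>By translation invariance the difference quotients in direction b integrate to 0. They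
  are dominated by a multiple of the Lipschitz constant on a ball, so the integral of their limit is
  0 as well.\<close>

lemma integral_grad_Cc1:
  fixes F :: "'a::euclidean_space \<Rightarrow> real"
  assumes "F \<in> Cc1 \<Omega>"
  shows "(LINT x|lebesgue. grad F x \<bullet> b) = 0"
proof -
  obtain K M where "support_bound \<Omega> K M F"
    by (rule Cc1D[OF assms])
  note KM = support_boundD[OF this]
  have mF [measurable]: "F \<in> borel_measurable borel"
    using KM(8) by (rule borel_measurable_continuous_onI)
  have lip: "\<bar>F x - F y\<bar> \<le> M * norm (x - y)" for x y
  proof -
    have "norm (F x - F y) \<le> M * norm (x - y)"
    proof (rule differentiable_bound[of UNIV _ "\<lambda>x v. grad F x \<bullet> v"])
      show "onorm ((\<bullet>) (grad F z)) \<le> M" for z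
      proof (rule onorm_le)
        fix v show "norm (grad F z \<bullet> v) \<le> M * norm v"
          using Cauchy_Schwarz_ineq2[of "grad F z" v] mult_right_mono[OF KM(6)[of z] norm_ge_zero[of v]] by simp
      qed
    qed (auto intro: has_derivative_at_withinI KM(10))
    then show ?thesis by simp
  qed
  obtain R where R: "\<And>x. x \<in> K \<Longrightarrow> norm x \<le> R"
    using compact_imp_bounded[OF KM(1)] unfolding bounded_iff by blast
  define t where "t n = 1 / real (Suc n)" for n
  have t: "0 < t n" "t n \<le> 1" for n by (auto simp: t_def divide_simps)
  have t0: "t \<longlonglongrightarrow> 0" unfolding t_def by (rule LIMSEQ_Suc[OF lim_const_over_n])
  \<comment> \<open>Steps are at most 1, so x and its shift both avoid the support once |x| exceeds
    R + |b|.\<close>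
  let ?B = "cball (0::'a) (R + norm b)"
  have "(\<lambda>n. LINT x|lebesgue. (F (t n *\<^sub>R b + x) - F x) / t n) \<longlonglongrightarrow> (LINT x|lebesgue. grad F x \<bullet> b)"
  proof (rule integral_dominated_convergence[where w="\<lambda>x. indicator ?B x * (M * norm b)"])
    show "AE x in lebesgue. (\<lambda>n. (F (t n *\<^sub>R b + x) - F x) / t n) \<longlonglongrightarrow> grad F x \<bullet> b"
    proof (intro AE_I2)
      fix x
      have "((\<lambda>s. F (x + s *\<^sub>R b)) has_derivative (\<lambda>s. grad F x \<bullet> (s *\<^sub>R b))) (at 0)"
        by (rule has_derivative_compose[of "\<lambda>s. x + s *\<^sub>R b" "\<lambda>s. s *\<^sub>R b" 0 UNIV F])
           (auto intro!: derivative_eq_intros KM(10))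
      then have "((\<lambda>s. F (x + s *\<^sub>R b)) has_real_derivative grad F x \<bullet> b) (at 0)"
        by (simp add: has_field_derivative_def mult.commute[of _ "grad F x \<bullet> b"])
      then have "((\<lambda>s. (F (x + s *\<^sub>R b) - F x) / s) \<longlongrightarrow> grad F x \<bullet> b) (at 0)"
        by (simp add: DERIV_def)
      then have "(\<lambda>n. (F (x + t n *\<^sub>R b) - F x) / t n) \<longlonglongrightarrow> grad F x \<bullet> b"
        using t0 t(1) by (intro LIMSEQ_SEQ_conv[THEN iffD2, rule_format]) (auto simp: less_imp_neq[symmetric])
      then show "(\<lambda>n. (F (t n *\<^sub>R b + x) - F x) / t n) \<longlonglongrightarrow> grad F x \<bullet> b"
        by (simp add: add.commute)
    qed
    show "AE x in lebesgue. norm ((F (t n *\<^sub>R b + x) - F x) / t n) \<le> indicator ?B x * (M * norm b)" for n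
    proof (intro AE_I2)
      fix x
      show "norm ((F (t n *\<^sub>R b + x) - F x) / t n) \<le> indicator ?B x * (M * norm b)"
      proof (cases "x \<in> ?B")
        case True
        then show ?thesis using lip[of "t n *\<^sub>R b + x" x] t(1)[of n] by (simp add: divide_simps mult_ac)
      next
        case False
        then have x: "R + norm b < norm x" by simp
        have "norm x \<le> norm (t n *\<^sub>R b + x) + norm (t n *\<^sub>R b)"
          using norm_triangle_ineq4[of "t n *\<^sub>R b + x" "t n *\<^sub>R b"] by simp
        also have "norm (t n *\<^sub>R b) \<le> norm b"
          using t[of n] by (simp add: mult_left_le_one_le)
        finally have "t n *\<^sub>R b + x \<notin> K" "x \<notin> K" using x R[of "t n *\<^sub>R b + x"] R[of x] norm_ge_zero[of b] by linarith+
        then show ?thesis using KM(3,7) by simp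
      qed
    qed
    show "integrable lebesgue (\<lambda>x. indicator ?B x * (M * norm b))"
      by (rule integrable_indicator_compact) simp
    show "(\<lambda>x. grad F x \<bullet> b) \<in> borel_measurable lebesgue"
      using Cc1_integrable(2)[OF assms, of b] by simp
    show "(\<lambda>x. (F (t n *\<^sub>R b + x) - F x) / t n) \<in> borel_measurable lebesgue" for n
      by (intro borel_measurable_lebesgue_compose) measurable
  qed
  note lim = this
  have eq: "(LINT x|lebesgue. (F (t n *\<^sub>R b + x) - F x) / t n) = 0" for n
    using integral_lebesgue_translate[OF mF, of "t n *\<^sub>R b"] Cc1_integrable(1)[OF assms]
    by (simp add: diff_divide_distrib)
  show ?thesis
    using lim unfolding eq by (simp add: LIMSEQ_const_iff)
qed

lemma Ck_on_1D:
  assumes "Ck_on 1 UNIV u"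
  shows "(u has_derivative (\<lambda>v. grad u x \<bullet> v)) (at x)" "continuous_on UNIV u" "continuous_on UNIV (grad u)"
  using assms[unfolded Ck_on_1_iff] Ck_on_imp_continuous[OF assms] by (auto intro: has_derivative_grad)

lemma Ck_on_1I:
  assumes "\<And>x. (u has_derivative (\<lambda>v. g x \<bullet> v)) (at x)" "continuous_on UNIV g"
  shows "Ck_on 1 UNIV u" "grad u = g"
proof -
  show eq: "grad u = g" using grad_eqI[OF assms(1)] by (rule ext)
  show "Ck_on 1 UNIV u"
    unfolding Ck_on_1_iff eq using assms by (auto simp: differentiable_def)
qed

lemma Cc1_mult:
  assumes u: "Ck_on 1 UNIV u" and \<psi>: "\<psi> \<in> Cc1 \<Omega>"
  shows "(\<lambda>x. u x * \<psi> x) \<in> Cc1 \<Omega>"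
    and "grad (\<lambda>x. u x * \<psi> x) x = u x *\<^sub>R grad \<psi> x + \<psi> x *\<^sub>R grad u x"
proof -
  have \<psi>1: "Ck_on 1 UNIV \<psi>" "{x. \<psi> x \<noteq> 0} \<Subset> \<Omega>"
    using \<psi> unfolding Cc1_def mem_Collect_eq by (rule conjunct1, rule conjunct2)
  have "((\<lambda>x. u x * \<psi> x) has_derivative (\<lambda>v. (u x *\<^sub>R grad \<psi> x + \<psi> x *\<^sub>R grad u x) \<bullet> v)) (at x)" for x
    using has_derivative_mult[OF Ck_on_1D(1)[OF u] Ck_on_1D(1)[OF \<psi>1(1)], of x]
    by (simp add: inner_add_left mult.commute)
  moreover have "continuous_on UNIV (\<lambda>x. u x *\<^sub>R grad \<psi> x + \<psi> x *\<^sub>R grad u x)"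
    by (intro continuous_intros Ck_on_1D u \<psi>1)
  ultimately have *: "Ck_on 1 UNIV (\<lambda>x. u x * \<psi> x)"
    and g: "grad (\<lambda>x. u x * \<psi> x) = (\<lambda>x. u x *\<^sub>R grad \<psi> x + \<psi> x *\<^sub>R grad u x)"
    by (rule Ck_on_1I)+
  show "grad (\<lambda>x. u x * \<psi> x) x = u x *\<^sub>R grad \<psi> x + \<psi> x *\<^sub>R grad u x"
    by (simp only: g)
  have sub: "closure {x. u x * \<psi> x \<noteq> 0} \<subseteq> closure {x. \<psi> x \<noteq> 0}"
    by (intro closure_mono) auto
  then have "{x. u x * \<psi> x \<noteq> 0} \<Subset> \<Omega>"
    using \<psi>1(2) unfolding compactly_contained_def
    by (meson bounded_subset closed_closure compact_eq_bounded_closed order_trans)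
  with * show "(\<lambda>x. u x * \<psi> x) \<in> Cc1 \<Omega>" by (simp only: Cc1_def mem_Collect_eq simp_thms)
qed

text \<open>The product has compact support and hence a gradient of mean 0. The factor u is merely
  C^1, which is what composites with mollifications are.\<close>

lemma integration_by_parts_C1:
  assumes u: "Ck_on 1 UNIV u" and \<psi>: "\<psi> \<in> Cc1 \<Omega>"
  shows "integrable lebesgue (\<lambda>x. u x * (grad \<psi> x \<bullet> b))" "integrable lebesgue (\<lambda>x. (grad u x \<bullet> b) * \<psi> x)"
    "(LINT x|lebesgue. u x * (grad \<psi> x \<bullet> b)) = - (LINT x|lebesgue. (grad u x \<bullet> b) * \<psi> x)"
proof -
  obtain K M where "support_bound \<Omega> K M \<psi>"
    by (rule Cc1D[OF \<psi>])
  note KM = support_boundD[OF this]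
  have "(\<lambda>x. indicat_real K x *\<^sub>R (u x * (grad \<psi> x \<bullet> b))) = (\<lambda>x. u x * (grad \<psi> x \<bullet> b))"
    using KM(4) by (auto simp: fun_eq_iff indicator_def)
  moreover have "integrable lebesgue (\<lambda>x. indicat_real K x *\<^sub>R (u x * (grad \<psi> x \<bullet> b)))"
    by (intro integrable_continuous_compact KM continuous_intros Ck_on_1D u)
  ultimately show 1: "integrable lebesgue (\<lambda>x. u x * (grad \<psi> x \<bullet> b))" by metis
  have "(\<lambda>x. indicat_real K x *\<^sub>R ((grad u x \<bullet> b) * \<psi> x)) = (\<lambda>x. (grad u x \<bullet> b) * \<psi> x)"
    using KM(3) by (auto simp: fun_eq_iff indicator_def)
  moreover have "integrable lebesgue (\<lambda>x. indicat_real K x *\<^sub>R ((grad u x \<bullet> b) * \<psi> x))"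
    by (intro integrable_continuous_compact KM continuous_intros Ck_on_1D u)
  ultimately show 2: "integrable lebesgue (\<lambda>x. (grad u x \<bullet> b) * \<psi> x)" by metis
  have "(LINT x|lebesgue. u x * (grad \<psi> x \<bullet> b) + (grad u x \<bullet> b) * \<psi> x) = 0"
    using integral_grad_Cc1[OF Cc1_mult(1)[OF u \<psi>], of b] unfolding Cc1_mult(2)[OF u \<psi>]
    by (simp add: inner_add_left mult.commute)
  then show "(LINT x|lebesgue. u x * (grad \<psi> x \<bullet> b)) = - (LINT x|lebesgue. (grad u x \<bullet> b) * \<psi> x)"
    using 1 2 by simp
qed

lemma has_weak_gradient_C1:
  assumes "open \<Omega>" "Ck_on 1 UNIV u"
  shows "has_weak_gradient \<Omega> u (grad u)"
proof (rule has_weak_gradientI[OF assms(1)])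
  fix K :: "'a set" assume K: "compact K"
  show "integrable lebesgue (\<lambda>x. indicator K x * u x)"
    using integrable_continuous_compact[OF Ck_on_1D(2)[OF assms(2)] K] by simp
  show "integrable lebesgue (\<lambda>x. indicator K x *\<^sub>R grad u x)"
    by (rule integrable_continuous_compact[OF Ck_on_1D(3)[OF assms(2)] K])
qed (rule integration_by_parts_C1(3)[OF assms(2) subsetD[OF Ccinf_subset_Cc1]])

lemma integral_tendsto_L1:
  fixes a :: "nat \<Rightarrow> 'a \<Rightarrow> real"
  assumes "\<And>n. integrable M (a n)" "integrable M l" "\<And>n. integrable M (e n)"
    and "\<And>n. AE x in M. \<bar>a n x - l x\<bar> \<le> e n x"
    and "(\<lambda>n. integral\<^sup>L M (e n)) \<longlonglongrightarrow> 0"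
  shows "(\<lambda>n. integral\<^sup>L M (a n)) \<longlonglongrightarrow> integral\<^sup>L M l"
proof (rule LIM_zero_cancel, rule Lim_null_comparison[OF _ assms(5)], rule always_eventually, rule allI)
  fix n
  have "norm (integral\<^sup>L M (a n) - integral\<^sup>L M l) = norm (LINT x|M. a n x - l x)"
    using assms by simp
  also have "\<dots> \<le> (LINT x|M. norm (a n x - l x))" by (rule integral_norm_bound)
  also have "\<dots> \<le> integral\<^sup>L M (e n)"
    using assms by (intro integral_mono_AE) auto
  finally show "norm (integral\<^sup>L M (a n) - integral\<^sup>L M l) \<le> integral\<^sup>L M (e n)" .
qed

lemma Ck_on_1_compose:
  fixes u :: "'a::euclidean_space \<Rightarrow> real"
  assumes u: "Ck_on 1 UNIV u" and h: "\<And>t. (h has_real_derivative h' t) (at t)" "continuous_on UNIV h'"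
  shows "Ck_on 1 UNIV (\<lambda>x. h (u x))" "grad (\<lambda>x. h (u x)) = (\<lambda>x. h' (u x) *\<^sub>R grad u x)"
proof -
  have "((\<lambda>x. h (u x)) has_derivative (\<lambda>v. (h' (u x) *\<^sub>R grad u x) \<bullet> v)) (at x)" for x
    using has_derivative_compose[OF Ck_on_1D(1)[OF u] h(1)[THEN has_field_derivative_imp_has_derivative], of x]
    by simp
  moreover have "continuous_on UNIV (\<lambda>x. h' (u x) *\<^sub>R grad u x)"
    by (intro continuous_on_scaleR continuous_on_compose2[OF h(2)] Ck_on_1D u) auto
  ultimately show "Ck_on 1 UNIV (\<lambda>x. h (u x))" "grad (\<lambda>x. h (u x)) = (\<lambda>x. h' (u x) *\<^sub>R grad u x)"
    by (rule Ck_on_1I)+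
qed

lemma real_lipschitz_bound:
  fixes h :: "real \<Rightarrow> real"
  assumes "\<And>t. (h has_real_derivative h' t) (at t)" "\<And>t. \<bar>h' t\<bar> \<le> L"
  shows "\<bar>h s - h t\<bar> \<le> L * \<bar>s - t\<bar>"
  using field_differentiable_bound[of UNIV h h' L s t] assms
  by (auto intro: has_field_derivative_at_within)

lemma borel_measurable_has_real_derivative:
  fixes h :: "real \<Rightarrow> real"
  assumes "\<And>t. (h has_real_derivative h' t) (at t)"
  shows "h \<in> borel_measurable borel"
  by (rule borel_measurable_continuous_onI, rule DERIV_continuous_on, rule has_field_derivative_at_within[OF assms])

text \<open>Classical for the mollifications of u, then a limit. On the left h is Lipschitz and L1
  convergence suffices. On the right the gradients converge in L1 against the bounded factor h',
  while the change of h' is multiplied by the fixed integrable gradient and is treated by dominated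
  convergence.\<close>

lemma has_weak_gradient_chain:
  fixes \<Omega> :: "'a::euclidean_space set"
  assumes \<Omega>: "open \<Omega>" and wg: "has_weak_gradient \<Omega> u g"
    and h: "\<And>t. (h has_real_derivative h' t) (at t)" "continuous_on UNIV h'" "\<And>t. \<bar>h' t\<bar> \<le> L"
  shows "has_weak_gradient \<Omega> (\<lambda>x. h (u x)) (\<lambda>x. h' (u x) *\<^sub>R g x)"
proof (rule has_weak_gradientI[OF \<Omega>])
  have mh [measurable]: "h \<in> borel_measurable borel" by (rule borel_measurable_has_real_derivative[OF h(1)])
  have mh' [measurable]: "h' \<in> borel_measurable borel" by (rule borel_measurable_continuous_onI[OF h(2)])
  have lip: "\<bar>h s - h t\<bar> \<le> L * \<bar>s - t\<bar>" for s t by (rule real_lipschitz_bound[OF h(1,3)])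
  have L0: "0 \<le> L" using h(3)[of 0] by linarith
  show iu: "integrable lebesgue (\<lambda>x. indicator K x * h (u x))" if K: "compact K" "K \<subseteq> \<Omega>" for K
  proof -
    note i = has_weak_gradientD(1)[OF \<Omega> wg K]
    have [measurable]: "(\<lambda>x. indicator K x * u x) \<in> borel_measurable lebesgue" using i by simp
    have [measurable]: "K \<in> sets lebesgue" by (rule sets_lebesgue_compact[OF K(1)])
    have "integrable lebesgue (\<lambda>x. indicator K x * h (indicator K x * u x))"
    proof (rule Bochner_Integration.integrable_bound)
      show "integrable lebesgue (\<lambda>x. indicator K x * \<bar>h 0\<bar> + L * \<bar>indicator K x * u x\<bar>)"
        using i integrable_indicator_compact[OF K(1)] by auto
      show "(\<lambda>x. indicator K x * h (indicator K x * u x)) \<in> borel_measurable lebesgue" by measurable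
      show "AE x in lebesgue. norm (indicator K x * h (indicator K x * u x)) \<le> norm (indicator K x * \<bar>h 0\<bar> + L * \<bar>indicator K x * u x\<bar>)"
      proof (intro AE_I2)
        fix x
        have "\<bar>h (u x)\<bar> \<le> \<bar>h 0\<bar> + L * \<bar>u x\<bar>" using lip[of "u x" 0] by simp
        then show "norm (indicator K x * h (indicator K x * u x)) \<le> norm (indicator K x * \<bar>h 0\<bar> + L * \<bar>indicator K x * u x\<bar>)"
          by (cases "x \<in> K") auto
      qed
    qed
    moreover have "(\<lambda>x. indicator K x * h (indicator K x * u x)) = (\<lambda>x. indicator K x * h (u x))"
      by (auto simp: indicator_def fun_eq_iff)
    ultimately show ?thesis by metis
  qed
  show ig: "integrable lebesgue (\<lambda>x. indicator K x *\<^sub>R (h' (u x) *\<^sub>R g x))" if K: "compact K" "K \<subseteq> \<Omega>" for K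
  proof -
    have [measurable]: "(\<lambda>x. indicator K x * u x) \<in> borel_measurable lebesgue"
      using has_weak_gradientD(1)[OF \<Omega> wg K] by simp
    have "integrable lebesgue (\<lambda>x. h' (indicator K x * u x) *\<^sub>R (indicat_real K x *\<^sub>R g x))"
      by (rule integrable_mult_bounded[OF has_weak_gradientD(2)[OF \<Omega> wg K] _ h(3)]) measurable
    moreover have "(\<lambda>x. h' (indicator K x * u x) *\<^sub>R (indicat_real K x *\<^sub>R g x)) = (\<lambda>x. indicator K x *\<^sub>R (h' (u x) *\<^sub>R g x))"
      by (auto simp: indicator_def fun_eq_iff)
    ultimately show ?thesis by metis
  qed
  fix \<phi> and b :: 'a assume \<phi>: "\<phi> \<in> Ccinf \<Omega>" and b: "b \<in> Basis"
  note \<phi>1 = subsetD[OF Ccinf_subset_Cc1 \<phi>]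
  obtain K M where "support_bound \<Omega> K M \<phi>"
    by (rule Cc1D[OF \<phi>1])
  note KM = support_boundD[OF this]
  obtain K' d where K': "compact K'" "K' \<subseteq> \<Omega>" "0 < d" "K \<subseteq> K'" "\<And>x. x \<in> K \<Longrightarrow> cball x d \<subseteq> K'"
    by (rule compact_in_open_cball[OF KM(1) \<Omega> KM(2)]) (rule that)
  obtain R where R: "\<And>x. x \<in> K' \<Longrightarrow> norm x \<le> R"
    using compact_imp_bounded[OF K'(1)] unfolding bounded_iff by blast
  define f where "f = (\<lambda>x. indicator K' x * u x)"
  define G where "G = (\<lambda>x. indicat_real K' x *\<^sub>R g x)"
  have f: "integrable lebesgue f" and G: "integrable lebesgue G"
    unfolding f_def G_def by (rule has_weak_gradientD(1)[OF \<Omega> wg K'(1,2)], rule has_weak_gradientD(2)[OF \<Omega> wg K'(1,2)])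
  have f0: "f x = 0" if "R < norm x" for x using R[of x] that by (cases "x \<in> K'") (auto simp: f_def)
  have G0: "G x = 0" if "R < norm x" for x using R[of x] that by (cases "x \<in> K'") (auto simp: G_def)
  have [measurable]: "f \<in> borel_measurable lebesgue" "G \<in> borel_measurable lebesgue"
    "\<phi> \<in> borel_measurable lebesgue" "(\<lambda>x. grad \<phi> x \<bullet> b) \<in> borel_measurable lebesgue"
    using f G Cc1_integrable[OF \<phi>1] by auto
  define r0 where "r0 n = d / real (Suc n)" for n
  have r0: "0 < r0 n" "r0 n \<le> d" for n using K'(3) by (auto simp: r0_def divide_simps)
  have r00: "r0 \<longlonglongrightarrow> 0" unfolding r0_def by (rule LIMSEQ_Suc[OF lim_const_over_n])
  \<comment> \<open>A subsequence is needed because h' is merely continuous: its values converge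
    only where the mollifications converge pointwise.\<close>
  obtain q where q: "strict_mono q" "AE x in lebesgue. (\<lambda>n. moll (r0 (q n)) f x) \<longlonglongrightarrow> f x"
    by (rule moll_subseq_AE[where R=R and r=r0, OF f _ r0(1) r00]) (erule f0, rule that)
  define r where "r n = r0 (q n)" for n
  have r: "0 < r n" "r n \<le> d" for n using r0 by (auto simp: r_def)
  have rlim: "r \<longlonglongrightarrow> 0"
    using LIMSEQ_subseq_LIMSEQ[OF r00 q(1)] by (simp add: r_def[abs_def] comp_def)
  let ?u = "\<lambda>n. moll (r n) f"
  have iu': "integrable lebesgue (?u n)" "integrable lebesgue (moll (r n) G)" for n
    using integrable_moll(1)[OF f r(1)] integrable_moll(1)[OF G r(1)] by auto
  have [measurable]: "?u n \<in> borel_measurable lebesgue" "moll (r n) G \<in> borel_measurable lebesgue" for n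
    using iu' by auto
  have C1: "Ck_on 1 UNIV (?u n)" for n by (rule Ck_on_1_moll[OF f r(1)])
  note C1h = Ck_on_1_compose[OF C1 h(1,2)]
  note ibp = integration_by_parts_C1[OF C1h(1) \<phi>1, of _ b]
  have eq: "(grad (\<lambda>x. h (?u n x)) x \<bullet> b) * \<phi> x = h' (?u n x) * (moll (r n) G x \<bullet> b) * \<phi> x" for n x
  proof (cases "x \<in> K")
    case True
    have cb: "cball x (r n) \<subseteq> K'" using K'(5)[OF True] r(2)[of n] by force
    have "frechet_derivative (?u n) (at x) = dmoll (r n) f x"
      by (rule frechet_derivative_at[OF moll_has_derivative[OF f r(1)], symmetric])
    then have "grad (?u n) x \<bullet> b = dmoll (r n) f x b"
      by (simp only: grad_inner[OF b])
    also have "\<dots> = moll (r n) G x \<bullet> b"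
      unfolding f_def G_def by (rule dmoll_weak_gradient[OF \<Omega> wg K'(1,2) cb r(1) b])
    finally show ?thesis by (simp add: C1h(2))
  qed (simp add: KM(3))
  have gb: "\<bar>grad \<phi> x \<bullet> b\<bar> \<le> M" for x using Basis_le_norm[OF b, of "grad \<phi> x"] KM(6)[of x] by linarith
  have A: "(\<lambda>n. LINT x|lebesgue. h (?u n x) * (grad \<phi> x \<bullet> b)) \<longlonglongrightarrow> (LINT x|lebesgue. h (u x) * (grad \<phi> x \<bullet> b))"
  proof (rule integral_tendsto_L1[where e="\<lambda>n x. L * M * norm (?u n x - f x)"])
    show "integrable lebesgue (\<lambda>x. h (?u n x) * (grad \<phi> x \<bullet> b))" for n by (rule ibp(1))
    show "integrable lebesgue (\<lambda>x. h (u x) * (grad \<phi> x \<bullet> b))"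
      using integrable_mult_test[of K "\<lambda>x. h (u x)" "\<lambda>x. grad \<phi> x \<bullet> b" M] iu[OF KM(1,2)] KM(4) gb KM(9)
      by (simp add: mult.commute continuous_on_inner)
    show "integrable lebesgue (\<lambda>x. L * M * norm (?u n x - f x))" for n using iu' f by simp
    show "AE x in lebesgue. \<bar>h (?u n x) * (grad \<phi> x \<bullet> b) - h (u x) * (grad \<phi> x \<bullet> b)\<bar> \<le> L * M * norm (?u n x - f x)" for n
    proof (intro AE_I2)
      fix x
      show "\<bar>h (?u n x) * (grad \<phi> x \<bullet> b) - h (u x) * (grad \<phi> x \<bullet> b)\<bar> \<le> L * M * norm (?u n x - f x)"
      proof (cases "x \<in> K")
        case True
        then have fx: "f x = u x" using K'(4) by (auto simp: f_def)
        have "\<bar>h (?u n x) * (grad \<phi> x \<bullet> b) - h (u x) * (grad \<phi> x \<bullet> b)\<bar> = \<bar>h (?u n x) - h (u x)\<bar> * \<bar>grad \<phi> x \<bullet> b\<bar>"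
          by (simp add: abs_mult[symmetric] left_diff_distrib)
        also have "\<dots> \<le> (L * \<bar>?u n x - f x\<bar>) * M"
          using lip gb by (intro mult_mono) (auto simp: fx L0)
        finally show ?thesis by (simp add: mult_ac)
      qed (use KM(4,7) L0 in simp)
    qed
    show "(\<lambda>n. LINT x|lebesgue. L * M * norm (?u n x - f x)) \<longlonglongrightarrow> 0"
    proof -
      have "(\<lambda>n. LINT x|lebesgue. norm (moll (r n) f x - f x)) \<longlonglongrightarrow> 0"
        by (rule moll_tendsto_L1[where R=R, OF f _ r(1) rlim]) (erule f0)
      from tendsto_mult_right_zero[OF this, of "L * M"] show ?thesis by simp
    qed
  qed
  have B: "(\<lambda>n. LINT x|lebesgue. h' (?u n x) * (moll (r n) G x \<bullet> b) * \<phi> x) \<longlonglongrightarrow> (LINT x|lebesgue. ((h' (u x) *\<^sub>R g x) \<bullet> b) * \<phi> x)"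
  proof (rule integral_tendsto_L1[where e="\<lambda>n x. L * M * norm (moll (r n) G x - G x) + M * (\<bar>h' (?u n x) - h' (f x)\<bar> * norm (G x))"])
    show "integrable lebesgue (\<lambda>x. h' (?u n x) * (moll (r n) G x \<bullet> b) * \<phi> x)" for n
      using ibp(2)[of n] by (simp only: eq)
    show "integrable lebesgue (\<lambda>x. ((h' (u x) *\<^sub>R g x) \<bullet> b) * \<phi> x)"
      using integrable_inner_left[OF integrable_mult_test[OF ig[OF KM(1,2)] KM(8,3,5)], of b] by (simp add: mult_ac)
    have hb: "\<bar>h' s - h' t\<bar> \<le> 2 * L" for s t using h(3)[of s] h(3)[of t] by linarith
    have i2: "integrable lebesgue (\<lambda>x. \<bar>h' (?u n x) - h' (f x)\<bar> * norm (G x))" for n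
      using integrable_mult_bounded[OF integrable_norm[OF G], of "\<lambda>x. \<bar>h' (?u n x) - h' (f x)\<bar>" "2 * L"] hb by simp
    have i1: "integrable lebesgue (\<lambda>x. norm (moll (r n) G x - G x))" for n
      using iu' G by simp
    show "integrable lebesgue (\<lambda>x. L * M * norm (moll (r n) G x - G x) + M * (\<bar>h' (?u n x) - h' (f x)\<bar> * norm (G x)))" for n
      using i1 i2 by simp
    show "AE x in lebesgue. \<bar>h' (?u n x) * (moll (r n) G x \<bullet> b) * \<phi> x - ((h' (u x) *\<^sub>R g x) \<bullet> b) * \<phi> x\<bar>
       \<le> L * M * norm (moll (r n) G x - G x) + M * (\<bar>h' (?u n x) - h' (f x)\<bar> * norm (G x))" for n
    proof (intro AE_I2)
      fix x
      show "\<bar>h' (?u n x) * (moll (r n) G x \<bullet> b) * \<phi> x - ((h' (u x) *\<^sub>R g x) \<bullet> b) * \<phi> x\<bar>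
       \<le> L * M * norm (moll (r n) G x - G x) + M * (\<bar>h' (?u n x) - h' (f x)\<bar> * norm (G x))"
      proof (cases "x \<in> K")
        case True
        then have fx: "f x = u x" "G x = g x" using K'(4) by (auto simp: f_def G_def)
        have "h' (?u n x) * (moll (r n) G x \<bullet> b) * \<phi> x - ((h' (u x) *\<^sub>R g x) \<bullet> b) * \<phi> x =
          h' (?u n x) * ((moll (r n) G x - G x) \<bullet> b) * \<phi> x + (h' (?u n x) - h' (f x)) * (G x \<bullet> b) * \<phi> x"
          by (simp add: fx inner_diff_left algebra_simps)
        also have "\<bar>\<dots>\<bar> \<le> \<bar>h' (?u n x)\<bar> * \<bar>(moll (r n) G x - G x) \<bullet> b\<bar> * \<bar>\<phi> x\<bar> + \<bar>h' (?u n x) - h' (f x)\<bar> * \<bar>G x \<bullet> b\<bar> * \<bar>\<phi> x\<bar>"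
          by (rule order_trans[OF abs_triangle_ineq]) (simp add: abs_mult)
        also have "\<dots> \<le> L * norm (moll (r n) G x - G x) * M + \<bar>h' (?u n x) - h' (f x)\<bar> * norm (G x) * M"
          using h(3) KM(5) Basis_le_norm[OF b] L0 by (intro add_mono mult_mono) auto
        finally show ?thesis by (simp add: mult_ac)
      qed (use KM(3,7) L0 in simp)
    qed
    have l2: "(\<lambda>n. LINT x|lebesgue. \<bar>h' (?u n x) - h' (f x)\<bar> * norm (G x)) \<longlonglongrightarrow> (LINT x::'a|lebesgue. 0)"
    proof (rule integral_dominated_convergence[where f="\<lambda>_. 0 :: real" and w="\<lambda>x. 2 * L * norm (G x)"])
      show "AE x in lebesgue. (\<lambda>n. \<bar>h' (?u n x) - h' (f x)\<bar> * norm (G x)) \<longlonglongrightarrow> 0"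
        using q(2)
      proof eventually_elim
        case (elim x)
        have "(\<lambda>n. h' (?u n x)) \<longlonglongrightarrow> h' (f x)"
          using elim by (intro continuous_on_tendsto_compose[OF h(2)]) (auto simp: r_def)
        from tendsto_mult_left_zero[OF tendsto_rabs_zero[OF LIM_zero[OF this]]] show ?case .
      qed
      show "AE x in lebesgue. norm (\<bar>h' (?u n x) - h' (f x)\<bar> * norm (G x)) \<le> 2 * L * norm (G x)" for n
        using hb by (intro AE_I2) (auto simp: abs_mult intro!: mult_right_mono)
    qed (use G in auto)
    have "(\<lambda>n. L * M * (LINT x|lebesgue. norm (moll (r n) G x - G x)) + M * (LINT x|lebesgue. \<bar>h' (?u n x) - h' (f x)\<bar> * norm (G x))) \<longlonglongrightarrow> L * M * 0 + M * 0"
    proof (intro tendsto_add tendsto_mult tendsto_const)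
      show "(\<lambda>n. LINT x|lebesgue. norm (moll (r n) G x - G x)) \<longlonglongrightarrow> 0"
        by (rule moll_tendsto_L1[where R=R, OF G _ r(1) rlim]) (erule G0)
    qed (use l2 in simp)
    then show "(\<lambda>n. LINT x|lebesgue. L * M * norm (moll (r n) G x - G x) + M * (\<bar>h' (?u n x) - h' (f x)\<bar> * norm (G x))) \<longlonglongrightarrow> 0"
      using i1 i2 by simp
  qed
  have "(\<lambda>n. LINT x|lebesgue. h (?u n x) * (grad \<phi> x \<bullet> b)) \<longlonglongrightarrow> - (LINT x|lebesgue. ((h' (u x) *\<^sub>R g x) \<bullet> b) * \<phi> x)"
    using tendsto_minus[OF B] by (simp only: ibp(3) eq)
  with A show "(LINT x|lebesgue. h (u x) * (grad \<phi> x \<bullet> b)) = - (LINT x|lebesgue. ((h' (u x) *\<^sub>R g x) \<bullet> b) * \<phi> x)"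
    by (rule LIMSEQ_unique)
qed

section \<open>Vanishing gradients and locally defined Sobolev functions\<close>

lemma AE_open_imp:
  fixes S :: "'a::euclidean_space set"
  assumes "open S" "S \<noteq> {}" "AE x in lebesgue. x \<in> S \<longrightarrow> P"
  shows P
proof (rule ccontr)
  assume "\<not> P"
  obtain z where z: "z \<in> S" using assms(2) by blast
  have "AE x\<in>S in lebesgue. x \<in> {}"
    using assms(3) by eventually_elim (use \<open>\<not> P\<close> in simp)
  from mem_closed_if_AE_lebesgue_open[OF assms(1) closed_empty this z] show False by simp
qed

text \<open>On the smaller ball every mollification has zero derivative, because that derivative is
  the mollified weak gradient; it is therefore a constant depending on the radius. The function is
  almost everywhere the limit of these constants.\<close>

lemma weak_gradient_0_locally_const:
  fixes \<Omega> :: "'a::euclidean_space set"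
  assumes \<Omega>: "open \<Omega>" and wg: "has_weak_gradient \<Omega> u g"
    and g0: "AE x in lebesgue. x \<in> \<Omega> \<longrightarrow> g x = 0" and x0: "x0 \<in> \<Omega>"
  obtains R c where "0 < R" "ball x0 R \<subseteq> \<Omega>" "AE x in lebesgue. x \<in> ball x0 R \<longrightarrow> u x = c"
proof -
  obtain R0 where R0: "0 < R0" "cball x0 R0 \<subseteq> \<Omega>"
    using \<Omega> x0 unfolding open_contains_cball by blast
  \<comment> \<open>Half for the point and half for the mollification radius: kernel balls stay in
    \<open>cball x0 R0\<close>.\<close>
  define R where "R = R0 / 2"
  have R: "0 < R" using R0 by (simp add: R_def)
  let ?K = "cball x0 R0"
  define f where "f = (\<lambda>x. indicator ?K x * u x)"
  have f: "integrable lebesgue f"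
    unfolding f_def by (rule has_weak_gradientD(1)[OF \<Omega> wg compact_cball R0(2)])
  have f0: "f x = 0" if "norm x0 + R0 < norm x" for x
  proof -
    have "x \<notin> ?K"
    proof
      assume "x \<in> ?K"
      then have "norm x \<le> norm x0 + R0"
        using norm_triangle_ineq[of x0 "x - x0"] by (simp add: dist_norm norm_minus_commute)
      then show False using that by simp
    qed
    then show ?thesis by (simp add: f_def)
  qed
  define r0 where "r0 n = R / real (Suc n)" for n
  have r0: "0 < r0 n" "r0 n \<le> R" for n using R by (auto simp: r0_def divide_simps)
  have r00: "r0 \<longlonglongrightarrow> 0" unfolding r0_def by (rule LIMSEQ_Suc[OF lim_const_over_n])
  obtain q where q: "strict_mono q" "AE x in lebesgue. (\<lambda>n. moll (r0 (q n)) f x) \<longlonglongrightarrow> f x"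
    by (rule moll_subseq_AE[where R="norm x0 + R0" and r=r0, OF f _ r0(1) r00]) (erule f0, rule that)
  have const: "moll (r0 n) f x = moll (r0 n) f x0" if x: "x \<in> ball x0 R" for n x
  proof -
    have "(moll (r0 n) f has_derivative (\<lambda>v. 0)) (at y)" if y: "y \<in> ball x0 R" for y
    proof -
      have cb: "cball y (r0 n) \<subseteq> ?K"
      proof
        fix z assume "z \<in> cball y (r0 n)"
        then have "dist y z \<le> R" "dist x0 y < R"
          using r0(2)[of n] y by simp_all
        then show "z \<in> ?K" using dist_triangle[of x0 z y] by (simp add: R_def)
      qed
      have zero: "dmoll (r0 n) f y b = 0" if b: "b \<in> Basis" for b
      proof -
        have "dmoll (r0 n) f y b = moll (r0 n) (\<lambda>y. indicat_real ?K y *\<^sub>R g y) y \<bullet> b"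
          unfolding f_def by (rule dmoll_weak_gradient[OF \<Omega> wg compact_cball R0(2) cb r0(1) b])
        also have "moll (r0 n) (\<lambda>y. indicat_real ?K y *\<^sub>R g y) y = 0"
          unfolding moll_def
        proof (rule integral_eq_zero_AE)
          show "AE z in lebesgue. kern (r0 n) (y - z) *\<^sub>R (indicat_real ?K z *\<^sub>R g z) = 0"
            using g0 by eventually_elim (use R0(2) in \<open>auto simp: indicator_def\<close>)
        qed
        finally show ?thesis by simp
      qed
      have sum: "dmoll (r0 n) f y v = (\<Sum>b\<in>Basis. (v \<bullet> b) * dmoll (r0 n) f y b)" for v
      proof -
        have lin: "linear (dmoll (r0 n) f y)" by (rule has_derivative_linear[OF moll_has_derivative[OF f r0(1)]])
        have "dmoll (r0 n) f y v = dmoll (r0 n) f y (\<Sum>b\<in>Basis. (v \<bullet> b) *\<^sub>R b)"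
          by (simp add: euclidean_representation)
        then show ?thesis by (simp add: linear_sum[OF lin] linear_cmul[OF lin])
      qed
      have "dmoll (r0 n) f y = (\<lambda>v. 0)" by (rule ext, subst sum) (simp add: zero)
      then show ?thesis using moll_has_derivative[OF f r0(1), of n y] by simp
    qed
    then have "\<exists>c. \<forall>y\<in>ball x0 R. moll (r0 n) f y = c"
      by (intro has_derivative_zero_constant convex_ball) (rule has_derivative_at_withinI)
    moreover have "x0 \<in> ball x0 R" using R by simp
    ultimately show ?thesis using x by metis
  qed
  show ?thesis
  proof
    show "0 < R" by (rule R)
    have sub: "ball x0 R \<subseteq> ?K" using R by (auto simp: R_def)
    then show "ball x0 R \<subseteq> \<Omega>" using R0 by blast
    \<comment> \<open>The witness \<open>lim\<close> is meaningful only if the sequence of constants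
      converges; convergence at any good point x of the ball shows this and identifies the
      limit.\<close>
    show "AE x in lebesgue. x \<in> ball x0 R \<longrightarrow> u x = lim (\<lambda>n. moll (r0 (q n)) f x0)"
      using q(2)
    proof eventually_elim
      case (elim x)
      show ?case
      proof
        assume x: "x \<in> ball x0 R"
        then have "(\<lambda>n. moll (r0 (q n)) f x0) \<longlonglongrightarrow> f x" using elim const[OF x] by simp
        then have "lim (\<lambda>n. moll (r0 (q n)) f x0) = f x" by (rule limI)
        then show "u x = lim (\<lambda>n. moll (r0 (q n)) f x0)" using subsetD[OF sub x] by (simp add: f_def)
      qed
    qed
  qed
qed

text \<open>Overlapping balls meet in a nonempty open set, which is not null, so their constants
  agree; connectedness makes the constant global. Lindelof's theorem leaves countably many balls,
  hence one exceptional null set.\<close>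

lemma weak_gradient_0_const:
  fixes \<Omega> :: "'a::euclidean_space set"
  assumes \<Omega>: "open \<Omega>" "connected \<Omega>" and wg: "has_weak_gradient \<Omega> u g"
    and g0: "AE x in lebesgue. x \<in> \<Omega> \<longrightarrow> g x = 0"
  obtains c where "AE x in lebesgue. x \<in> \<Omega> \<longrightarrow> u x = c"
proof -
  have "\<exists>R c. 0 < R \<and> ball x R \<subseteq> \<Omega> \<and> (AE y in lebesgue. y \<in> ball x R \<longrightarrow> u y = c)" if "x \<in> \<Omega>" for x
    by (rule weak_gradient_0_locally_const[OF \<Omega>(1) wg g0 that]) blast
  then obtain R c where Rc: "\<And>x. x \<in> \<Omega> \<Longrightarrow> 0 < R x" "\<And>x. x \<in> \<Omega> \<Longrightarrow> ball x (R x) \<subseteq> \<Omega>"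
    "\<And>x. x \<in> \<Omega> \<Longrightarrow> AE y in lebesgue. y \<in> ball x (R x) \<longrightarrow> u y = c x"
    by metis
  have loc: "c x = c y" if x: "x \<in> \<Omega>" and y: "y \<in> ball x (R x)" for x y
  proof -
    have y': "y \<in> \<Omega>" using Rc(2)[OF x] y by blast
    show ?thesis
    proof (rule AE_open_imp)
      show "open (ball x (R x) \<inter> ball y (R y))" by (intro open_Int open_ball)
      show "ball x (R x) \<inter> ball y (R y) \<noteq> {}" using y Rc(1)[OF y'] by (metis IntI centre_in_ball empty_iff)
      show "AE z in lebesgue. z \<in> ball x (R x) \<inter> ball y (R y) \<longrightarrow> c x = c y"
        using Rc(3)[OF x] Rc(3)[OF y'] by eventually_elim auto
    qed
  qed
  have const: "c x = c y" if "x \<in> \<Omega>" "y \<in> \<Omega>" for x y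
  proof (rule connected_local_const[OF \<Omega>(2) that])
    show "\<forall>x\<in>\<Omega>. \<forall>\<^sub>F y in at x within \<Omega>. c x = c y"
    proof
      fix x assume x: "x \<in> \<Omega>"
      show "\<forall>\<^sub>F y in at x within \<Omega>. c x = c y"
        unfolding eventually_at using Rc(1)[OF x] loc[OF x] by (auto simp: dist_commute)
    qed
  qed
  obtain F where F: "F \<subseteq> (\<lambda>x. ball x (R x)) ` \<Omega>" "countable F" "\<Union>F = \<Union>((\<lambda>x. ball x (R x)) ` \<Omega>)"
    using Lindelof[of "(\<lambda>x. ball x (R x)) ` \<Omega>"] by auto
  have cover: "\<Omega> \<subseteq> \<Union>F"
    unfolding F(3) using Rc(1) by force
  show ?thesis
  proof (cases "\<Omega> = {}")
    case False
    then obtain x0 where x0: "x0 \<in> \<Omega>" by blast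
    have "AE x in lebesgue. \<forall>B\<in>F. x \<in> B \<longrightarrow> u x = c x0"
    proof (subst AE_ball_countable[OF F(2)], rule ballI)
      fix B assume "B \<in> F"
      then obtain z where z: "z \<in> \<Omega>" "B = ball z (R z)" using F(1) by auto
      show "AE x in lebesgue. x \<in> B \<longrightarrow> u x = c x0"
        using Rc(3)[OF z(1)] const[OF z(1) x0] by (simp add: z(2))
    qed
    then show ?thesis
      using cover by (intro that[of "c x0"]) (elim eventually_mono, auto)
  qed (use that in auto)
qed

section \<open>Gluing local weak gradients\<close>

lemma integrable_cong_AE_lebesgue:
  fixes f g :: "'a::euclidean_space \<Rightarrow> 'b::euclidean_space"
  assumes "integrable lebesgue f" "AE x in lebesgue. f x = g x"
  shows "integrable lebesgue g" "integral\<^sup>L lebesgue g = integral\<^sup>L lebesgue f"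
proof -
  have m: "f \<in> borel_measurable lebesgue" using assms(1) by simp
  note m = m borel_measurable_AE[OF m assms(2)]
  show "integrable lebesgue g" using integrable_cong_AE[OF m assms(2)] assms(1) by simp
  show "integral\<^sup>L lebesgue g = integral\<^sup>L lebesgue f" using integral_cong_AE[OF m assms(2)] by simp
qed

lemma has_weak_gradient_cong_AE:
  assumes \<Omega>: "open \<Omega>" and wg: "has_weak_gradient \<Omega> u g" and eq: "AE x in lebesgue. x \<in> \<Omega> \<longrightarrow> g x = g' x"
  shows "has_weak_gradient \<Omega> u g'"
proof (rule has_weak_gradientI[OF \<Omega>])
  fix K assume K: "compact K" "K \<subseteq> \<Omega>"
  show "integrable lebesgue (\<lambda>x. indicator K x * u x)" by (rule has_weak_gradientD(1)[OF \<Omega> wg K])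
  show "integrable lebesgue (\<lambda>x. indicator K x *\<^sub>R g' x)"
  proof (rule integrable_cong_AE_lebesgue(1)[OF has_weak_gradientD(2)[OF \<Omega> wg K]])
    show "AE x in lebesgue. indicat_real K x *\<^sub>R g x = indicator K x *\<^sub>R g' x"
      using eq by eventually_elim (use K in \<open>auto simp: indicator_def\<close>)
  qed
next
  fix \<phi> and b :: 'a assume \<phi>: "\<phi> \<in> Ccinf \<Omega>" and b: "b \<in> Basis"
  obtain K M where "support_bound \<Omega> K M \<phi>"
    by (rule Cc1D[OF subsetD[OF Ccinf_subset_Cc1 \<phi>]])
  note KM = support_boundD[OF this]
  have "integrable lebesgue (\<lambda>x. (g x \<bullet> b) * \<phi> x)"
    using integrable_inner_left[OF integrable_mult_test[OF has_weak_gradientD(2)[OF \<Omega> wg KM(1,2)] KM(8,3,5)], of b]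
    by (simp add: mult.commute)
  moreover have "AE x in lebesgue. (g x \<bullet> b) * \<phi> x = (g' x \<bullet> b) * \<phi> x"
    using eq by eventually_elim (use KM in \<open>metis mult_zero_right subsetD\<close>)
  ultimately have "(LINT x|lebesgue. (g' x \<bullet> b) * \<phi> x) = (LINT x|lebesgue. (g x \<bullet> b) * \<phi> x)"
    by (rule integrable_cong_AE_lebesgue(2))
  then show "(LINT x|lebesgue. u x * (grad \<phi> x \<bullet> b)) = - (LINT x|lebesgue. (g' x \<bullet> b) * \<phi> x)"
    using has_weak_gradientD(3)[OF \<Omega> wg \<phi> b] by simp
qed

text \<open>\<open>W1p_loc\<close> supplies a separate weak gradient on each subdomain, chosen
  independently. They agree almost everywhere on overlaps and can be glued; only after that does
  \<open>weak_grad \<Omega> u\<close> denote a weak gradient and not an arbitrary value.\<close>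

lemma W1p_loc_weak_gradient:
  fixes \<Omega> :: "'a::euclidean_space set"
  assumes \<Omega>: "open \<Omega>" and u: "u \<in> W1p_loc p \<Omega> w"
  shows "has_weak_gradient \<Omega> u (weak_grad \<Omega> u)"
proof -
  obtain O' :: "nat \<Rightarrow> 'a set" where O': "\<And>n. open (O' n)" "\<And>n. O' n \<Subset> \<Omega>" "\<And>n. O' n \<subseteq> O' (Suc n)"
    "(\<Union>n. O' n) = \<Omega>" "\<And>K. compact K \<Longrightarrow> K \<subseteq> \<Omega> \<Longrightarrow> \<exists>n. K \<subseteq> O' n"
    by (rule open_exhaustion[OF \<Omega>]) (rule that)
  have mono: "O' m \<subseteq> O' n" if "m \<le> n" for m n
    by (rule lift_Suc_mono_le[of O', OF O'(3) that])
  define G where "G n = weak_grad (O' n) u" for n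
  have G: "has_weak_gradient (O' n) u (G n)" for n
  proof -
    have "u \<in> W1p p (O' n) w" using u O'(1,2)[of n] by (auto simp: W1p_loc_def)
    then have "weakly_differentiable (O' n) u" by (simp add: W1p_def)
    then show ?thesis unfolding weakly_differentiable_def G_def by (metis weak_grad_works)
  qed
  \<comment> \<open>The value is taken from the first subdomain containing x; on each
    \<open>O' n\<close> it differs from \<open>G n\<close> only by a null set.\<close>
  define g where "g x = G (LEAST n. x \<in> O' n) x" for x
  have gG: "AE x in lebesgue. x \<in> O' n \<longrightarrow> G n x = g x" for n
  proof -
    have "AE x in lebesgue. \<forall>k\<le>n. x \<in> O' k \<longrightarrow> G n x = G k x"
    proof -
      have "AE x in lebesgue. \<forall>k\<in>{..n}. x \<in> O' k \<longrightarrow> G n x = G k x"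
        by (intro AE_finite_allI weak_gradient_unique[OF O'(1) has_weak_gradient_subset[OF O'(1) O'(1) mono G] G]) auto
      then show ?thesis by eventually_elim auto
    qed
    then show ?thesis
    proof eventually_elim
      case (elim x)
      show ?case
      proof
        assume x: "x \<in> O' n"
        have "(LEAST n. x \<in> O' n) \<le> n" "x \<in> O' (LEAST n. x \<in> O' n)"
          using x by (auto intro: Least_le LeastI)
        then show "G n x = g x" using elim by (simp add: g_def)
      qed
    qed
  qed
  have wg: "has_weak_gradient (O' n) u g" for n
    by (rule has_weak_gradient_cong_AE[OF O'(1) G gG])
  have "has_weak_gradient \<Omega> u g"
  proof (rule has_weak_gradientI[OF \<Omega>])
    fix K assume K: "compact K" "K \<subseteq> \<Omega>"
    then obtain n where n: "K \<subseteq> O' n" using O'(5) by blast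
    show "integrable lebesgue (\<lambda>x. indicator K x * u x)" "integrable lebesgue (\<lambda>x. indicator K x *\<^sub>R g x)"
      by (rule has_weak_gradientD(1)[OF O'(1) wg K(1) n], rule has_weak_gradientD(2)[OF O'(1) wg K(1) n])
  next
    fix \<phi> and b :: 'a assume \<phi>: "\<phi> \<in> Ccinf \<Omega>" and b: "b \<in> Basis"
    then have c: "compact (closure {x. \<phi> x \<noteq> 0})" "closure {x. \<phi> x \<noteq> 0} \<subseteq> \<Omega>" "smooth_on UNIV \<phi>"
      unfolding Ccinf_def compactly_contained_def mem_Collect_eq by blast+
    obtain n where "closure {x. \<phi> x \<noteq> 0} \<subseteq> O' n" using O'(5)[OF c(1,2)] by blast
    then have "\<phi> \<in> Ccinf (O' n)" using c unfolding Ccinf_def compactly_contained_def mem_Collect_eq by blast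
    then show "(LINT x|lebesgue. u x * (grad \<phi> x \<bullet> b)) = - (LINT x|lebesgue. (g x \<bullet> b) * \<phi> x)"
      by (rule has_weak_gradientD(3)[OF O'(1) wg _ b])
  qed
  then show ?thesis by (rule weak_grad_works)
qed

text \<open>The definition controls the gradient chosen on a subdomain; uniqueness transfers this to
  the gradient chosen on \<Omega>.\<close>

lemma W1p_loc_integrable:
  fixes \<Omega> :: "'a::euclidean_space set"
  assumes \<Omega>: "open \<Omega>" and u: "u \<in> W1p_loc p \<Omega> w" and K: "compact K" "K \<subseteq> \<Omega>"
  shows "integrable lebesgue (\<lambda>x. indicator K x * (norm (weak_grad \<Omega> u x) powr p * w x))"
proof -
  obtain O' :: "nat \<Rightarrow> 'a set" where O': "\<And>n. open (O' n)" "\<And>n. O' n \<Subset> \<Omega>" "\<And>n. O' n \<subseteq> O' (Suc n)"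
    "(\<Union>n. O' n) = \<Omega>" "\<And>K. compact K \<Longrightarrow> K \<subseteq> \<Omega> \<Longrightarrow> \<exists>n. K \<subseteq> O' n"
    by (rule open_exhaustion[OF \<Omega>]) (rule that)
  obtain n where n: "K \<subseteq> O' n" using O'(5)[OF K] by blast
  have W: "u \<in> W1p p (O' n) w" using u O'(1,2)[of n] by (auto simp: W1p_loc_def)
  then have "weakly_differentiable (O' n) u" by (simp add: W1p_def)
  then have G: "has_weak_gradient (O' n) u (weak_grad (O' n) u)"
    unfolding weakly_differentiable_def by (metis weak_grad_works)
  have sub: "O' n \<subseteq> \<Omega>" using O'(4) by blast
  have eq: "AE x in lebesgue. x \<in> O' n \<longrightarrow> weak_grad (O' n) u x = weak_grad \<Omega> u x"
    by (rule weak_gradient_unique[OF O'(1) G has_weak_gradient_subset[OF \<Omega> O'(1) sub W1p_loc_weak_gradient[OF \<Omega> u]]])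
  have "integrable (lebesgue_on (O' n)) (\<lambda>x. norm (weak_grad (O' n) u x) powr p * w x)"
    using W by (simp add: W1p_def)
  then have "integrable lebesgue (\<lambda>x. indicator (O' n) x *\<^sub>R (norm (weak_grad (O' n) u x) powr p * w x))"
    using O'(1) by (subst (asm) integrable_lebesgue_on_iff) auto
  from integrable_indicator_subset[OF this n sets_lebesgue_compact[OF K(1)]]
  show ?thesis
  proof (rule integrable_cong_AE_lebesgue(1))
    show "AE x in lebesgue. indicat_real K x *\<^sub>R (norm (weak_grad (O' n) u x) powr p * w x) =
      indicator K x * (norm (weak_grad \<Omega> u x) powr p * w x)"
      using eq by eventually_elim (use n in \<open>auto simp: indicator_def\<close>)
  qed
qed

section \<open>Mollification in weighted spaces\<close>

text \<open>Comparing b with t a replaces calculus: in each case one summand alone bounds the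
  product. Either summand can be given a small coefficient, the first by small t and the second by
  large t.\<close>

lemma young_powr:
  fixes a b t p :: real
  assumes "1 < p" "0 \<le> a" "0 \<le> b" "0 < t"
  shows "a powr (p - 1) * b \<le> t * a powr p + t powr (1 - p) * b powr p"
proof (cases "b \<le> t * a")
  case True
  have "a powr (p - 1) * b \<le> a powr (p - 1) * (t * a)"
    by (intro mult_left_mono True) simp
  also have "\<dots> = t * a powr p"
    using powr_mult_base[OF assms(2), of "p - 1"] by (simp add: mult_ac)
  finally show ?thesis by (simp add: add_increasing2)
next
  case False
  then have "a \<le> b / t" using assms by (simp add: field_simps)
  then have "a powr (p - 1) * b \<le> (b / t) powr (p - 1) * b"
    using assms by (intro mult_right_mono powr_mono2) auto
  also have "\<dots> = t powr (1 - p) * (b * b powr (p - 1))"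
    using assms powr_minus[of t "p - 1"] by (simp add: powr_divide field_simps)
  also have "b * b powr (p - 1) = b powr p"
    using powr_mult_base[OF assms(3), of "p - 1"] by simp
  finally show ?thesis using assms by (simp add: add_increasing)
qed

lemma young_powr_1:
  fixes a b p :: real
  assumes "1 < p" "0 \<le> a" "0 \<le> b"
  shows "a powr (p - 1) * b \<le> a powr p + b powr p"
  using young_powr[OF assms, of 1] by simp

lemma Ap_weightD:
  assumes "Ap_weight p w"
  shows "w \<in> borel_measurable lebesgue" "AE x in lebesgue. 0 < w x"
    "compact K \<Longrightarrow> integrable lebesgue (\<lambda>x. indicator K x * w x)"
proof -
  have l: "locally_integrable UNIV w" and "AE x in lebesgue. 0 < w x"
    using assms by (auto simp: Ap_weight_def)
  show "AE x in lebesgue. 0 < w x" by fact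
  show "w \<in> borel_measurable lebesgue"
    using l by (simp add: locally_integrable_def lebesgue_on_UNIV_eq)
  show "compact K \<Longrightarrow> integrable lebesgue (\<lambda>x. indicator K x * w x)"
    using l by (simp add: locally_integrable_iff)
qed

lemma measure_ball_scale:
  "0 \<le> r \<Longrightarrow> measure lebesgue (ball (y::'a::euclidean_space) r) = r ^ DIM('a) * measure lebesgue (ball (0::'a) 1)"
  by (simp add: content_ball_conv_unit_ball[of r y])

text \<open>The Muckenhoupt inequality with averages turned into integrals: the two normalisations
  contribute |B| and |B|^(p-1), together |B|^p. \<sigma> is the dual weight.\<close>

lemma Ap_weight_ball:
  fixes w :: "'a::euclidean_space \<Rightarrow> real"
  assumes p: "1 < p" and Ap: "Ap_weight p w"
  defines "\<sigma> \<equiv> \<lambda>x. w x powr (- 1 / (p - 1))"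
  obtains c where "0 < c"
    "\<And>y r. 0 < r \<Longrightarrow> integrable lebesgue (\<lambda>x. indicator (ball y r) x * \<sigma> x)"
    "\<And>y r. 0 < r \<Longrightarrow> integrable lebesgue (\<lambda>x. indicator (ball y r) x * w x)"
    "\<And>y r. 0 < r \<Longrightarrow> (LINT x|lebesgue. indicator (ball y r) x * w x) *
        (LINT x|lebesgue. indicator (ball y r) x * \<sigma> x) powr (p - 1) \<le> c * measure lebesgue (ball y r) powr p"
proof -
  obtain c where c: "0 < c" "\<And>y r. 0 < r \<Longrightarrow> integrable (lebesgue_on (ball y r)) \<sigma>"
     "\<And>y r. 0 < r \<Longrightarrow> avg (ball y r) w * (avg (ball y r) \<sigma>) powr (p - 1) \<le> c"
    using Ap unfolding Ap_weight_def \<sigma>_def by blast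
  show ?thesis
  proof (rule that[OF c(1)])
    fix y :: 'a and r :: real assume r: "0 < r"
    have bs: "ball y r \<in> sets lebesgue" by simp
    show i: "integrable lebesgue (\<lambda>x. indicator (ball y r) x * \<sigma> x)"
      using c(2)[OF r, of y] unfolding integrable_lebesgue_on_iff[OF bs] by simp
    have "integrable lebesgue (\<lambda>x. indicator (cball y r) x *\<^sub>R w x)"
      using Ap_weightD(3)[OF Ap compact_cball, of y r] by simp
    from integrable_indicator_subset[OF this ball_subset_cball bs]
    show "integrable lebesgue (\<lambda>x. indicator (ball y r) x * w x)" by simp
    let ?m = "measure lebesgue (ball y r)"
    have m: "0 < ?m" using r by (simp add: content_ball_pos)
    have 0: "0 \<le> (LINT x|lebesgue. indicator (ball y r) x * \<sigma> x)"
      by (intro integral_nonneg_AE AE_I2) (simp add: \<sigma>_def)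
    have "(LINT x|lebesgue. indicator (ball y r) x * w x) / ?m *
        ((LINT x|lebesgue. indicator (ball y r) x * \<sigma> x) / ?m) powr (p - 1) \<le> c"
      using c(3)[OF r, of y] unfolding avg_def integral_lebesgue_on_eq[OF bs] by simp
    then have "(LINT x|lebesgue. indicator (ball y r) x * w x) *
        (LINT x|lebesgue. indicator (ball y r) x * \<sigma> x) powr (p - 1) \<le> c * (?m * ?m powr (p - 1))"
      using m 0 by (simp add: powr_divide field_simps)
    also have "?m * ?m powr (p - 1) = ?m powr p" using powr_mult_base[of ?m "p - 1"] m by simp
    finally show "(LINT x|lebesgue. indicator (ball y r) x * w x) *
        (LINT x|lebesgue. indicator (ball y r) x * \<sigma> x) powr (p - 1) \<le> c * ?m powr p" .
  qed
qed

text \<open>The factor \<open>2\<^sup>p\<close> is lost because this follows from Young's inequality with an optimal parameter.\<close>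

lemma hoelder_dual_weight:
  fixes s w :: "'a::euclidean_space \<Rightarrow> real"
  assumes p: "1 < p" and B: "B \<in> sets lebesgue" and s: "integrable lebesgue s" "\<And>x. 0 \<le> s x"
    and w: "AE x in lebesgue. 0 < w x"
    and i1: "integrable lebesgue (\<lambda>x. indicator B x * w x powr (- 1 / (p - 1)))"
    and i2: "integrable lebesgue (\<lambda>x. s x powr p * w x)"
  shows "(LINT x|lebesgue. indicator B x * s x) powr p \<le> 2 powr p *
    ((LINT x|lebesgue. indicator B x * (s x powr p * w x)) *
     (LINT x|lebesgue. indicator B x * w x powr (- 1 / (p - 1))) powr (p - 1))"
proof -
  define I where "I = (LINT x|lebesgue. indicator B x * s x)"
  define X where "X = (LINT x|lebesgue. indicator B x * (s x powr p * w x))"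
  define Y where "Y = (LINT x|lebesgue. indicator B x * w x powr (- 1 / (p - 1)))"
  have i3: "integrable lebesgue (\<lambda>x. indicator B x * (s x powr p * w x))"
    using integrable_indicator_subset[of UNIV "\<lambda>x. s x powr p * w x" B] i2 B by simp
  have i4: "integrable lebesgue (\<lambda>x. indicator B x * s x)"
    using integrable_indicator_subset[of UNIV s B] s(1) B by simp
  have I0: "0 \<le> I" unfolding I_def by (intro integral_nonneg_AE AE_I2) (simp add: s)
  have X0: "0 \<le> X" unfolding X_def using w by (intro integral_nonneg_AE) (auto elim!: eventually_mono)
  have Y0: "0 \<le> Y" unfolding Y_def by (intro integral_nonneg_AE AE_I2) simp
  have young: "I \<le> t * Y + t powr (1 - p) * X" if t: "0 < t" for t
  proof -
    have "I \<le> (LINT x|lebesgue. t * (indicator B x * w x powr (- 1 / (p - 1))) + t powr (1 - p) * (indicator B x * (s x powr p * w x)))"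
      unfolding I_def
    proof (rule integral_mono_AE)
      show "AE x in lebesgue. indicator B x * s x \<le> t * (indicator B x * w x powr (- 1 / (p - 1))) + t powr (1 - p) * (indicator B x * (s x powr p * w x))"
        using w
      proof eventually_elim
        case (elim x)
        \<comment> \<open>Factorisation chosen so that \<open>a powr (p - 1) * b\<close> is s,
          \<open>a powr p\<close> is the dual weight and \<open>b powr p\<close> is the weighted
          density of s.\<close>
        define a where "a = w x powr (- 1 / (p * (p - 1)))"
        define b where "b = s x * w x powr (1 / p)"
        have "a powr (p - 1) * b = s x * (w x powr (- 1 / p) * w x powr (1 / p))"
          using p elim by (simp add: a_def b_def powr_powr mult_ac)
        also have "w x powr (- 1 / p) * w x powr (1 / p) = 1"
          using elim by (simp add: powr_add[symmetric])
        finally have 1: "a powr (p - 1) * b = s x" by simp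
        have 2: "a powr p = w x powr (- 1 / (p - 1))"
          using p by (simp add: a_def powr_powr)
        have 3: "b powr p = s x powr p * w x"
          using p elim s(2)[of x] by (simp add: b_def powr_mult powr_powr)
        have "s x \<le> t * (w x powr (- 1 / (p - 1))) + t powr (1 - p) * (s x powr p * w x)"
          using young_powr[OF p, of a b t] s(2)[of x] t unfolding 1 2 3 by (simp add: a_def b_def)
        then show ?case by (simp add: indicator_def)
      qed
    qed (use i1 i3 i4 in auto)
    also have "\<dots> = t * Y + t powr (1 - p) * X"
      using i1 i3 by (simp add: X_def Y_def)
    finally show ?thesis .
  qed
  have "I powr p \<le> 2 powr p * (X * Y powr (p - 1))"
  \<comment> \<open>The balancing t used below would be 0 here. Instead, if I were positive, a t
    adapted to I would make the right-hand side of \<open>young\<close> smaller than I.\<close>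
  proof (cases "X = 0 \<or> Y = 0")
    case True
    have "I \<le> 0"
    proof (rule ccontr)
      assume "\<not> I \<le> 0"
      then have I: "0 < I" by simp
      show False
      proof (cases "X = 0")
        case True
        define t where "t = I / (2 * (Y + 1))"
        have "0 < t" using I Y0 by (simp add: t_def)
        from young[OF this] have "I \<le> t * Y" using True by simp
        also have "t * Y < I" using I Y0 by (simp add: t_def field_simps add_nonneg_pos)
        finally show False by simp
      next
        case False
        then have "Y = 0" "0 < X" using \<open>X = 0 \<or> Y = 0\<close> X0 by auto
        define t where "t = (I / (2 * X)) powr (1 / (1 - p))"
        have "0 < t" using I \<open>0 < X\<close> by (simp add: t_def)
        from young[OF this] have "I \<le> t powr (1 - p) * X" using \<open>Y = 0\<close> by simp
        also have "t powr (1 - p) = I / (2 * X)"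
          using p I \<open>0 < X\<close> by (simp add: t_def powr_powr)
        finally show False using I \<open>0 < X\<close> by (simp add: field_simps)
      qed
    qed
    then show ?thesis using I0 X0 Y0 by simp
  next
    case False
    then have X: "0 < X" and Y: "0 < Y" using X0 Y0 by auto
    \<comment> \<open>The t that balances both terms, each becoming
      \<open>X powr (1 / p) * Y powr ((p - 1) / p)\<close>.\<close>
    define t where "t = X powr (1 / p) * Y powr (- 1 / p)"
    have t: "0 < t" using X Y by (simp add: t_def)
    have e1: "t * Y = X powr (1 / p) * Y powr ((p - 1) / p)"
    proof -
      have "Y powr (- 1 / p) * Y powr 1 = Y powr ((p - 1) / p)"
        using p by (simp only: powr_add[symmetric]) (simp add: field_simps)
      then show ?thesis using Y by (simp add: t_def)
    qed
    have e2: "t powr (1 - p) * X = X powr (1 / p) * Y powr ((p - 1) / p)"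
    proof -
      have "t powr (1 - p) = X powr ((1 - p) / p) * Y powr ((p - 1) / p)"
      proof -
        have e: "1 / p * (1 - p) = (1 - p) / p" "- 1 / p * (1 - p) = (p - 1) / p"
          using p by (simp_all add: field_simps)
        have "t powr (1 - p) = (X powr (1 / p)) powr (1 - p) * (Y powr (- 1 / p)) powr (1 - p)"
          unfolding t_def by (rule powr_mult; simp)
        then show ?thesis by (simp only: powr_powr e)
      qed
      moreover have "X powr ((1 - p) / p) * X powr 1 = X powr (1 / p)"
        using p by (simp only: powr_add[symmetric]) (simp add: field_simps)
      ultimately show ?thesis using X by (simp add: mult_ac)
    qed
    have "I \<le> 2 * (X powr (1 / p) * Y powr ((p - 1) / p))"
      using young[OF t] e1 e2 by simp
    then have "I powr p \<le> (2 * (X powr (1 / p) * Y powr ((p - 1) / p))) powr p"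
      using I0 p by (intro powr_mono2) auto
    also have "\<dots> = 2 powr p * (X * Y powr (p - 1))"
      using X Y p by (simp add: powr_mult powr_powr)
    finally show ?thesis .
  qed
  then show ?thesis by (simp only: I_def X_def Y_def)
qed

lemma norm_moll_le_ball:
  fixes S :: "'a::euclidean_space \<Rightarrow> 'b::euclidean_space"
  assumes "integrable lebesgue S" "0 < r"
  shows "norm (moll r S x) \<le> exp (4 / 3) / measure lebesgue (ball (0::'a) (r / 2)) * (LINT y|lebesgue. indicator (ball x r) y * norm (S y))"
proof -
  let ?k = "exp (4 / 3) / measure lebesgue (ball (0::'a) (r / 2))"
  have i: "integrable lebesgue (\<lambda>y. indicator (ball x r) y * norm (S y))"
    using integrable_indicator_subset[of UNIV "\<lambda>y. norm (S y)" "ball x r"] assms(1) by simp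
  have "norm (moll r S x) \<le> (LINT y|lebesgue. norm (kern r (x - y) *\<^sub>R S y))"
    unfolding moll_def by (rule integral_norm_bound)
  also have "\<dots> \<le> (LINT y|lebesgue. ?k * (indicator (ball x r) y * norm (S y)))"
  proof (rule integral_mono)
    show "norm (kern r (x - y) *\<^sub>R S y) \<le> ?k * (indicator (ball x r) y * norm (S y))" for y
    proof (cases "dist x y < r")
      case True
      then show ?thesis
        using mult_right_mono[OF kern_le[OF assms(2), of "x - y"] norm_ge_zero[of "S y"]] kern_nonneg[OF assms(2), of "x - y"]
        by simp
    qed (use kern_eq_0[OF assms(2), of "x - y"] in \<open>simp add: dist_norm\<close>)
  qed (intro integrable_norm integrable_moll_integrand assms integrable_mult_right i)+
  finally show ?thesis by simp
qed

abbreviation (input) finite_energy :: "real \<Rightarrow> ('a::euclidean_space \<Rightarrow> real) \<Rightarrow> ('a \<Rightarrow> 'b::euclidean_space) \<Rightarrow> bool"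
  where "finite_energy p w S \<equiv> integrable lebesgue (\<lambda>x. norm (S x) powr p * w x)"

abbreviation (input) energy :: "real \<Rightarrow> ('a::euclidean_space \<Rightarrow> real) \<Rightarrow> ('a \<Rightarrow> 'b::euclidean_space) \<Rightarrow> real"
  where "energy p w S \<equiv> LINT x|lebesgue. norm (S x) powr p * w x"

text \<open>Hoelder against the dual weight bounds the p-th power of the mollification at x by the
  integral of |S|^p w over the ball around x times a power of the dual mass s x. Integrating against
  w and exchanging the order leaves, for each y, the integral of s^(p-1) w over the ball around y.
  Both factors are controlled in the ball of radius 2 r around y, where the Muckenhoupt condition
  applies. The volumes cancel, so the bound is uniform in r.\<close>

lemma moll_weighted_bound:
  fixes w :: "'a::euclidean_space \<Rightarrow> real"
  assumes p: "1 < p" and Ap: "Ap_weight p w"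
  obtains C where "0 \<le> C" "\<And>r (S :: 'a \<Rightarrow> 'b::euclidean_space). 0 < r \<Longrightarrow> integrable lebesgue S \<Longrightarrow>
      finite_energy p w S \<Longrightarrow>
      finite_energy p w (moll r S) \<and>
      (energy p w (moll r S)) \<le> C * (energy p w S)"
proof -
  define \<sigma> where "\<sigma> x = w x powr (- 1 / (p - 1))" for x
  obtain c where c: "0 < c"
    "\<And>y r. 0 < r \<Longrightarrow> integrable lebesgue (\<lambda>x. indicator (ball y r) x * \<sigma> x)"
    "\<And>y r. 0 < r \<Longrightarrow> integrable lebesgue (\<lambda>x. indicator (ball y r) x * w x)"
    "\<And>y r. 0 < r \<Longrightarrow> (LINT x|lebesgue. indicator (ball y r) x * w x) *
        (LINT x|lebesgue. indicator (ball y r) x * \<sigma> x) powr (p - 1) \<le> c * measure lebesgue (ball y r) powr p"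
    by (rule Ap_weight_ball[OF p Ap, folded \<sigma>_def]) (rule that)
  note w = Ap_weightD(2)[OF Ap]
  have [measurable]: "w \<in> borel_measurable lebesgue" by (rule Ap_weightD(1)[OF Ap])
  have [measurable]: "\<sigma> \<in> borel_measurable lebesgue" unfolding \<sigma>_def[abs_def] by measurable
  \<comment> \<open>2 from the dual Hoelder inequality, exp(4/3) from the height of the kernel, and
    4^N as the volume ratio of balls of radius 2 r and r / 2.\<close>
  define C where "C = (2 * exp (4 / 3) * 4 ^ DIM('a)) powr p * c"
  show ?thesis
  proof (rule that)
    show C0: "0 \<le> C" using c(1) by (simp add: C_def)
    fix r :: real and S :: "'a \<Rightarrow> 'b"
    assume r: "0 < r" and S: "integrable lebesgue S" and Sp: "finite_energy p w S"
    have [measurable]: "S \<in> borel_measurable lebesgue" using S by simp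
    have [measurable]: "moll r S \<in> borel_measurable lebesgue" by (rule borel_measurable_moll) measurable
    define m where "m = measure lebesgue (ball (0::'a) (r / 2))"
    have m: "0 < m" using r by (simp add: m_def content_ball_pos)
    define k where "k = (exp (4 / 3) / m) powr p * 2 powr p"
    define s where "s x = (LINT y|lebesgue. indicator (ball x r) y * \<sigma> y)" for x
    define P where "P = (\<lambda>y. norm (S y) powr p * w y)"
    have ind: "indicator (ball x r) y = (indicator (ball y r) x :: 'c::zero_neq_one)" for x y :: 'a
      by (auto simp: indicator_def dist_commute)
    have pair_ball: "{z \<in> space (lebesgue \<Otimes>\<^sub>M lebesgue). dist (fst z) (snd z) < r} \<in> sets ((lebesgue :: 'a measure) \<Otimes>\<^sub>M (lebesgue :: 'a measure))"
      by measurable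
    have ind_eq: "indicator (ball (fst z) r) (snd z) = indicator {z \<in> space (lebesgue \<Otimes>\<^sub>M lebesgue). dist (fst z) (snd z) < r} z"
      for z :: "'a \<times> 'a" by (auto simp: indicator_def space_pair_measure)
    have ms [measurable]: "s \<in> borel_measurable lebesgue"
      unfolding s_def[abs_def]
    proof (rule lebesgue.borel_measurable_lebesgue_integral)
      have "(\<lambda>z. indicat_real {z \<in> space (lebesgue \<Otimes>\<^sub>M lebesgue). dist (fst z) (snd z) < r} z * \<sigma> (snd z)) \<in> borel_measurable (lebesgue \<Otimes>\<^sub>M lebesgue)"
        by (intro borel_measurable_times borel_measurable_indicator pair_ball measurable_compose[OF measurable_snd]) measurable
      then show "(\<lambda>(x, y). indicat_real (ball x r) y * \<sigma> y) \<in> borel_measurable (lebesgue \<Otimes>\<^sub>M lebesgue)"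
        by (simp add: case_prod_unfold ind_eq)
    qed
    have s0: "0 \<le> s x" for x unfolding s_def by (intro integral_nonneg_AE AE_I2) (simp add: \<sigma>_def)
    have P0: "AE x in lebesgue. 0 \<le> P x" using w by eventually_elim (simp add: P_def)
    have mP [measurable]: "P \<in> borel_measurable lebesgue" using Sp by (simp add: P_def)
    have iP: "integrable lebesgue (\<lambda>y. indicator (ball x r) y * P y)" for x
      using integrable_indicator_subset[of UNIV P "ball x r"] Sp by (simp add: P_def)
    have pointwise: "norm (moll r S x) powr p \<le> k * ((LINT y|lebesgue. indicator (ball x r) y * P y) * s x powr (p - 1))" for x
    proof -
      let ?I = "LINT y|lebesgue. indicator (ball x r) y * norm (S y)"
      have I0: "0 \<le> ?I" by (intro integral_nonneg_AE AE_I2) simp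
      have "norm (moll r S x) powr p \<le> (exp (4 / 3) / m * ?I) powr p"
        using norm_moll_le_ball[OF S r, of x] p by (intro powr_mono2) (auto simp: m_def)
      also have "\<dots> = (exp (4 / 3) / m) powr p * ?I powr p"
        by (rule powr_mult; use m I0 in simp)
      also have "?I powr p \<le> 2 powr p * ((LINT y|lebesgue. indicator (ball x r) y * P y) * s x powr (p - 1))"
        unfolding P_def s_def \<sigma>_def
        by (rule hoelder_dual_weight[OF p _ _ _ w])
          (use S Sp c(2)[OF r, of x] in \<open>auto simp: \<sigma>_def\<close>)
      finally show ?thesis using m by (simp add: k_def mult_ac mult_left_mono)
    qed
    have step1: "(\<integral>\<^sup>+x. ennreal (norm (moll r S x) powr p * w x) \<partial>lebesgue)
      \<le> (\<integral>\<^sup>+x. ennreal k * (\<integral>\<^sup>+y. indicator (ball x r) y * ennreal (P y) * (ennreal (s x powr (p - 1)) * ennreal (w x)) \<partial>lebesgue) \<partial>lebesgue)"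
    proof (rule nn_integral_mono_AE)
      show "AE x in lebesgue. ennreal (norm (moll r S x) powr p * w x) \<le>
        ennreal k * (\<integral>\<^sup>+y. indicator (ball x r) y * ennreal (P y) * (ennreal (s x powr (p - 1)) * ennreal (w x)) \<partial>lebesgue)"
        using w
    proof eventually_elim
      case (elim x)
      have "ennreal (norm (moll r S x) powr p * w x) \<le> ennreal (k * ((LINT y|lebesgue. indicator (ball x r) y * P y) * s x powr (p - 1)) * w x)"
        using pointwise[of x] elim by (intro ennreal_leI mult_right_mono) auto
      also have "\<dots> = ennreal k * (ennreal (LINT y|lebesgue. indicator (ball x r) y * P y) * (ennreal (s x powr (p - 1)) * ennreal (w x)))"
        using elim m by (simp add: k_def ennreal_mult'' ennreal_mult' mult_ac)
      also have "ennreal (LINT y|lebesgue. indicator (ball x r) y * P y) = (\<integral>\<^sup>+y. ennreal (indicator (ball x r) y * P y) \<partial>lebesgue)"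
        by (rule nn_integral_eq_integral[symmetric, OF iP]) (use P0 in \<open>auto elim!: eventually_mono\<close>)
      also have "\<dots> = (\<integral>\<^sup>+y. indicator (ball x r) y * ennreal (P y) \<partial>lebesgue)"
        by (intro nn_integral_cong) (auto simp: indicator_def)
      also have "\<dots> * (ennreal (s x powr (p - 1)) * ennreal (w x)) =
        (\<integral>\<^sup>+y. indicator (ball x r) y * ennreal (P y) * (ennreal (s x powr (p - 1)) * ennreal (w x)) \<partial>lebesgue)"
        by (rule nn_integral_multc[symmetric])
          (intro borel_measurable_times_ennreal borel_measurable_indicator measurable_compose[OF mP measurable_ennreal], simp)
      finally show ?case .
    qed
    qed
    have step2: "(\<integral>\<^sup>+x. ennreal k * (\<integral>\<^sup>+y. indicator (ball x r) y * ennreal (P y) * (ennreal (s x powr (p - 1)) * ennreal (w x)) \<partial>lebesgue) \<partial>lebesgue)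
        = ennreal k * (\<integral>\<^sup>+x. (\<integral>\<^sup>+y. indicator (ball x r) y * ennreal (P y) * (ennreal (s x powr (p - 1)) * ennreal (w x)) \<partial>lebesgue) \<partial>lebesgue)"
      and step3: "(\<integral>\<^sup>+x. (\<integral>\<^sup>+y. indicator (ball x r) y * ennreal (P y) * (ennreal (s x powr (p - 1)) * ennreal (w x)) \<partial>lebesgue) \<partial>lebesgue)
        = (\<integral>\<^sup>+y. (\<integral>\<^sup>+x. indicator (ball x r) y * ennreal (P y) * (ennreal (s x powr (p - 1)) * ennreal (w x)) \<partial>lebesgue) \<partial>lebesgue)"
    proof -
      have "(\<lambda>z. indicator {z \<in> space (lebesgue \<Otimes>\<^sub>M lebesgue). dist (fst z) (snd z) < r} z * ennreal (P (snd z)) * (ennreal (s (fst z) powr (p - 1)) * ennreal (w (fst z)))) \<in> borel_measurable ((lebesgue :: 'a measure) \<Otimes>\<^sub>M (lebesgue :: 'a measure))"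
        by (intro borel_measurable_times_ennreal borel_measurable_indicator pair_ball measurable_compose[OF measurable_snd] measurable_compose[OF measurable_fst, where g="\<lambda>x. ennreal (s x powr (p - 1))"]
          measurable_compose[OF measurable_fst, where g="\<lambda>x. ennreal (w x)"]) measurable
      then have meas: "(\<lambda>(x, y). indicator (ball x r) y * ennreal (P y) * (ennreal (s x powr (p - 1)) * ennreal (w x))) \<in> borel_measurable ((lebesgue :: 'a measure) \<Otimes>\<^sub>M (lebesgue :: 'a measure))"
        by (simp add: case_prod_unfold ind_eq)
      show "(\<integral>\<^sup>+x. ennreal k * (\<integral>\<^sup>+y. indicator (ball x r) y * ennreal (P y) * (ennreal (s x powr (p - 1)) * ennreal (w x)) \<partial>lebesgue) \<partial>lebesgue)
        = ennreal k * (\<integral>\<^sup>+x. (\<integral>\<^sup>+y. indicator (ball x r) y * ennreal (P y) * (ennreal (s x powr (p - 1)) * ennreal (w x)) \<partial>lebesgue) \<partial>lebesgue)"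
        by (rule nn_integral_cmult[OF lebesgue.borel_measurable_nn_integral[OF meas]])
      show "(\<integral>\<^sup>+x. (\<integral>\<^sup>+y. indicator (ball x r) y * ennreal (P y) * (ennreal (s x powr (p - 1)) * ennreal (w x)) \<partial>lebesgue) \<partial>lebesgue)
        = (\<integral>\<^sup>+y. (\<integral>\<^sup>+x. indicator (ball x r) y * ennreal (P y) * (ennreal (s x powr (p - 1)) * ennreal (w x)) \<partial>lebesgue) \<partial>lebesgue)"
        by (rule lebesgue_pair.Fubini'[symmetric, OF meas])
    qed
    have inner: "(\<integral>\<^sup>+x. indicator (ball x r) y * ennreal (P y) * (ennreal (s x powr (p - 1)) * ennreal (w x)) \<partial>lebesgue)
      \<le> ennreal (P y) * ennreal (c * (4 ^ DIM('a) * m) powr p)" for y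
    proof -
      define W where "W = (LINT x|lebesgue. indicator (ball y (2 * r)) x * w x)"
      define s2 where "s2 = (LINT x|lebesgue. indicator (ball y (2 * r)) x * \<sigma> x)"
      \<comment> \<open>The ball around x is contained in the doubled ball around y, which makes the
        bound on the dual mass independent of x.\<close>
      have s2: "s x \<le> s2" if "x \<in> ball y r" for x
        unfolding s_def s2_def
      proof (rule integral_mono[OF c(2)[OF r] c(2)])
        have "ball x r \<subseteq> ball y (2 * r)"
        proof
          fix z assume "z \<in> ball x r"
          then show "z \<in> ball y (2 * r)" using that dist_triangle[of y z x] by simp
        qed
        then show "indicator (ball x r) z * \<sigma> z \<le> indicator (ball y (2 * r)) z * \<sigma> z" for z
          by (auto simp: indicator_def \<sigma>_def)
      qed (use r in simp)
      have "(\<integral>\<^sup>+x. indicator (ball x r) y * ennreal (P y) * (ennreal (s x powr (p - 1)) * ennreal (w x)) \<partial>lebesgue)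
        \<le> (\<integral>\<^sup>+x. (ennreal (P y) * ennreal (s2 powr (p - 1))) * ennreal (indicator (ball y (2 * r)) x * w x) \<partial>lebesgue)"
      proof (rule nn_integral_mono)
        fix x
        show "indicator (ball x r) y * ennreal (P y) * (ennreal (s x powr (p - 1)) * ennreal (w x))
          \<le> (ennreal (P y) * ennreal (s2 powr (p - 1))) * ennreal (indicator (ball y (2 * r)) x * w x)"
        proof (cases "x \<in> ball y r")
          case True
          have "ennreal (s x powr (p - 1)) \<le> ennreal (s2 powr (p - 1))"
            using s2[OF True] s0[of x] p by (intro ennreal_leI powr_mono2) auto
          then have "ennreal (P y) * (ennreal (s x powr (p - 1)) * ennreal (w x)) \<le> ennreal (P y) * (ennreal (s2 powr (p - 1)) * ennreal (w x))"
            by (intro mult_left_mono mult_right_mono) auto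
          moreover have "x \<in> ball y (2 * r)" "y \<in> ball x r" using True r by (auto simp: dist_commute)
          ultimately show ?thesis by (simp add: mult.assoc)
        next
          case False
          then have "y \<notin> ball x r" by (simp add: dist_commute)
          then show ?thesis by simp
        qed
      qed
      also have "\<dots> = (ennreal (P y) * ennreal (s2 powr (p - 1))) * (\<integral>\<^sup>+x. ennreal (indicator (ball y (2 * r)) x * w x) \<partial>lebesgue)"
        using c(3)[of "2 * r" y] r
        by (intro nn_integral_cmult measurable_compose[OF _ measurable_ennreal]) (simp add: borel_measurable_integrable)
      also have "(\<integral>\<^sup>+x. ennreal (indicator (ball y (2 * r)) x * w x) \<partial>lebesgue) = ennreal W"
        unfolding W_def by (rule nn_integral_eq_integral[OF c(3)]) (use r w in \<open>auto elim!: eventually_mono\<close>)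
      also have "(ennreal (P y) * ennreal (s2 powr (p - 1))) * ennreal W = ennreal (P y) * ennreal (W * s2 powr (p - 1))"
      proof -
        have "ennreal (W * s2 powr (p - 1)) = ennreal W * ennreal (s2 powr (p - 1))"
          by (rule ennreal_mult'') simp
        then show ?thesis by (simp only: mult_ac)
      qed
      also have "\<dots> \<le> ennreal (P y) * ennreal (c * (4 ^ DIM('a) * m) powr p)"
      proof (intro mult_left_mono ennreal_leI)
        have "W * s2 powr (p - 1) \<le> c * measure lebesgue (ball y (2 * r)) powr p"
          unfolding W_def s2_def using r by (intro c(4)) simp
        also have "measure lebesgue (ball y (2 * r)) = 4 ^ DIM('a) * m"
        proof -
          have "(2 * r) ^ DIM('a) = 4 ^ DIM('a) * (r / 2) ^ DIM('a)"
            by (simp only: power_mult_distrib[symmetric]) simp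
          then show ?thesis using r unfolding m_def by (subst (1 2) measure_ball_scale) auto
        qed
        finally show "W * s2 powr (p - 1) \<le> c * (4 ^ DIM('a) * m) powr p" .
      qed simp
      finally show ?thesis .
    qed
    have fin: "(\<integral>\<^sup>+x. ennreal (norm (moll r S x) powr p * w x) \<partial>lebesgue) \<le> ennreal (C * (LINT x|lebesgue. P x))"
    proof -
      have "(\<integral>\<^sup>+x. ennreal (norm (moll r S x) powr p * w x) \<partial>lebesgue) \<le> ennreal k * (\<integral>\<^sup>+y. ennreal (P y) * ennreal (c * (4 ^ DIM('a) * m) powr p) \<partial>lebesgue)"
        by (rule order_trans[OF step1], unfold step2 step3, rule mult_left_mono, rule nn_integral_mono, rule inner, simp)
      also have "(\<integral>\<^sup>+y. ennreal (P y) * ennreal (c * (4 ^ DIM('a) * m) powr p) \<partial>lebesgue)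
          = (\<integral>\<^sup>+y. ennreal (P y) \<partial>lebesgue) * ennreal (c * (4 ^ DIM('a) * m) powr p)"
        by (rule nn_integral_multc[OF measurable_compose[OF mP measurable_ennreal]])
      also have "(\<integral>\<^sup>+y. ennreal (P y) \<partial>lebesgue) = ennreal (LINT x|lebesgue. P x)"
        by (rule nn_integral_eq_integral) (use Sp P0 in \<open>auto simp: P_def\<close>)
      also have "ennreal k * (ennreal (LINT x|lebesgue. P x) * ennreal (c * (4 ^ DIM('a) * m) powr p)) = ennreal (C * (LINT x|lebesgue. P x))"
      proof -
        have "0 \<le> (LINT x|lebesgue. P x)" using P0 by (rule integral_nonneg_AE)
        moreover have "k * (c * (4 ^ DIM('a) * m) powr p) = C"
          using m by (simp add: k_def C_def powr_mult[symmetric] mult_ac)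
        moreover have k0: "0 \<le> k" by (simp add: k_def)
        moreover have c0: "0 \<le> c * (4 ^ DIM('a) * m) powr p" using c(1) by simp
        ultimately have "ennreal k * (ennreal (LINT x|lebesgue. P x) * ennreal (c * (4 ^ DIM('a) * m) powr p))
          = ennreal (k * ((LINT x|lebesgue. P x) * (c * (4 ^ DIM('a) * m) powr p)))"
          by (simp only: ennreal_mult mult_nonneg_nonneg)
        also have "k * ((LINT x|lebesgue. P x) * (c * (4 ^ DIM('a) * m) powr p)) = (k * (c * (4 ^ DIM('a) * m) powr p)) * (LINT x|lebesgue. P x)"
          by (simp only: mult_ac)
        finally show ?thesis by (simp only: \<open>k * (c * (4 ^ DIM('a) * m) powr p) = C\<close>)
      qed
      finally show ?thesis .
    qed
    have Pint0: "0 \<le> (LINT x|lebesgue. P x)" using P0 by (rule integral_nonneg_AE)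
    have nn: "AE x in lebesgue. 0 \<le> norm (moll r S x) powr p * w x"
      using w by eventually_elim simp
    have int: "finite_energy p w (moll r S)"
    proof (rule integrableI_nonneg[OF _ nn])
      show "(\<integral>\<^sup>+x. ennreal (norm (moll r S x) powr p * w x) \<partial>lebesgue) < \<infinity>"
        using fin by (rule le_less_trans) simp
    qed measurable
    have "(energy p w (moll r S)) \<le> C * (LINT x|lebesgue. P x)"
      using fin unfolding nn_integral_eq_integral[OF int nn] using C0 Pint0 by (simp add: ennreal_le_iff)
    with int show "finite_energy p w (moll r S) \<and>
      (energy p w (moll r S)) \<le> C * (energy p w S)"
      unfolding P_def by blast
  qed
qed

section \<open>The weighted p-Laplacian\<close>

text \<open>The flux has the size of a^(p-1) w and S has finite energy; Young's inequality stands in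
  for the duality pairing.\<close>

lemma weighted_pairing_integrable:
  fixes F S :: "'a::euclidean_space \<Rightarrow> 'b::euclidean_space" and a w :: "'a \<Rightarrow> real"
  assumes p: "1 < p" and F: "F \<in> borel_measurable lebesgue" and a: "\<And>x. 0 \<le> a x"
    and ia: "integrable lebesgue (\<lambda>x. a x powr p * w x)" and w: "AE x in lebesgue. 0 < w x"
    and Fa: "AE x in lebesgue. norm (F x) \<le> a x powr (p - 1) * w x"
    and S: "S \<in> borel_measurable lebesgue" "finite_energy p w S"
  shows "integrable lebesgue (\<lambda>x. F x \<bullet> S x)"
proof (rule Bochner_Integration.integrable_bound[OF Bochner_Integration.integrable_add[OF ia S(2)]])
  show "(\<lambda>x. F x \<bullet> S x) \<in> borel_measurable lebesgue" using F S(1) by simp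
  show "AE x in lebesgue. norm (F x \<bullet> S x) \<le> norm (a x powr p * w x + norm (S x) powr p * w x)"
    using w Fa
  proof eventually_elim
    case (elim x)
    have "norm (F x \<bullet> S x) \<le> norm (F x) * norm (S x)" by (simp add: Cauchy_Schwarz_ineq2)
    also have "\<dots> \<le> a x powr (p - 1) * w x * norm (S x)" using elim by (intro mult_right_mono) auto
    also have "\<dots> = a x powr (p - 1) * norm (S x) * w x" by simp
    also have "\<dots> \<le> (a x powr p + norm (S x) powr p) * w x"
      using elim a by (intro mult_right_mono young_powr_1[OF p]) auto
    finally show ?case using elim by (simp add: distrib_right)
  qed
qed

text \<open>Weak convergence from L1 convergence and bounded energies. Where |F| \<le> k the L1
  distance suffices. Where |F| > k Young's inequality leaves the energy of a on sets that shrink to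
  the empty set, plus a small multiple of the energies of S and \<open>Sn\<close>. The order of
  choice is t, then k, then n.\<close>

lemma weighted_pairing_tendsto:
  fixes F :: "'a::euclidean_space \<Rightarrow> 'b::euclidean_space" and a w :: "'a \<Rightarrow> real"
  assumes p: "1 < p" and F: "F \<in> borel_measurable lebesgue" and a: "\<And>x. 0 \<le> a x"
    and ia: "integrable lebesgue (\<lambda>x. a x powr p * w x)" and w: "AE x in lebesgue. 0 < w x"
    and Fa: "AE x in lebesgue. norm (F x) \<le> a x powr (p - 1) * w x"
    and S: "integrable lebesgue S" "finite_energy p w S"
    and Sn: "\<And>n::nat. integrable lebesgue (Sn n)" "\<And>n. finite_energy p w (Sn n)"
      "\<And>n. (energy p w (Sn n)) \<le> B"
    and lim: "(\<lambda>n. LINT x|lebesgue. norm (Sn n x - S x)) \<longlonglongrightarrow> 0"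
  shows "(\<lambda>n. LINT x|lebesgue. F x \<bullet> Sn n x) \<longlonglongrightarrow> (LINT x|lebesgue. F x \<bullet> S x)"
proof (rule LIMSEQ_I)
  fix e :: real assume e: "0 < e"
  note [measurable] = F
  have iS: "integrable lebesgue (\<lambda>x. F x \<bullet> S x)"
    by (rule weighted_pairing_integrable[OF p F a ia w Fa _ S(2)]) (use S in simp)
  have iSn: "integrable lebesgue (\<lambda>x. F x \<bullet> Sn n x)" for n
    by (rule weighted_pairing_integrable[OF p F a ia w Fa _ Sn(2)]) (use Sn in simp)
  define B' where "B' = B + (energy p w S)"
  have pos: "0 \<le> (energy p w T)" for T :: "'a \<Rightarrow> 'b"
    using w by (intro integral_nonneg_AE) (auto elim!: eventually_mono)
  have B': "0 \<le> B'" using pos[of S] pos[of "Sn 0"] Sn(3)[of 0] by (simp add: B'_def)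
  \<comment> \<open>Solves t^(1-p) (B' + 1) = e / 3; the exponent is negative, so t is large for
    small e.\<close>
  define t where "t = (e / (3 * (B' + 1))) powr (1 / (1 - p))"
  have t: "0 < t" using e B' by (simp add: t_def)
  have "t powr (1 - p) = e / (3 * (B' + 1))"
    using p e B' by (simp add: t_def powr_powr)
  then have "t powr (1 - p) * (B' + 1) = e / 3" using B' by (simp add: field_simps)
  then have "t powr (1 - p) * B' = e / 3 - t powr (1 - p)" by (simp add: algebra_simps)
  moreover have "0 < t powr (1 - p)" using t by simp
  ultimately have tB: "t powr (1 - p) * B' < e / 3" by linarith
  let ?P = "\<lambda>x. a x powr p * w x"
  let ?A = "\<lambda>k x. indicator {x. real k < norm (F x)} x * ?P x"
  have mA: "{x. real k < norm (F x)} \<in> sets lebesgue" for k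
    using borel_measurable_iff_greater[THEN iffD1, OF measurable_compose[OF F borel_measurable_norm], rule_format, of "real k"] by simp
  have iA: "integrable lebesgue (?A k)" for k
    using integrable_indicator_subset[of UNIV ?P, OF _ subset_UNIV mA] ia by simp
  have "(\<lambda>k. integral\<^sup>L lebesgue (?A k)) \<longlonglongrightarrow> (LINT x::'a|lebesgue. 0)"
  proof (rule integral_dominated_convergence[where f="\<lambda>_. 0 :: real" and w="\<lambda>x. norm (?P x)"])
    show "AE x in lebesgue. (\<lambda>k. ?A k x) \<longlonglongrightarrow> 0"
    proof (intro AE_I2 tendsto_eventually)
      fix x
      obtain N :: nat where "norm (F x) \<le> real N" using real_arch_simple by blast
      then show "\<forall>\<^sub>F k in sequentially. ?A k x = 0"
        by (intro eventually_sequentiallyI[of N]) auto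
    qed
    show "AE x in lebesgue. norm (?A k x) \<le> norm (?P x)" for k
      by (intro AE_I2) (auto simp: indicator_def)
  qed (use iA ia in auto)
  then have "\<forall>\<^sub>F k in sequentially. integral\<^sup>L lebesgue (?A k) < e / (6 * t)"
    using e t by (intro order_tendstoD(2)) auto
  then obtain k where k: "integral\<^sup>L lebesgue (?A k) < e / (6 * t)"
    by (auto simp: eventually_sequentially)
  then have tA: "2 * t * integral\<^sup>L lebesgue (?A k) < e / 3"
    using t by (simp add: field_simps)
  have "(\<lambda>n. real k * (LINT x|lebesgue. norm (Sn n x - S x))) \<longlonglongrightarrow> 0"
    using tendsto_mult_right_zero[OF lim] by simp
  then obtain N where N: "\<And>n. N \<le> n \<Longrightarrow> real k * (LINT x|lebesgue. norm (Sn n x - S x)) < e / 3"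
    using order_tendstoD(2)[of _ 0 sequentially "e / 3"] e by (auto simp: eventually_sequentially)
  show "\<exists>no. \<forall>n\<ge>no. norm ((LINT x|lebesgue. F x \<bullet> Sn n x) - (LINT x|lebesgue. F x \<bullet> S x)) < e"
  proof (intro exI allI impI)
    fix n assume n: "N \<le> n"
    let ?D = "\<lambda>x. 2 * t * ?A k x + t powr (1 - p) * (norm (Sn n x) powr p * w x + norm (S x) powr p * w x) + real k * norm (Sn n x - S x)"
    have iD: "integrable lebesgue ?D"
      using iA Sn S by (intro Bochner_Integration.integrable_add integrable_mult_right integrable_norm Bochner_Integration.integrable_diff)
    have "norm ((LINT x|lebesgue. F x \<bullet> Sn n x) - (LINT x|lebesgue. F x \<bullet> S x)) = norm (LINT x|lebesgue. F x \<bullet> Sn n x - F x \<bullet> S x)"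
      using iS iSn by simp
    also have "\<dots> \<le> (LINT x|lebesgue. norm (F x \<bullet> Sn n x - F x \<bullet> S x))" by (rule integral_norm_bound)
    also have "\<dots> \<le> integral\<^sup>L lebesgue ?D"
    proof (rule integral_mono_AE)
      show "integrable lebesgue (\<lambda>x. norm (F x \<bullet> Sn n x - F x \<bullet> S x))" using iS iSn by simp
      show "AE x in lebesgue. norm (F x \<bullet> Sn n x - F x \<bullet> S x) \<le> ?D x"
        using w Fa
      proof eventually_elim
        case (elim x)
        have base: "norm (F x \<bullet> Sn n x - F x \<bullet> S x) \<le> norm (F x) * norm (Sn n x - S x)"
          using Cauchy_Schwarz_ineq2[of "F x" "Sn n x - S x"] by (simp add: inner_diff_right)
        have nn: "0 \<le> norm (Sn n x) powr p * w x" "0 \<le> norm (S x) powr p * w x" "0 \<le> ?P x" using elim by auto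
        show ?case
        proof (cases "real k < norm (F x)")
          case True
          have F1: "norm (F x) * norm z \<le> t * ?P x + t powr (1 - p) * (norm z powr p * w x)" for z :: 'b
          proof -
            have "norm (F x) * norm z \<le> a x powr (p - 1) * w x * norm z" using elim by (intro mult_right_mono) auto
            also have "\<dots> = a x powr (p - 1) * norm z * w x" by simp
            also have "\<dots> \<le> (t * a x powr p + t powr (1 - p) * norm z powr p) * w x"
              using elim a t by (intro mult_right_mono young_powr[OF p]) auto
            finally show ?thesis by (simp add: algebra_simps)
          qed
          have "norm (F x) * norm (Sn n x - S x) \<le> norm (F x) * (norm (Sn n x) + norm (S x))"
            by (intro mult_left_mono norm_triangle_ineq4) simp
          also have "\<dots> \<le> (t * ?P x + t powr (1 - p) * (norm (Sn n x) powr p * w x)) + (t * ?P x + t powr (1 - p) * (norm (S x) powr p * w x))"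
            unfolding distrib_left by (intro add_mono F1)
          also have "\<dots> = 2 * t * ?P x + t powr (1 - p) * (norm (Sn n x) powr p * w x + norm (S x) powr p * w x)"
            by (simp add: algebra_simps)
          also have "\<dots> \<le> ?D x" using True by simp
          finally show ?thesis using base by linarith
        next
          case False
          then have "norm (F x) * norm (Sn n x - S x) \<le> real k * norm (Sn n x - S x)"
            by (intro mult_right_mono) auto
          also have "\<dots> \<le> ?D x" using False nn t by simp
          finally show ?thesis using base by linarith
        qed
      qed
    qed (rule iD)
    also have "\<dots> = 2 * t * integral\<^sup>L lebesgue (?A k) + t powr (1 - p) * ((energy p w (Sn n)) + (energy p w S))
        + real k * (LINT x|lebesgue. norm (Sn n x - S x))"
      using iA[of k] Sn(1,2)[of n] S by simp
    also have "\<dots> < e / 3 + e / 3 + e / 3"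
    proof -
      have "t powr (1 - p) * ((energy p w (Sn n)) + (energy p w S)) \<le> t powr (1 - p) * B'"
        using Sn(3)[of n] by (intro mult_left_mono) (auto simp: B'_def)
      then show ?thesis using tA tB N[OF n] by linarith
    qed
    finally show "norm ((LINT x|lebesgue. F x \<bullet> Sn n x) - (LINT x|lebesgue. F x \<bullet> S x)) < e" by simp
  qed
qed

text \<open>A mollified indicator of a neighbourhood K' of K. The radius is at most the margin d of
  K inside K', which gives the value 1 on K, and at most the margin e of K' inside L, which keeps
  the support in L.\<close>

lemma exists_cutoff:
  fixes K :: "'a::euclidean_space set"
  assumes "open \<Omega>" "compact K" "K \<subseteq> \<Omega>"
  obtains \<psi> where "\<psi> \<in> Cc1 \<Omega>" "\<And>x. x \<in> K \<Longrightarrow> \<psi> x = 1" "\<And>x. 0 \<le> \<psi> x"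
proof -
  obtain K' d where K': "compact K'" "K' \<subseteq> \<Omega>" "0 < d" "K \<subseteq> K'" "\<And>x. x \<in> K \<Longrightarrow> cball x d \<subseteq> K'"
    by (rule compact_in_open_cball[OF assms(2,1,3)]) (rule that)
  obtain L e where L: "compact L" "L \<subseteq> \<Omega>" "0 < e" "K' \<subseteq> L" "\<And>x. x \<in> K' \<Longrightarrow> cball x e \<subseteq> L"
    by (rule compact_in_open_cball[OF K'(1) assms(1) K'(2)]) (rule that)
  define r where "r = min d e"
  have r: "0 < r" "r \<le> d" "r \<le> e" using K' L by (auto simp: r_def)
  let ?f = "\<lambda>x. indicat_real K' x"
  have f: "integrable lebesgue ?f"
    using integrable_indicator_compact[OF K'(1), of 1] by simp
  have supp: "{x. moll r ?f x \<noteq> 0} \<subseteq> L"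
  proof
    fix x assume "x \<in> {x. moll r ?f x \<noteq> 0}"
    then have "\<not> (\<forall>y. dist x y < r \<longrightarrow> ?f y = 0)" using moll_eq_0[of x r ?f] r by auto
    then obtain y where "dist x y < r" "y \<in> K'" by (auto simp: indicator_def split: if_splits)
    then show "x \<in> L" using L(5)[of y] r by (auto simp: dist_commute)
  qed
  show ?thesis
  proof
    have "closure {x. moll r ?f x \<noteq> 0} \<subseteq> L"
      by (rule closure_minimal[OF supp compact_imp_closed[OF L(1)]])
    then have "{x. moll r ?f x \<noteq> 0} \<Subset> \<Omega>"
      unfolding compactly_contained_def using L(1,2)
      by (meson bounded_subset closed_closure compact_eq_bounded_closed order_trans)
    then show "moll r ?f \<in> Cc1 \<Omega>"
      unfolding Cc1_def mem_Collect_eq using Ck_on_1_moll[OF f r(1)] by (rule conjI[rotated])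
    show "moll r ?f x = 1" if "x \<in> K" for x
    proof -
      have "norm (moll r ?f x - 1) \<le> 0"
      proof (rule norm_moll_diff_le[OF f r(1)])
        fix y assume "dist x y < r"
        then have "y \<in> K'" using K'(5)[OF that] r by auto
        then show "norm (?f y - 1) \<le> 0" by simp
      qed
      then show ?thesis by simp
    qed
    show "0 \<le> moll r ?f x" for x
      unfolding moll_def by (intro integral_nonneg_AE AE_I2) (simp add: kern_nonneg r)
  qed
qed

locale weighted_problem =
  fixes \<Omega> :: "'a::euclidean_space set" and p \<delta> :: real and w f :: "'a \<Rightarrow> real" and A :: "'a \<Rightarrow> 'a \<Rightarrow> 'a"
  assumes open_\<Omega>: "open \<Omega>" and connected_\<Omega>: "connected \<Omega>" and p: "1 < p"
    and Ap: "Ap_weight p w" and sc: "structural_conditions p \<Omega> w A"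
    and \<delta>: "0 < \<delta>"
    and f0: "AE x in lebesgue_on \<Omega>. 0 \<le> f x"
begin

lemma sets_\<Omega>: "\<Omega> \<in> sets lebesgue"
  using open_\<Omega> by simp

lemma w_pos: "AE x in lebesgue. 0 < w x"
  by (rule Ap_weightD(2)[OF Ap])

lemma w_measurable [measurable]: "w \<in> borel_measurable lebesgue"
  by (rule Ap_weightD(1)[OF Ap])

text \<open>The flux of the weighted p-Laplacian. With this closed formula measurability of
  \<open>F x (g x)\<close> is immediate, and \<zeta> = 0 needs no convention since the vector factor
  vanishes.\<close>

definition F :: "'a \<Rightarrow> 'a \<Rightarrow> 'a" where
  "F x \<zeta> = (norm \<zeta> powr (p - 2) * w x) *\<^sub>R \<zeta>"

text \<open>Growth and degeneracy hold with the same constant, so they force equality in the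
  Cauchy--Schwarz inequality.\<close>

lemma A_eq_F: "AE x in lebesgue. x \<in> \<Omega> \<longrightarrow> (\<forall>\<zeta>. A x \<zeta> = F x \<zeta>)"
proof -
  have "AE x in lebesgue. x \<in> \<Omega> \<longrightarrow> (\<forall>\<zeta>. norm (A x \<zeta>) \<le> norm \<zeta> powr (p - 1) * w x)"
    "AE x in lebesgue. x \<in> \<Omega> \<longrightarrow> (\<forall>\<zeta>. A x \<zeta> \<bullet> \<zeta> \<ge> norm \<zeta> powr p * w x)"
    using sc unfolding structural_conditions_def AE_lebesgue_on_iff[OF sets_\<Omega>] by blast+
  then show ?thesis using w_pos
  proof eventually_elim
    case (elim x)
    show ?case
    proof (intro impI allI)
      fix \<zeta> assume x: "x \<in> \<Omega>"
      have g: "norm (A x \<zeta>) \<le> norm \<zeta> powr (p - 1) * w x" and d: "A x \<zeta> \<bullet> \<zeta> \<ge> norm \<zeta> powr p * w x"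
        using elim x by auto
      show "A x \<zeta> = F x \<zeta>"
      proof (cases "\<zeta> = 0")
        case True
        then show ?thesis using g by (simp add: F_def)
      next
        case False
        define n where "n = norm \<zeta>"
        define c where "c = n powr (p - 2) * w x"
        have n: "0 < n" using False by (simp add: n_def)
        have c0: "0 \<le> c" using elim by (simp add: c_def)
        have e1: "n powr (p - 1) * w x = c * n"
        proof -
          have "n powr (p - 1) = n powr (p - 2) * n powr 1" by (simp only: powr_add[symmetric]) simp
          then show ?thesis using n by (simp add: c_def)
        qed
        have e2: "n powr p * w x = c * n * n"
        proof -
          have "n powr p = n powr (p - 2) * (n powr 1 * n powr 1)" by (simp only: powr_add[symmetric]) simp
          then show ?thesis using n by (simp add: c_def)
        qed
        \<comment> \<open>Expanding the square: growth bounds the first term from above and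
          degeneracy the mixed product from below, so the squared distance to the p-Laplacian flux
          is at most 0.\<close>
        have "(norm (A x \<zeta> - c *\<^sub>R \<zeta>))\<^sup>2 = (norm (A x \<zeta>))\<^sup>2 - 2 * c * (A x \<zeta> \<bullet> \<zeta>) + c\<^sup>2 * n\<^sup>2"
          unfolding n_def power2_norm_eq_inner
          by (simp add: inner_diff inner_commute[of \<zeta> "A x \<zeta>"] power2_eq_square algebra_simps)
        also have "\<dots> \<le> (c * n)\<^sup>2 - 2 * c * (c * n * n) + c\<^sup>2 * n\<^sup>2"
        proof -
          have "(norm (A x \<zeta>))\<^sup>2 \<le> (c * n)\<^sup>2" using g e1 by (intro power_mono) (auto simp: n_def)
          moreover have "2 * c * (c * n * n) \<le> 2 * c * (A x \<zeta> \<bullet> \<zeta>)" using d e2 c0 by (intro mult_left_mono) (auto simp: n_def)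
          ultimately show ?thesis by linarith
        qed
        also have "\<dots> = 0" by (simp add: power2_eq_square)
        finally have "A x \<zeta> = c *\<^sub>R \<zeta>" by simp
        then show ?thesis by (simp add: F_def c_def n_def)
      qed
    qed
  qed
qed

text \<open>Positivity of the strong monotonicity bound. The delicate factor is the power of
  \<open>A_bar\<close>, whose exponent is at most 0: a \<open>powr\<close> is positive exactly when
  its base is nonzero, and the base is positive because one of two distinct vectors is
  nonzero.\<close>

lemma F_strictly_monotone:
  "AE x in lebesgue. x \<in> \<Omega> \<longrightarrow> (\<forall>\<zeta>1 \<zeta>2. \<zeta>1 \<noteq> \<zeta>2 \<longrightarrow> 0 < (F x \<zeta>1 - F x \<zeta>2) \<bullet> (\<zeta>1 - \<zeta>2))"
proof -
  obtain c where c: "0 < c" "AE x in lebesgue. x \<in> \<Omega> \<longrightarrow> (\<forall>\<zeta>1 \<zeta>2. \<zeta>1 \<noteq> \<zeta>2 \<longrightarrow>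
         (A x \<zeta>1 - A x \<zeta>2) \<bullet> (\<zeta>1 - \<zeta>2) \<ge>
           c * norm (\<zeta>1 - \<zeta>2) powr (max p 2) * A_bar w A x \<zeta>1 \<zeta>2 powr (1 - (max p 2) / p) * w x)"
    using sc unfolding structural_conditions_def Let_def AE_lebesgue_on_iff[OF sets_\<Omega>] by blast
  from c(2) A_eq_F w_pos show ?thesis
  proof eventually_elim
    case (elim x)
    show ?case
    proof (intro impI allI)
      fix \<zeta>1 \<zeta>2 :: 'a assume x: "x \<in> \<Omega>" and ne: "\<zeta>1 \<noteq> \<zeta>2"
      have FF: "F x \<zeta> \<bullet> \<zeta> = norm \<zeta> powr (p - 2) * w x * (norm \<zeta>)\<^sup>2" for \<zeta>
        by (simp add: F_def power2_norm_eq_inner)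
      have FF0: "0 \<le> F x \<zeta> \<bullet> \<zeta>" and FFp: "\<zeta> \<noteq> 0 \<Longrightarrow> 0 < F x \<zeta> \<bullet> \<zeta>" for \<zeta>
        unfolding FF using elim by auto
      have "0 < F x \<zeta>1 \<bullet> \<zeta>1 + F x \<zeta>2 \<bullet> \<zeta>2"
      proof (cases "\<zeta>1 = 0")
        case True
        then show ?thesis using ne FFp[of \<zeta>2] FF0[of \<zeta>1] by simp
      next
        case False
        then show ?thesis using FFp[of \<zeta>1] FF0[of \<zeta>2] by simp
      qed
      then have "0 < A_bar w A x \<zeta>1 \<zeta>2" using elim x by (simp add: A_bar_def)
      then have "0 < c * norm (\<zeta>1 - \<zeta>2) powr (max p 2) * A_bar w A x \<zeta>1 \<zeta>2 powr (1 - (max p 2) / p) * w x"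
        using c(1) ne elim by simp
      also have "\<dots> \<le> (A x \<zeta>1 - A x \<zeta>2) \<bullet> (\<zeta>1 - \<zeta>2)" using elim(1) x ne by blast
      finally show "0 < (F x \<zeta>1 - F x \<zeta>2) \<bullet> (\<zeta>1 - \<zeta>2)" using elim(2) x by simp
    qed
  qed
qed

lemma norm_F: "0 \<le> w x \<Longrightarrow> norm (F x \<zeta>) = norm \<zeta> powr (p - 1) * w x"
proof -
  assume "0 \<le> w x"
  then have "norm (F x \<zeta>) = (norm \<zeta> * norm \<zeta> powr (p - 2)) * w x" by (simp add: F_def abs_mult mult_ac)
  also have "norm \<zeta> * norm \<zeta> powr (p - 2) = norm \<zeta> powr (p - 1)"
    using powr_mult_base[of "norm \<zeta>" "p - 2"] by simp
  finally show ?thesis .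
qed

lemma F_measurable: "g \<in> borel_measurable lebesgue \<Longrightarrow> (\<lambda>x. F x (g x)) \<in> borel_measurable lebesgue"
  unfolding F_def
  by (intro borel_measurable_scaleR borel_measurable_times powr_real_measurable measurable_compose[OF _ borel_measurable_norm]
      borel_measurable_const w_measurable)

section \<open>Sobolev test functions\<close>

abbreviation sol :: "('a \<Rightarrow> real) \<Rightarrow> bool" where
  "sol u \<equiv> weak_solution p \<Omega> w A \<delta> f u"

abbreviation gr :: "('a \<Rightarrow> real) \<Rightarrow> 'a \<Rightarrow> 'a" where
  "gr u \<equiv> weak_grad \<Omega> u"

lemma sol_W1p_loc: "sol u \<Longrightarrow> u \<in> W1p_loc p \<Omega> w"
  by (simp add: weak_solution_def)

lemma sol_pos: "sol u \<Longrightarrow> AE x in lebesgue. x \<in> \<Omega> \<longrightarrow> 0 < u x"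
  unfolding weak_solution_def AE_lebesgue_on_iff[OF sets_\<Omega>] by blast

lemma sol_weak_gradient: "sol u \<Longrightarrow> has_weak_gradient \<Omega> u (gr u)"
  by (rule W1p_loc_weak_gradient[OF open_\<Omega> sol_W1p_loc])

lemma sol_integrable_p:
  "sol u \<Longrightarrow> compact K \<Longrightarrow> K \<subseteq> \<Omega> \<Longrightarrow> integrable lebesgue (\<lambda>x. indicator K x * (norm (gr u x) powr p * w x))"
  by (rule W1p_loc_integrable[OF open_\<Omega> sol_W1p_loc])

lemma sol_weak_form:
  assumes u: "sol u" and \<phi>: "\<phi> \<in> Cc1 \<Omega>" and K: "compact K" "K \<subseteq> \<Omega>"
    and supp: "\<And>x. x \<notin> K \<Longrightarrow> \<phi> x = 0" "\<And>x. x \<notin> K \<Longrightarrow> grad \<phi> x = 0"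
  shows "integrable lebesgue (\<lambda>x. indicator K x * (f x / u x powr \<delta>) * \<phi> x)"
    and "(LINT x|lebesgue. (indicator K x *\<^sub>R F x (gr u x)) \<bullet> grad \<phi> x) = (LINT x|lebesgue. indicator K x * (f x / u x powr \<delta>) * \<phi> x)"
proof -
  have i: "integrable (lebesgue_on \<Omega>) (\<lambda>x. A x (gr u x) \<bullet> grad \<phi> x)"
    "integrable (lebesgue_on \<Omega>) (\<lambda>x. f x / u x powr \<delta> * \<phi> x)"
    "(LINT x|lebesgue_on \<Omega>. A x (gr u x) \<bullet> grad \<phi> x) = (LINT x|lebesgue_on \<Omega>. f x / u x powr \<delta> * \<phi> x)"
    using u \<phi> unfolding weak_solution_def by blast+
  have e2: "(\<lambda>x. indicat_real \<Omega> x *\<^sub>R (f x / u x powr \<delta> * \<phi> x)) = (\<lambda>x. indicator K x * (f x / u x powr \<delta>) * \<phi> x)"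
  proof
    fix x show "indicat_real \<Omega> x *\<^sub>R (f x / u x powr \<delta> * \<phi> x) = indicator K x * (f x / u x powr \<delta>) * \<phi> x"
      using K supp(1)[of x] by (cases "x \<in> K") auto
  qed
  show "integrable lebesgue (\<lambda>x. indicator K x * (f x / u x powr \<delta>) * \<phi> x)"
    using i(2) unfolding integrable_lebesgue_on_iff[OF sets_\<Omega>] e2 .
  have "AE x in lebesgue. indicat_real \<Omega> x *\<^sub>R (A x (gr u x) \<bullet> grad \<phi> x) = (indicator K x *\<^sub>R F x (gr u x)) \<bullet> grad \<phi> x"
    using A_eq_F
  proof eventually_elim
    case (elim x)
    show ?case using K supp(2)[of x] elim by (cases "x \<in> K") auto
  qed
  from integrable_cong_AE_lebesgue(2)[OF i(1)[unfolded integrable_lebesgue_on_iff[OF sets_\<Omega>]] this]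
  show "(LINT x|lebesgue. (indicator K x *\<^sub>R F x (gr u x)) \<bullet> grad \<phi> x) = (LINT x|lebesgue. indicator K x * (f x / u x powr \<delta>) * \<phi> x)"
    using i(3) unfolding integral_lebesgue_on_eq[OF sets_\<Omega>] e2 by simp
qed

text \<open>A cutoff equal to 1 on K is a test function, and integrability of its right-hand side is
  part of being a weak solution. This supplies the majorant when testing with rough
  functions.\<close>

lemma sol_rhs_integrable:
  assumes u: "sol u" and K: "compact K" "K \<subseteq> \<Omega>"
  shows "integrable lebesgue (\<lambda>x. indicator K x * (f x / u x powr \<delta>))"
proof -
  obtain \<psi> where \<psi>: "\<psi> \<in> Cc1 \<Omega>" "\<And>x. x \<in> K \<Longrightarrow> \<psi> x = 1" "\<And>x. 0 \<le> \<psi> x"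
    by (rule exists_cutoff[OF open_\<Omega> K]) (rule that)
  obtain L M where "support_bound \<Omega> L M \<psi>"
    by (rule Cc1D[OF \<psi>(1)])
  note L = support_boundD[OF this]
  have KL: "K \<subseteq> L"
  proof
    fix x assume "x \<in> K"
    show "x \<in> L"
    proof (rule ccontr)
      assume "x \<notin> L"
      then show False using L(3)[of x] \<psi>(2)[OF \<open>x \<in> K\<close>] by simp
    qed
  qed
  have "integrable lebesgue (\<lambda>x. indicat_real L x *\<^sub>R ((f x / u x powr \<delta>) * \<psi> x))"
  proof -
    have "integrable lebesgue (\<lambda>x. indicator L x * (f x / u x powr \<delta>) * \<psi> x)"
      by (rule sol_weak_form(1)[OF u \<psi>(1) L(1,2)]) (erule L(3), erule L(4))
    then show ?thesis by (simp add: mult.assoc)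
  qed
  from integrable_indicator_subset[OF this KL sets_lebesgue_compact[OF K(1)]]
  have "integrable lebesgue (\<lambda>x. indicat_real K x *\<^sub>R ((f x / u x powr \<delta>) * \<psi> x))" .
  moreover have "(\<lambda>x. indicat_real K x *\<^sub>R ((f x / u x powr \<delta>) * \<psi> x)) = (\<lambda>x. indicator K x * (f x / u x powr \<delta>))"
    using \<psi>(2) by (auto simp: indicator_def fun_eq_iff)
  ultimately show ?thesis by metis
qed

text \<open>Mollifications of T are C^1 test functions. On the left their gradients have bounded
  energy and converge in L1, so the pairing with the flux converges; the energy of u is known to be
  finite on compact sets, whence the compact support of T. On the right the bound on T and local
  integrability of f / u^\<delta> allow dominated convergence.\<close>

lemma sol_test:
  assumes u: "sol u" and T: "has_weak_gradient \<Omega> T S" and K: "compact K" "K \<subseteq> \<Omega>"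
    and supp: "AE x in lebesgue. x \<in> \<Omega> \<longrightarrow> x \<notin> K \<longrightarrow> T x = 0 \<and> S x = 0"
    and bdd: "AE x in lebesgue. x \<in> \<Omega> \<longrightarrow> \<bar>T x\<bar> \<le> M"
    and Sp: "integrable lebesgue (\<lambda>x. indicator K x * (norm (S x) powr p * w x))"
  shows "integrable lebesgue (\<lambda>x. indicator K x * (F x (gr u x) \<bullet> S x))"
    "integrable lebesgue (\<lambda>x. indicator K x * (f x / u x powr \<delta> * T x))"
    "(LINT x|lebesgue. indicator K x * (F x (gr u x) \<bullet> S x)) = (LINT x|lebesgue. indicator K x * (f x / u x powr \<delta> * T x))"
proof -
  obtain K' d where K': "compact K'" "K' \<subseteq> \<Omega>" "0 < d" "K \<subseteq> K'" "\<And>x. x \<in> K \<Longrightarrow> cball x d \<subseteq> K'"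
    by (rule compact_in_open_cball[OF K(1) open_\<Omega> K(2)]) (rule that)
  obtain R where R: "\<And>x. x \<in> K' \<Longrightarrow> norm x \<le> R"
    using compact_imp_bounded[OF K'(1)] unfolding bounded_iff by blast
  \<comment> \<open>The support and the bound are given only almost everywhere; T0 satisfies them at
    every point, as the pointwise bounds on mollifications require.\<close>
  define T0 where "T0 x = (if x \<in> K \<and> \<bar>T x\<bar> \<le> M then T x else 0)" for x
  define S0 where "S0 x = indicat_real K x *\<^sub>R S x" for x
  have TT: "AE x in lebesgue. indicator K' x * T x = T0 x"
    using supp bdd by eventually_elim (use K'(2,4) in \<open>auto simp: T0_def indicator_def\<close>)
  have SS: "AE x in lebesgue. indicator K' x *\<^sub>R S x = S0 x"
    using supp by eventually_elim (use K'(2,4) in \<open>auto simp: S0_def indicator_def\<close>)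
  have iT: "integrable lebesgue T0"
    by (rule integrable_cong_AE_lebesgue(1)[OF has_weak_gradientD(1)[OF open_\<Omega> T K'(1,2)] TT])
  have iS: "integrable lebesgue S0"
    unfolding S0_def[abs_def] by (rule has_weak_gradientD(2)[OF open_\<Omega> T K])
  have iSp: "finite_energy p w S0"
  proof -
    have "(\<lambda>x. norm (S0 x) powr p * w x) = (\<lambda>x. indicator K x * (norm (S x) powr p * w x))"
      by (auto simp: S0_def indicator_def fun_eq_iff)
    then show ?thesis using Sp by simp
  qed
  have T0M: "norm (T0 x) \<le> \<bar>M\<bar>" for x by (auto simp: T0_def)
  have T00: "T0 x = 0" "S0 x = 0" if "x \<notin> K" for x using that by (auto simp: T0_def S0_def)
  have T0R: "T0 x = 0" "S0 x = 0" if "R < norm x" for x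
  proof -
    have "x \<notin> K" using R[of x] that K'(4) by auto
    then show "T0 x = 0" "S0 x = 0" by (rule T00)+
  qed
  \<comment> \<open>Half of d: if x is within r of a point of K, the kernel ball around x is within
    2 r \<le> d of that point and stays in K'.\<close>
  define r0 where "r0 n = (d / 2) / real (Suc n)" for n
  have r0: "0 < r0 n" "r0 n \<le> d / 2" for n using K'(3) by (auto simp: r0_def divide_simps)
  have r00: "r0 \<longlonglongrightarrow> 0" unfolding r0_def by (rule LIMSEQ_Suc[OF lim_const_over_n])
  obtain q where q: "strict_mono q" "AE x in lebesgue. (\<lambda>n. moll (r0 (q n)) T0 x) \<longlonglongrightarrow> T0 x"
    by (rule moll_subseq_AE[where R=R and r=r0, OF iT _ r0(1) r00]) (erule T0R, rule that)
  define r where "r n = r0 (q n)" for n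
  have r: "0 < r n" "r n \<le> d / 2" for n using r0 by (auto simp: r_def)
  have rlim: "r \<longlonglongrightarrow> 0"
    using LIMSEQ_subseq_LIMSEQ[OF r00 q(1)] by (simp add: r_def[abs_def] comp_def)
  let ?T = "\<lambda>n. moll (r n) T0" and ?S = "\<lambda>n. moll (r n) S0"
  have far: "?T n x = 0 \<and> ?S n x = 0 \<and> dmoll (r n) T0 x b = 0" if x: "\<And>y. y \<in> K \<Longrightarrow> r n < dist x y" for n x b
  proof -
    have z: "T0 y = 0 \<and> S0 y = 0" if "dist x y \<le> r n" for y
      using T00[of y] x[of y] that by force
    have "dkern (r n) (x - y) b * T0 y = 0" for y
      using z[of y] dkern_eq_0[OF r(1)[of n], of "x - y"] by (cases "dist x y \<le> r n") (auto simp: dist_norm)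
    then have "dmoll (r n) T0 x b = 0" unfolding dmoll_def by (simp only: integral_zero)
    moreover have "?T n x = 0" by (rule moll_eq_0) (use z r in auto)
    moreover have "?S n x = 0" by (rule moll_eq_0) (use z r in auto)
    ultimately show ?thesis by blast
  qed
  have off: "?T n x = 0" "?S n x = 0" if x: "x \<notin> K'" for n x
  proof -
    have "r n < dist x y" if "y \<in> K" for y
    proof -
      have "x \<notin> cball y d" using K'(5)[OF that] x by blast
      then show ?thesis using r(2)[of n] K'(3) by (simp add: dist_commute)
    qed
    then show "?T n x = 0" "?S n x = 0" using far by blast+
  qed
  \<comment> \<open>Two regimes: far from K everything vanishes, near K the kernel ball lies in K'
    and mollification commutes with the weak gradient.\<close>
  have dT: "dmoll (r n) T0 x b = ?S n x \<bullet> b" if b: "b \<in> Basis" for n x b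
  proof (cases "\<exists>y\<in>K. dist x y \<le> r n")
    case False
    then show ?thesis using far[of n x b] by (force simp: not_le)
  next
    case True
    then obtain y where y: "y \<in> K" "dist x y \<le> r n" by blast
    have cb: "cball x (r n) \<subseteq> K'"
    proof
      fix z assume "z \<in> cball x (r n)"
      then have "dist y z \<le> d" using dist_triangle[of y z x] y(2) r(2)[of n] by (simp add: dist_commute)
      then show "z \<in> K'" using K'(5)[OF y(1)] by auto
    qed
    have "dmoll (r n) T0 x b = dmoll (r n) (\<lambda>y. indicator K' y * T y) x b"
      unfolding dmoll_def
    proof (rule integrable_cong_AE_lebesgue(2)[OF integrable_dkern[OF has_weak_gradientD(1)[OF open_\<Omega> T K'(1,2)] r(1)]])
      show "AE y in lebesgue. dkern (r n) (x - y) b * (indicator K' y * T y) = dkern (r n) (x - y) b * T0 y"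
        using TT by eventually_elim simp
    qed
    also have "\<dots> = moll (r n) (\<lambda>y. indicator K' y *\<^sub>R S y) x \<bullet> b"
      by (rule dmoll_weak_gradient[OF open_\<Omega> T K'(1,2) cb r(1) b])
    also have "moll (r n) (\<lambda>y. indicator K' y *\<^sub>R S y) x = ?S n x"
      unfolding moll_def
    proof (rule integrable_cong_AE_lebesgue(2)[OF integrable_moll_integrand[OF iS r(1)]])
      show "AE y in lebesgue. kern (r n) (x - y) *\<^sub>R S0 y = kern (r n) (x - y) *\<^sub>R (indicator K' y *\<^sub>R S y)"
        using SS by eventually_elim simp
    qed
    finally show ?thesis .
  qed
  have grT: "grad (?T n) x = ?S n x" for n x
  proof (rule euclidean_eqI)
    fix b :: 'a assume b: "b \<in> Basis"
    have "frechet_derivative (?T n) (at x) = dmoll (r n) T0 x"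
      by (rule frechet_derivative_at[OF moll_has_derivative[OF iT r(1)], symmetric])
    then show "grad (?T n) x \<bullet> b = ?S n x \<bullet> b"
      by (simp only: grad_inner[OF b] dT[OF b])
  qed
  have Tn: "?T n \<in> Cc1 \<Omega>" for n
  proof -
    have "{x. ?T n x \<noteq> 0} \<subseteq> K'" using off(1) by (auto intro: ccontr)
    then have "closure {x. ?T n x \<noteq> 0} \<subseteq> K'"
      by (rule closure_minimal[OF _ compact_imp_closed[OF K'(1)]])
    then have "{x. ?T n x \<noteq> 0} \<Subset> \<Omega>"
      unfolding compactly_contained_def using K'(1,2)
      by (meson bounded_subset closed_closure compact_eq_bounded_closed order_trans)
    then show ?thesis
      unfolding Cc1_def mem_Collect_eq using Ck_on_1_moll[OF iT r(1)] by (rule conjI[rotated])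
  qed
  have grT0: "grad (?T n) x = 0" if "x \<notin> K'" for n x
    unfolding grT by (rule off(2)[OF that])
  let ?F = "\<lambda>x. indicat_real K' x *\<^sub>R F x (gr u x)"
  let ?f = "\<lambda>x. indicator K' x * (f x / u x powr \<delta>)"
  have weak: "(LINT x|lebesgue. ?F x \<bullet> ?S n x) = (LINT x|lebesgue. ?f x * ?T n x)" for n
  proof -
    have "(LINT x|lebesgue. ?F x \<bullet> grad (?T n) x) = (LINT x|lebesgue. ?f x * ?T n x)"
      by (rule sol_weak_form(2)[OF u Tn K'(1,2)]) (erule off(1), erule grT0)
    then show ?thesis by (simp only: grT)
  qed
  have if': "integrable lebesgue ?f" by (rule sol_rhs_integrable[OF u K'(1,2)])
  define a where "a x = norm (indicat_real K' x *\<^sub>R gr u x)" for x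
  have gm: "(\<lambda>x. indicat_real K' x *\<^sub>R gr u x) \<in> borel_measurable lebesgue"
    using has_weak_gradientD(2)[OF open_\<Omega> sol_weak_gradient[OF u] K'(1,2)] by simp
  have Feq: "?F = (\<lambda>x. F x (indicat_real K' x *\<^sub>R gr u x))"
    by (auto simp: F_def indicator_def fun_eq_iff)
  have mF: "?F \<in> borel_measurable lebesgue"
    unfolding Feq by (rule F_measurable[OF gm])
  have ia: "integrable lebesgue (\<lambda>x. a x powr p * w x)"
  proof -
    have "(\<lambda>x. a x powr p * w x) = (\<lambda>x. indicator K' x * (norm (gr u x) powr p * w x))"
      by (auto simp: a_def indicator_def fun_eq_iff)
    then show ?thesis using sol_integrable_p[OF u K'(1,2)] by simp
  qed
  have Fa: "AE x in lebesgue. norm (?F x) \<le> a x powr (p - 1) * w x"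
    using w_pos
  proof eventually_elim
    case (elim x)
    have "?F x = F x (indicat_real K' x *\<^sub>R gr u x)" using Feq by meson
    then show ?case using elim by (simp add: a_def norm_F)
  qed
  have a0: "0 \<le> a x" for x by (simp add: a_def)
  obtain C where C: "0 \<le> C" "\<And>r (S :: 'a \<Rightarrow> 'a). 0 < r \<Longrightarrow> integrable lebesgue S \<Longrightarrow>
      finite_energy p w S \<Longrightarrow>
      finite_energy p w (moll r S) \<and>
      (energy p w (moll r S)) \<le> C * (energy p w S)"
    by (rule moll_weighted_bound[OF p Ap]) (rule that)
  note CS = C(2)[OF r(1) iS iSp]
  have lim1: "(\<lambda>n. LINT x|lebesgue. ?F x \<bullet> ?S n x) \<longlonglongrightarrow> (LINT x|lebesgue. ?F x \<bullet> S0 x)"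
  proof (rule weighted_pairing_tendsto[OF p mF a0 ia w_pos Fa iS iSp])
    show "integrable lebesgue (?S n)" for n by (rule integrable_moll(1)[OF iS r(1)])
    show "finite_energy p w (?S n)" for n using CS by blast
    show "(energy p w (?S n)) \<le> C * (energy p w S0)" for n using CS by blast
    show "(\<lambda>n. LINT x|lebesgue. norm (?S n x - S0 x)) \<longlonglongrightarrow> 0"
      by (rule moll_tendsto_L1[where R=R, OF iS _ r(1) rlim]) (erule T0R)
  qed
  have mT: "T0 \<in> borel_measurable lebesgue" "?T n \<in> borel_measurable lebesgue" for n
    using iT integrable_moll(1)[OF iT r(1)] by auto
  have mf: "?f \<in> borel_measurable lebesgue" using if' by (rule borel_measurable_integrable)
  have ifM: "integrable lebesgue (\<lambda>x. \<bar>M\<bar> * norm (?f x))"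
    by (rule integrable_mult_right[OF integrable_norm[OF if']])
  have b1: "AE x in lebesgue. norm (?f x * ?T n x) \<le> \<bar>M\<bar> * norm (?f x)" for n
  proof (intro AE_I2)
    fix x
    show "norm (?f x * ?T n x) \<le> \<bar>M\<bar> * norm (?f x)"
      using mult_right_mono[OF norm_moll_bounded[OF iT r(1) T0M, of n x] norm_ge_zero[of "?f x"]]
      by (simp only: norm_mult[of "?f x"] mult.commute[of "norm (?f x)"])
  qed
  have flim: "AE x in lebesgue. (\<lambda>n. ?f x * ?T n x) \<longlonglongrightarrow> ?f x * T0 x"
    using q(2)
  proof eventually_elim
    case (elim x)
    then show ?case unfolding r_def by (rule tendsto_mult_left)
  qed
  have lim2: "(\<lambda>n. LINT x|lebesgue. ?f x * ?T n x) \<longlonglongrightarrow> (LINT x|lebesgue. ?f x * T0 x)"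
  proof (rule integral_dominated_convergence[OF _ _ ifM _ b1])
    show "AE x in lebesgue. (\<lambda>n. ?f x * ?T n x) \<longlonglongrightarrow> ?f x * T0 x"
      by (rule flim)
  qed (intro borel_measurable_times mf mT)+
  have eq: "(LINT x|lebesgue. ?F x \<bullet> S0 x) = (LINT x|lebesgue. ?f x * T0 x)"
    using lim1 lim2 unfolding weak by (rule LIMSEQ_unique)
  have e1: "(\<lambda>x. ?F x \<bullet> S0 x) = (\<lambda>x. indicator K x * (F x (gr u x) \<bullet> S x))"
    using K'(4) by (auto simp: S0_def indicator_def fun_eq_iff)
  have e2: "AE x in lebesgue. ?f x * T0 x = indicator K x * (f x / u x powr \<delta> * T x)"
    using TT by eventually_elim (use K'(4) in \<open>auto simp: T0_def indicator_def split: if_splits\<close>)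
  have i2: "integrable lebesgue (\<lambda>x. ?f x * T0 x)"
  proof (rule integrable_dominated_convergence[OF _ _ ifM _ b1])
    show "AE x in lebesgue. (\<lambda>n. ?f x * ?T n x) \<longlonglongrightarrow> ?f x * T0 x"
      by (rule flim)
  qed (intro borel_measurable_times mf mT)+
  have i1: "integrable lebesgue (\<lambda>x. ?F x \<bullet> S0 x)"
    by (rule weighted_pairing_integrable[OF p mF a0 ia w_pos Fa borel_measurable_integrable[OF iS] iSp])
  show "integrable lebesgue (\<lambda>x. indicator K x * (F x (gr u x) \<bullet> S x))"
    using i1 unfolding e1 .
  show "integrable lebesgue (\<lambda>x. indicator K x * (f x / u x powr \<delta> * T x))"
    by (rule integrable_cong_AE_lebesgue(1)[OF i2 e2])
  show "(LINT x|lebesgue. indicator K x * (F x (gr u x) \<bullet> S x)) = (LINT x|lebesgue. indicator K x * (f x / u x powr \<delta> * T x))"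
    using eq unfolding e1 integrable_cong_AE_lebesgue(2)[OF i2 e2] .
qed

end

section \<open>Energy estimates\<close>

text \<open>A \<open>C\<^sup>1\<close> substitute for \<open>t\<^sup>+\<close>, convex and 1-Lipschitz.\<close>

definition G :: "real \<Rightarrow> real" where "G t = sqrt (1 + (max t 0)\<^sup>2) - 1"

definition dG :: "real \<Rightarrow> real" where "dG t = max t 0 / sqrt (1 + (max t 0)\<^sup>2)"

lemma max_0_square_has_derivative: "((\<lambda>t::real. (max t 0)\<^sup>2) has_real_derivative 2 * max t 0) (at t)"
proof -
  consider "t < 0" | "t = 0" | "t > 0" by linarith
  then show ?thesis
  proof cases
    case 1
    have "\<forall>\<^sub>F x in nhds t. 0 = (max x 0)\<^sup>2"
      using eventually_nhds_in_open[of "{..<0}" t] 1 by (auto elim!: eventually_mono)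
    then show ?thesis
      using 1 DERIV_cong_ev[of t t "\<lambda>_. 0" "\<lambda>x. (max x 0)\<^sup>2" 0 0] by simp
  next
    case 2
    have "((\<lambda>h::real. (max h 0)\<^sup>2 / h) \<longlongrightarrow> 0) (at 0)"
    proof (rule Lim_null_comparison[where g="\<lambda>h. \<bar>h\<bar>"])
      show "\<forall>\<^sub>F h::real in at 0. norm ((max h 0)\<^sup>2 / h) \<le> \<bar>h\<bar>"
        by (intro always_eventually allI) (auto simp: max_def power2_eq_square)
      show "((\<lambda>h::real. \<bar>h\<bar>) \<longlongrightarrow> 0) (at 0)"
        using tendsto_rabs[OF tendsto_ident_at[of "0::real" UNIV]] by simp
    qed
    then show ?thesis using 2 by (simp add: DERIV_def)
  next
    case 3
    have "((\<lambda>x. x\<^sup>2) has_real_derivative 2 * max t 0) (at t)"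
      using 3 by (auto intro!: derivative_eq_intros)
    moreover have "\<forall>\<^sub>F x in nhds t. x\<^sup>2 = (max x 0)\<^sup>2"
      using eventually_nhds_in_open[of "{0<..}" t] 3 by (auto elim!: eventually_mono)
    ultimately show ?thesis
      using DERIV_cong_ev[of t t "\<lambda>x. x\<^sup>2" "\<lambda>x. (max x 0)\<^sup>2"] by simp
  qed
qed

lemma one_plus_square_pos: "0 < 1 + (x::real)\<^sup>2"
  by (simp add: add_pos_nonneg)

lemma G_has_derivative: "(G has_real_derivative dG t) (at t)"
proof -
  have 1: "((\<lambda>t. 1 + (max t 0)\<^sup>2) has_real_derivative 0 + 2 * max t 0) (at t)"
    by (intro DERIV_add DERIV_const max_0_square_has_derivative)
  have "((\<lambda>t. sqrt (1 + (max t 0)\<^sup>2) - 1) has_real_derivative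
      inverse (sqrt (1 + (max t 0)\<^sup>2)) / 2 * (0 + 2 * max t 0) - 0) (at t)"
    by (intro DERIV_diff DERIV_const DERIV_chain2[OF DERIV_real_sqrt[OF one_plus_square_pos] 1])
  then show ?thesis by (simp add: G_def[abs_def] dG_def field_simps)
qed

lemma continuous_on_dG: "continuous_on UNIV dG"
  unfolding dG_def[abs_def]
proof (intro continuous_intros ballI)
  fix t :: real show "sqrt (1 + (max t 0)\<^sup>2) \<noteq> 0" using one_plus_square_pos[of "max t 0"] by (simp only: real_sqrt_eq_0_iff)
qed

lemma dG_nonneg: "0 \<le> dG t" by (simp add: dG_def)

lemma dG_le_1: "dG t \<le> 1"
proof -
  have "max t 0 \<le> sqrt (1 + (max t 0)\<^sup>2)" by (intro real_le_rsqrt) simp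
  then show ?thesis using one_plus_square_pos[of "max t 0"] by (simp add: dG_def divide_le_eq_1)
qed

lemma abs_dG_le_1: "\<bar>dG t\<bar> \<le> 1" using dG_nonneg[of t] dG_le_1[of t] by simp

lemma dG_eq_0: "t \<le> 0 \<Longrightarrow> dG t = 0" by (simp add: dG_def)

lemma dG_pos: "0 < t \<Longrightarrow> 0 < dG t"
  using one_plus_square_pos[of t] by (simp add: dG_def)

lemma dG_mono: "s \<le> t \<Longrightarrow> dG s \<le> dG t"
proof -
  assume st: "s \<le> t"
  define a b where "a = max s 0" and "b = max t 0"
  have ab: "0 \<le> a" "a \<le> b" using st by (auto simp: a_def b_def)
  have "a * sqrt (1 + b\<^sup>2) = sqrt (a\<^sup>2 * (1 + b\<^sup>2))" using ab by (simp add: real_sqrt_mult)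
  also have "\<dots> \<le> sqrt (b\<^sup>2 * (1 + a\<^sup>2))"
    using power_mono[OF ab(2,1), of 2] by (intro real_sqrt_le_mono) (simp add: algebra_simps)
  also have "\<dots> = b * sqrt (1 + a\<^sup>2)" using ab by (simp add: real_sqrt_mult)
  finally have "a / sqrt (1 + a\<^sup>2) \<le> b / sqrt (1 + b\<^sup>2)"
    using one_plus_square_pos[of a] one_plus_square_pos[of b] by (simp add: divide_le_eq pos_le_divide_eq mult.commute)
  then show ?thesis by (simp add: dG_def a_def b_def)
qed

lemma G_eq_0: "t \<le> 0 \<Longrightarrow> G t = 0" by (simp add: G_def)

lemma G_lipschitz: "\<bar>G s - G t\<bar> \<le> \<bar>s - t\<bar>"
  using real_lipschitz_bound[OF G_has_derivative abs_dG_le_1, of s t] by simp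

lemma G_nonneg: "0 \<le> G t" by (simp add: G_def)

lemma G_mono: "s \<le> t \<Longrightarrow> G s \<le> G t"
  by (auto simp: G_def intro!: real_sqrt_le_mono power_mono)

lemma G_pos_iff: "0 < G t \<longleftrightarrow> 0 < t"
  by (cases "0 < t") (auto simp: G_def)

lemma G_le_max: "G t \<le> max t 0"
  using G_lipschitz[of t 0] G_eq_0[of t] G_eq_0[of 0] G_nonneg[of t] by (cases "t \<le> 0") auto

text \<open>G is quadratic near 0 and asymptotic to t, so a linear lower bound needs t bounded away
  from 0. After squaring, slope q requires (2 + t q) q \<le> t. This holds for q \<le> t / (t + 2),
  bounding the q in the bracket by 1, and t \<ge> \<tau> admits q = \<tau> / (\<tau> + 2).\<close>

lemma G_lower:
  assumes "0 < \<tau>" "\<tau> \<le> t" shows "t * (\<tau> / (\<tau> + 2)) \<le> G t"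
proof -
  have t: "0 < t" using assms by linarith
  let ?q = "\<tau> / (\<tau> + 2)"
  have q: "0 \<le> ?q" "?q \<le> 1" using assms by auto
  have "1 + t * ?q \<le> sqrt (1 + t\<^sup>2)"
  proof (rule real_le_rsqrt)
    have "(2 + t * ?q) * ?q \<le> t"
    proof -
      have "?q \<le> t / (t + 2)" using assms by (simp add: divide_simps, simp add: algebra_simps)
      then have "(2 + t * ?q) * ?q \<le> (2 + t * 1) * (t / (t + 2))"
        using q t by (intro mult_mono add_mono mult_left_mono) auto
      also have "\<dots> = t" using t by (simp add: field_simps)
      finally show ?thesis .
    qed
    then have "t * ((2 + t * ?q) * ?q) \<le> t * t" using t by (intro mult_left_mono) auto
    then show "(1 + t * ?q)\<^sup>2 \<le> 1 + t\<^sup>2" by (simp add: power2_eq_square algebra_simps)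
  qed
  then show ?thesis using t by (simp add: G_def)
qed

lemma powr_add_le:
  fixes a b p :: real
  assumes "0 < p" "0 \<le> a" "0 \<le> b"
  shows "(a + b) powr p \<le> 2 powr p * (a powr p + b powr p)"
proof -
  have "(a + b) powr p \<le> (2 * max a b) powr p" using assms by (intro powr_mono2) auto
  also have "\<dots> = 2 powr p * max a b powr p" by (rule powr_mult; use assms in auto)
  also have "max a b powr p \<le> a powr p + b powr p" by (auto simp: max_def)
  finally show ?thesis by simp
qed

text \<open>Fatou's lemma with bounds for late indices. The \<open>ennreal\<close> form fits because
  integrability of the limit is what its uses aim at and cannot be presupposed.\<close>

lemma nn_integral_le_lim:
  fixes g :: "nat \<Rightarrow> 'a \<Rightarrow> real"
  assumes m: "\<And>n. g n \<in> borel_measurable M" and lim: "AE x in M. (\<lambda>n. g n x) \<longlonglongrightarrow> h x"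
    and c: "\<And>n. N \<le> n \<Longrightarrow> (\<integral>\<^sup>+x. ennreal (g n x) \<partial>M) \<le> c"
  shows "(\<integral>\<^sup>+x. ennreal (h x) \<partial>M) \<le> c"
proof -
  have "(\<integral>\<^sup>+x. ennreal (h x) \<partial>M) = (\<integral>\<^sup>+x. liminf (\<lambda>n. ennreal (g n x)) \<partial>M)"
  proof (rule nn_integral_cong_AE)
    show "AE x in M. ennreal (h x) = liminf (\<lambda>n. ennreal (g n x))"
      using lim
    proof eventually_elim
      case (elim x)
      then have "(\<lambda>n. ennreal (g n x)) \<longlonglongrightarrow> ennreal (h x)" by (rule tendsto_ennrealI)
      then show ?case by (simp add: lim_imp_Liminf)
    qed
  qed
  also have "\<dots> \<le> liminf (\<lambda>n. \<integral>\<^sup>+x. ennreal (g n x) \<partial>M)"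
    using m by (intro nn_integral_liminf) simp
  also have "\<dots> \<le> limsup (\<lambda>n. \<integral>\<^sup>+x. ennreal (g n x) \<partial>M)"
    by (rule Liminf_le_Limsup) simp
  also have "\<dots> \<le> c"
    by (rule Limsup_bounded) (use c in \<open>auto simp: eventually_sequentially\<close>)
  finally show ?thesis .
qed

context weighted_problem
begin

lemma integrable_powr_dominated:
  fixes S :: "'a \<Rightarrow> 'b::euclidean_space" and P :: "'a \<Rightarrow> 'c::euclidean_space" and Q :: "'a \<Rightarrow> 'd::euclidean_space"
  assumes "S \<in> borel_measurable lebesgue" "AE x in lebesgue. norm (S x) \<le> norm (P x) + norm (Q x)"
    and P: "finite_energy p w P"
    and Q: "finite_energy p w Q"
  shows "finite_energy p w S"
    and "(energy p w S) \<le> 2 powr p * ((energy p w P) + (energy p w Q))"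
proof -
  let ?D = "\<lambda>x. 2 powr p * (norm (P x) powr p * w x + norm (Q x) powr p * w x)"
  have D: "integrable lebesgue ?D" using P Q by simp
  have le: "AE x in lebesgue. 0 \<le> norm (S x) powr p * w x \<and> norm (S x) powr p * w x \<le> ?D x"
    using assms(2) w_pos
  proof eventually_elim
    case (elim x)
    have "norm (S x) powr p \<le> (norm (P x) + norm (Q x)) powr p" using elim p by (intro powr_mono2) auto
    also have "\<dots> \<le> 2 powr p * (norm (P x) powr p + norm (Q x) powr p)" using p by (intro powr_add_le) auto
    finally have "norm (S x) powr p * w x \<le> 2 powr p * (norm (P x) powr p + norm (Q x) powr p) * w x"
      using elim by (intro mult_right_mono) auto
    then show ?case using elim by (simp add: algebra_simps)
  qed
  show i: "finite_energy p w S"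
  proof (rule Bochner_Integration.integrable_bound[OF D])
    show "(\<lambda>x. norm (S x) powr p * w x) \<in> borel_measurable lebesgue"
      using assms(1) w_measurable by (intro borel_measurable_times powr_real_measurable measurable_compose[OF _ borel_measurable_norm] borel_measurable_const)
    show "AE x in lebesgue. norm (norm (S x) powr p * w x) \<le> norm (?D x)"
      using le by eventually_elim simp
  qed
  have "(energy p w S) \<le> integral\<^sup>L lebesgue ?D"
    by (rule integral_mono_AE[OF i D]) (use le in eventually_elim, simp)
  then show "(energy p w S) \<le> 2 powr p * ((energy p w P) + (energy p w Q))"
    using P Q by simp
qed

lemma Cc1_integrable_p:
  assumes "\<phi> \<in> Cc1 \<Omega>'"
  shows "finite_energy p w (grad \<phi>)" "grad \<phi> \<in> borel_measurable lebesgue"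
proof -
  obtain K M where "support_bound \<Omega>' K M \<phi>"
    by (rule Cc1D[OF assms])
  note KM = support_boundD[OF this]
  show m: "grad \<phi> \<in> borel_measurable lebesgue"
    using KM(9) by (intro borel_measurable_lebesgue_compose borel_measurable_continuous_onI)
  have "integrable lebesgue (\<lambda>x. (norm (grad \<phi> x) powr p) *\<^sub>R (indicator K x * w x))"
  proof (rule integrable_mult_bounded[OF Ap_weightD(3)[OF Ap KM(1)], of _ "M powr p"])
    show "(\<lambda>x. norm (grad \<phi> x) powr p) \<in> borel_measurable lebesgue"
      using m by (intro powr_real_measurable measurable_compose[OF _ borel_measurable_norm] borel_measurable_const)
    show "\<bar>norm (grad \<phi> x) powr p\<bar> \<le> M powr p" for x
      using KM(6)[of x] p by (simp add: powr_mono2)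
  qed
  moreover have "(\<lambda>x. (norm (grad \<phi> x) powr p) *\<^sub>R (indicator K x * w x)) = (\<lambda>x. norm (grad \<phi> x) powr p * w x)"
    using KM(4) by (auto simp: indicator_def fun_eq_iff)
  ultimately show "finite_energy p w (grad \<phi>)" by metis
qed

lemma rhs_nonneg:
  "AE x in lebesgue. x \<in> \<Omega> \<longrightarrow> 0 \<le> f x"
  using f0 unfolding AE_lebesgue_on_iff[OF sets_\<Omega>] .

lemma F_inner_self: "0 \<le> w x \<Longrightarrow> F x z \<bullet> z = norm z powr p * w x"
proof -
  assume "0 \<le> w x"
  have "norm z powr (p - 2) * (norm z)\<^sup>2 = norm z powr p"
  proof (cases "z = 0")
    case False
    then have "(norm z)\<^sup>2 = norm z powr 2" by simp
    then show ?thesis by (simp only: powr_add[symmetric]) simp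
  qed simp
  then show ?thesis by (simp add: F_def power2_norm_eq_inner[symmetric] mult_ac)
qed

text \<open>A weak gradient carries no information off \<Omega>; measurability on the whole space
  makes sense only after cutting off.\<close>

lemma gr_measurable_\<Omega>:
  assumes "has_weak_gradient \<Omega> u g"
  shows "(\<lambda>x. indicat_real \<Omega> x *\<^sub>R g x) \<in> borel_measurable lebesgue" "(\<lambda>x. indicat_real \<Omega> x * u x) \<in> borel_measurable lebesgue"
proof -
  have "g \<in> borel_measurable (lebesgue_on \<Omega>)" "u \<in> borel_measurable (lebesgue_on \<Omega>)"
    using assms by (auto simp: has_weak_gradient_def locally_integrable_def)
  then show "(\<lambda>x. indicat_real \<Omega> x *\<^sub>R g x) \<in> borel_measurable lebesgue" "(\<lambda>x. indicat_real \<Omega> x * u x) \<in> borel_measurable lebesgue"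
    unfolding borel_measurable_lebesgue_on_iff[OF sets_\<Omega>] by simp_all
qed

text \<open>Test the equation with a smooth version of \<open>(\<phi> - v)\<^sup>+\<close> and drop the nonnegative right-hand side.\<close>

lemma energy_below_test_function:
  assumes v: "sol v" and \<phi>: "\<phi> \<in> Cc1 \<Omega>"
  shows "(\<integral>\<^sup>+x. ennreal (indicator \<Omega> x * (dG (\<phi> x - v x) * (norm (gr v x) powr p * w x))) \<partial>lebesgue)
    \<le> ennreal (2 * (1 / 2) powr (1 - p) * (energy p w (grad \<phi>)))"
proof -
  obtain K M where "support_bound \<Omega> K M \<phi>"
    by (rule Cc1D[OF \<phi>])
  note KM = support_boundD[OF this]
  have \<phi>1: "Ck_on 1 UNIV \<phi>" using \<phi> unfolding Cc1_def mem_Collect_eq by (rule conjunct1)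
  define d where "d x = dG (\<phi> x - v x)" for x
  define S where "S x = d x *\<^sub>R (grad \<phi> x - gr v x)" for x
  define T where "T x = G (\<phi> x - v x)" for x
  have "has_weak_gradient \<Omega> (\<lambda>x. 1 * \<phi> x + (-1) * v x) (\<lambda>x. 1 *\<^sub>R grad \<phi> x + (-1) *\<^sub>R gr v x)"
    by (rule has_weak_gradient_linear[OF open_\<Omega> has_weak_gradient_C1[OF open_\<Omega> \<phi>1] sol_weak_gradient[OF v]])
  then have "has_weak_gradient \<Omega> (\<lambda>x. \<phi> x - v x) (\<lambda>x. grad \<phi> x - gr v x)" by simp
  from has_weak_gradient_chain[OF open_\<Omega> this G_has_derivative continuous_on_dG abs_dG_le_1]
  have wT: "has_weak_gradient \<Omega> T S" by (simp add: T_def[abs_def] S_def[abs_def] d_def)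
  have vp: "AE x in lebesgue. x \<in> \<Omega> \<longrightarrow> 0 < v x" by (rule sol_pos[OF v])
  \<comment> \<open>Off the support of \<phi> one has \<phi> - v = - v < 0, so positivity of v gives
    the test function compact support although v has none.\<close>
  have supp: "AE x in lebesgue. x \<in> \<Omega> \<longrightarrow> x \<notin> K \<longrightarrow> T x = 0 \<and> S x = 0"
    using vp by eventually_elim (auto simp: T_def S_def d_def KM(3) G_eq_0 dG_eq_0)
  have bdd: "AE x in lebesgue. x \<in> \<Omega> \<longrightarrow> \<bar>T x\<bar> \<le> M"
    using vp
  proof eventually_elim
    case (elim x)
    then show ?case using G_le_max[of "\<phi> x - v x"] G_nonneg[of "\<phi> x - v x"] KM(5)[of x] KM(7) by (auto simp: T_def)
  qed
  have iv: "integrable lebesgue (\<lambda>x. norm (indicat_real K x *\<^sub>R gr v x) powr p * w x)"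
  proof -
    have "(\<lambda>x. norm (indicat_real K x *\<^sub>R gr v x) powr p * w x) = (\<lambda>x. indicator K x * (norm (gr v x) powr p * w x))"
      by (auto simp: indicator_def fun_eq_iff)
    then show ?thesis using sol_integrable_p[OF v KM(1,2)] by simp
  qed
  note i\<phi> = Cc1_integrable_p(1)[OF \<phi>]
  have mS: "(\<lambda>x. indicat_real K x *\<^sub>R S x) \<in> borel_measurable lebesgue"
    using has_weak_gradientD(2)[OF open_\<Omega> wT KM(1,2)] by simp
  have "integrable lebesgue (\<lambda>x. norm (indicat_real K x *\<^sub>R S x) powr p * w x)"
  proof (rule integrable_powr_dominated(1)[OF mS _ i\<phi> iv])
    have "norm (indicat_real K x *\<^sub>R S x) \<le> norm (grad \<phi> x) + norm (indicat_real K x *\<^sub>R gr v x)" for x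
    proof -
      have "norm (S x) \<le> 1 * norm (grad \<phi> x - gr v x)"
        unfolding S_def norm_scaleR d_def by (intro mult_right_mono abs_dG_le_1) simp
      then have "norm (S x) \<le> norm (grad \<phi> x) + norm (gr v x)"
        using norm_triangle_ineq4[of "grad \<phi> x" "gr v x"] by linarith
      then show ?thesis by (auto simp: indicator_def)
    qed
    then show "AE x in lebesgue. norm (indicat_real K x *\<^sub>R S x) \<le> norm (grad \<phi> x) + norm (indicat_real K x *\<^sub>R gr v x)" by simp
  qed
  moreover have "(\<lambda>x. norm (indicat_real K x *\<^sub>R S x) powr p * w x) = (\<lambda>x. indicator K x * (norm (S x) powr p * w x))"
    by (auto simp: indicator_def fun_eq_iff)
  ultimately have Sp: "integrable lebesgue (\<lambda>x. indicator K x * (norm (S x) powr p * w x))" by metis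
  note test = sol_test[OF v wT KM(1,2) supp bdd Sp]
  define X where "X x = indicator K x * (d x * (norm (gr v x) powr p * w x))" for x
  define c where "c = (1 / 2 :: real) powr (1 - p)"
  have c0: "0 \<le> c" by (simp add: c_def)
  have md: "(\<lambda>x. indicator K x * d x) \<in> borel_measurable lebesgue"
  proof -
    have m1: "(\<lambda>x. indicat_real K x * v x) \<in> borel_measurable lebesgue"
      using has_weak_gradientD(1)[OF open_\<Omega> sol_weak_gradient[OF v] KM(1,2)] by simp
    have m2: "\<phi> \<in> borel_measurable lebesgue"
      using KM(8) by (intro borel_measurable_lebesgue_compose borel_measurable_continuous_onI)
    have m3: "indicat_real K \<in> borel_measurable lebesgue"
      using sets_lebesgue_compact[OF KM(1)] by simp
    have "(\<lambda>x. indicat_real K x * dG (\<phi> x - indicat_real K x * v x)) \<in> borel_measurable lebesgue"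
      by (rule borel_measurable_times[OF m3 measurable_compose[OF borel_measurable_diff[OF m2 m1]
          borel_measurable_continuous_onI[OF continuous_on_dG]]])
    moreover have "(\<lambda>x. indicat_real K x * dG (\<phi> x - indicat_real K x * v x)) = (\<lambda>x. indicator K x * d x)"
      by (auto simp: d_def indicator_def fun_eq_iff)
    ultimately show ?thesis by metis
  qed
  have iX: "integrable lebesgue X"
  proof -
    have "integrable lebesgue (\<lambda>x. (indicator K x * d x) *\<^sub>R (norm (indicat_real K x *\<^sub>R gr v x) powr p * w x))"
      using abs_dG_le_1 by (intro integrable_mult_bounded[OF iv md, of 1]) (auto simp: d_def indicator_def)
    moreover have "(\<lambda>x. (indicator K x * d x) *\<^sub>R (norm (indicat_real K x *\<^sub>R gr v x) powr p * w x)) = X"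
      by (auto simp: X_def indicator_def fun_eq_iff)
    ultimately show ?thesis by metis
  qed
  have "0 \<le> (LINT x|lebesgue. indicator K x * (f x / v x powr \<delta> * T x))"
    using rhs_nonneg by (intro integral_nonneg_AE, eventually_elim) (use KM(2) in \<open>auto simp: T_def G_nonneg indicator_def\<close>)
  also have "\<dots> = (LINT x|lebesgue. indicator K x * (F x (gr v x) \<bullet> S x))" using test(3) by simp
  also have "\<dots> \<le> (LINT x|lebesgue. (- 1 / 2) * X x + c * (norm (grad \<phi> x) powr p * w x))"
  proof (rule integral_mono_AE[OF test(1)])
    show "integrable lebesgue (\<lambda>x. (- 1 / 2) * X x + c * (norm (grad \<phi> x) powr p * w x))"
      using iX i\<phi> by (intro Bochner_Integration.integrable_add integrable_mult_right)
    show "AE x in lebesgue. indicator K x * (F x (gr v x) \<bullet> S x) \<le> (- 1 / 2) * X x + c * (norm (grad \<phi> x) powr p * w x)"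
      using w_pos
    proof eventually_elim
      case (elim x)
      show ?case
      proof (cases "x \<in> K")
        case True
        have d01: "0 \<le> d x" "d x \<le> 1" using dG_nonneg dG_le_1 by (auto simp: d_def)
        have "F x (gr v x) \<bullet> grad \<phi> x \<le> norm (F x (gr v x)) * norm (grad \<phi> x)" by (rule norm_cauchy_schwarz)
        also have "\<dots> = norm (gr v x) powr (p - 1) * norm (grad \<phi> x) * w x" using elim by (simp add: norm_F)
        \<comment> \<open>Young with parameter 1/2 lets half of the energy of v be absorbed; this is
          the origin of the factor \<open>2 * (1 / 2) powr (1 - p)\<close>.\<close>
        also have "\<dots> \<le> (1 / 2 * norm (gr v x) powr p + c * norm (grad \<phi> x) powr p) * w x"
          unfolding c_def using elim by (intro mult_right_mono young_powr[OF p]) auto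
        finally have 1: "F x (gr v x) \<bullet> grad \<phi> x \<le> 1 / 2 * (norm (gr v x) powr p * w x) + c * (norm (grad \<phi> x) powr p * w x)"
          by (simp add: algebra_simps)
        have "F x (gr v x) \<bullet> S x = d x * (F x (gr v x) \<bullet> grad \<phi> x - norm (gr v x) powr p * w x)"
          using elim by (simp add: S_def inner_diff_right F_inner_self)
        also have "\<dots> \<le> d x * (c * (norm (grad \<phi> x) powr p * w x) - 1 / 2 * (norm (gr v x) powr p * w x))"
          using 1 d01 by (intro mult_left_mono) auto
        also have "\<dots> = (- 1 / 2) * X x + d x * (c * (norm (grad \<phi> x) powr p * w x))"
          using True by (simp add: X_def algebra_simps)
        also have "\<dots> \<le> (- 1 / 2) * X x + 1 * (c * (norm (grad \<phi> x) powr p * w x))"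
          using d01 elim c0 by (intro add_left_mono mult_right_mono) auto
        finally show ?thesis using True by simp
      qed (use KM(4) in \<open>simp add: X_def\<close>)
    qed
  qed
  also have "\<dots> = (- 1 / 2) * (LINT x|lebesgue. X x) + c * (energy p w (grad \<phi>))"
    using iX i\<phi> by simp
  finally have XX: "(LINT x|lebesgue. X x) \<le> 2 * c * (energy p w (grad \<phi>))" by simp
  have "(\<integral>\<^sup>+x. ennreal (indicator \<Omega> x * (dG (\<phi> x - v x) * (norm (gr v x) powr p * w x))) \<partial>lebesgue) = (\<integral>\<^sup>+x. ennreal (X x) \<partial>lebesgue)"
    using vp by (intro nn_integral_cong_AE, eventually_elim)
      (use KM(2,3) in \<open>auto simp: X_def d_def indicator_def dG_eq_0\<close>)
  also have "\<dots> = ennreal (LINT x|lebesgue. X x)"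
    using w_pos by (intro nn_integral_eq_integral iX, eventually_elim) (simp add: X_def d_def dG_nonneg)
  also have "\<dots> \<le> ennreal (2 * c * (energy p w (grad \<phi>)))"
    by (rule ennreal_leI[OF XX])
  finally show ?thesis by (simp only: c_def)
qed

text \<open>Unpacks the boundary condition into what the limits use: compactly supported functions
  with a uniform energy bound that converge almost everywhere to u^\<alpha>. The energy bound takes
  the place of convergence of the gradients.\<close>

lemma boundary_sequence:
  assumes u: "sol u"
  obtains \<alpha> \<phi> B where "1 \<le> \<alpha>" "\<And>n::nat. \<phi> n \<in> Cc1 \<Omega>"
    "\<And>n. (energy p w (grad (\<phi> n))) \<le> B"
    "AE x in lebesgue. x \<in> \<Omega> \<longrightarrow> (\<lambda>n. \<phi> n x) \<longlonglongrightarrow> u x powr \<alpha>"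
proof -
  obtain \<alpha> where \<alpha>: "1 \<le> \<alpha>" "(\<lambda>x. u x powr \<alpha>) \<in> W1p_0 p \<Omega> w"
    using u unfolding weak_solution_def by blast
  define U where "U x = u x powr \<alpha>" for x
  have U: "U \<in> W1p p \<Omega> w" "\<And>\<epsilon>. 0 < \<epsilon> \<Longrightarrow> \<exists>\<phi>\<in>Ccinf \<Omega> \<inter> W1p p \<Omega> w. W1p_norm p \<Omega> w (\<lambda>x. U x - \<phi> x) < \<epsilon>"
    using \<alpha>(2) unfolding W1p_0_def mem_Collect_eq U_def[abs_def] by blast+
  have "\<forall>n. \<exists>\<phi>. \<phi> \<in> Ccinf \<Omega> \<inter> W1p p \<Omega> w \<and> W1p_norm p \<Omega> w (\<lambda>x. U x - \<phi> x) < 1 / real (Suc n)"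
    using U(2) by (metis of_nat_0_less_iff zero_less_Suc zero_less_divide_1_iff)
  then obtain \<psi> where \<psi>: "\<And>n. \<psi> n \<in> Ccinf \<Omega>" "\<And>n. \<psi> n \<in> W1p p \<Omega> w"
    "\<And>n. W1p_norm p \<Omega> w (\<lambda>x. U x - \<psi> n x) < 1 / real (Suc n)"
    by (metis IntD1 IntD2)
  have \<psi>c: "\<psi> n \<in> Cc1 \<Omega>" for n using subsetD[OF Ccinf_subset_Cc1 \<psi>(1)] .
  have \<psi>1: "Ck_on 1 UNIV (\<psi> n)" for n using \<psi>c[of n] unfolding Cc1_def mem_Collect_eq by (rule conjunct1)
  have lo: "integrable (lebesgue_on \<Omega>) h \<longleftrightarrow> integrable lebesgue (\<lambda>x. indicator \<Omega> x * h x)" for h :: "'a \<Rightarrow> real"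
    using integrable_lebesgue_on_iff[OF sets_\<Omega>, of h] by simp
  have lo': "(LINT x|lebesgue_on \<Omega>. h x) = (LINT x|lebesgue. indicator \<Omega> x * h x)" for h :: "'a \<Rightarrow> real"
    using integral_lebesgue_on_eq[OF sets_\<Omega>, of h] by simp
  have ip: "indicator \<Omega> x * (norm z powr p * w x) = norm (indicat_real \<Omega> x *\<^sub>R z) powr p * w x" for x and z :: "'c::euclidean_space"
    by (auto simp: indicator_def)
  have wU: "has_weak_gradient \<Omega> U (gr U)"
    using U(1) unfolding W1p_def weakly_differentiable_def mem_Collect_eq by (metis weak_grad_works)
  have wD0: "has_weak_gradient \<Omega> (\<lambda>x. U x - \<psi> n x) (\<lambda>x. gr U x - grad (\<psi> n) x)" for n
    using has_weak_gradient_linear[OF open_\<Omega> wU has_weak_gradient_C1[OF open_\<Omega> \<psi>1[of n]], of 1 "-1"] by simp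
  have wD: "has_weak_gradient \<Omega> (\<lambda>x. U x - \<psi> n x) (gr (\<lambda>x. U x - \<psi> n x))" for n
    by (rule weak_grad_works[OF wD0])
  \<comment> \<open>The norm involves the gradient chosen for the difference; uniqueness identifies
    it with the difference of the gradients.\<close>
  have grD: "AE x in lebesgue. x \<in> \<Omega> \<longrightarrow> gr (\<lambda>x. U x - \<psi> n x) x = gr U x - grad (\<psi> n) x" for n
    by (rule weak_gradient_unique[OF open_\<Omega> wD wD0])
  let ?D = "\<lambda>n x. indicat_real \<Omega> x *\<^sub>R gr (\<lambda>x. U x - \<psi> n x) x"
  let ?gU = "\<lambda>x. indicat_real \<Omega> x *\<^sub>R gr U x"
  have \<psi>off: "grad (\<psi> n) x = 0" if "x \<notin> \<Omega>" for n x
  proof -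
    obtain K M where "support_bound \<Omega> K M (\<psi> n)"
      by (rule Cc1D[OF \<psi>c])
    note KM = support_boundD[OF this]
    show ?thesis by (rule KM(4)) (use that KM(2) in blast)
  qed
  have igU: "finite_energy p w ?gU"
    using U(1) unfolding W1p_def mem_Collect_eq lo ip by blast
  note i\<psi> = Cc1_integrable_p(1)[OF \<psi>c]
  \<comment> \<open>A small \<open>W1p_norm\<close> says nothing about a non-integrable function,
    whose Bochner integral is 0 by convention. Integrability of the differences is therefore proved
    independently of the norm.\<close>
  have iD: "finite_energy p w (?D n)" for n
  proof (rule integrable_powr_dominated(1)[OF gr_measurable_\<Omega>(1)[OF wD] _ igU i\<psi>])
    show "AE x in lebesgue. norm (?D n x) \<le> norm (?gU x) + norm (grad (\<psi> n) x)"
      using grD[of n] by eventually_elim (auto simp: indicator_def norm_triangle_ineq4)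
  qed
  have norm_parts: "(LINT x|lebesgue. norm (indicat_real \<Omega> x *\<^sub>R (U x - \<psi> n x)) powr p * w x) powr (1 / p) < 1 / real (Suc n)"
    "(energy p w (?D n)) powr (1 / p) < 1 / real (Suc n)" for n
  proof -
    have "(LINT x|lebesgue. norm (indicat_real \<Omega> x *\<^sub>R (U x - \<psi> n x)) powr p * w x) powr (1 / p) +
      (energy p w (?D n)) powr (1 / p) < 1 / real (Suc n)"
      using \<psi>(3)[of n] unfolding W1p_norm_def lo' real_norm_def[symmetric] ip .
    then show "(LINT x|lebesgue. norm (indicat_real \<Omega> x *\<^sub>R (U x - \<psi> n x)) powr p * w x) powr (1 / p) < 1 / real (Suc n)"
    "(energy p w (?D n)) powr (1 / p) < 1 / real (Suc n)"
      by (smt (verit) powr_ge_zero)+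
  qed
  have nn: "0 \<le> (energy p w h)" for h :: "'a \<Rightarrow> 'c::euclidean_space"
    using w_pos by (intro integral_nonneg_AE) (auto elim!: eventually_mono)
  have root: "y \<le> z powr p" if "y powr (1 / p) < z" "0 \<le> y" for y z :: real
  proof -
    have "(y powr (1 / p)) powr p \<le> z powr p" using that p by (intro powr_mono2) auto
    then show ?thesis using that p by (simp add: powr_powr)
  qed
  define B where "B = 2 powr p * ((energy p w ?gU) + 1)"
  have bound: "(energy p w (grad (\<psi> n))) \<le> B" for n
  proof -
    have "(energy p w (grad (\<psi> n))) \<le>
      2 powr p * ((energy p w ?gU) + (energy p w (?D n)))"
    proof (rule integrable_powr_dominated(2)[OF Cc1_integrable_p(2)[OF \<psi>c] _ igU iD])
      show "AE x in lebesgue. norm (grad (\<psi> n) x) \<le> norm (?gU x) + norm (?D n x)"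
        using grD[of n]
      proof eventually_elim
        case (elim x)
        show ?case
        proof (cases "x \<in> \<Omega>")
          case True
          then have "grad (\<psi> n) x = ?gU x - ?D n x" using elim by simp
          then show ?thesis using norm_triangle_ineq4[of "?gU x" "?D n x"] by simp
        qed (simp add: \<psi>off)
      qed
    qed
    also have "\<dots> \<le> B"
    proof -
      have "(energy p w (?D n)) \<le> (1 / real (Suc n)) powr p"
        by (rule root[OF norm_parts(2) nn])
      also have "\<dots> \<le> 1 powr p" using p by (intro powr_mono2) auto
      finally show ?thesis unfolding B_def by (intro mult_left_mono add_left_mono) auto
    qed
    finally show ?thesis .
  qed
  let ?y = "\<lambda>n x. norm (indicat_real \<Omega> x *\<^sub>R (U x - \<psi> n x)) powr p * w x"
  have iy: "integrable lebesgue (?y n)" for n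
  proof -
    have "integrable lebesgue (\<lambda>x. norm (indicat_real \<Omega> x *\<^sub>R U x) powr p * w x)"
      using U(1) unfolding W1p_def mem_Collect_eq lo real_norm_def[symmetric] ip by blast
    moreover have "integrable lebesgue (\<lambda>x. norm (indicat_real \<Omega> x *\<^sub>R \<psi> n x) powr p * w x)"
      using \<psi>(2)[of n] unfolding W1p_def mem_Collect_eq lo real_norm_def[symmetric] ip by blast
    ultimately show ?thesis
    proof (rule integrable_powr_dominated(1)[rotated 2])
      show "(\<lambda>x. indicat_real \<Omega> x *\<^sub>R (U x - \<psi> n x)) \<in> borel_measurable lebesgue"
        using gr_measurable_\<Omega>(2)[OF wD[of n]] by simp
      show "AE x in lebesgue. norm (indicat_real \<Omega> x *\<^sub>R (U x - \<psi> n x)) \<le> norm (indicat_real \<Omega> x *\<^sub>R U x) + norm (indicat_real \<Omega> x *\<^sub>R \<psi> n x)"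
        by (intro AE_I2) (auto simp: indicator_def)
    qed
  qed
  \<comment> \<open>The weighted p-th powers converge in L1, so a subsequence converges almost
    everywhere; dividing by w > 0 and taking roots gives convergence of the functions.\<close>
  have "(\<lambda>n. LINT x|lebesgue. norm (?y n x)) \<longlonglongrightarrow> 0"
  proof (rule tendsto_sandwich[OF always_eventually always_eventually tendsto_const, rule_format])
    show "0 \<le> (LINT x|lebesgue. norm (?y n x))" for n by simp
    show "(LINT x|lebesgue. norm (?y n x)) \<le> (1 / real (Suc n)) powr p" for n
    proof -
      have "(LINT x|lebesgue. norm (?y n x)) = (LINT x|lebesgue. ?y n x)"
        by (rule integral_cong_AE) (use iy[of n] w_pos in \<open>auto elim!: eventually_mono\<close>)
      also have "\<dots> \<le> (1 / real (Suc n)) powr p" by (rule root[OF norm_parts(1) nn])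
      finally show ?thesis .
    qed
    show "(\<lambda>n. (1 / real (Suc n)) powr p) \<longlonglongrightarrow> 0"
      using LIMSEQ_Suc[OF lim_const_over_n, of 1] p by (intro tendsto_zero_powrI[where b=p]) auto
  qed
  then obtain q where q: "strict_mono q" "AE x in lebesgue. (\<lambda>n. ?y (q n) x) \<longlonglongrightarrow> 0"
    using tendsto_L1_AE_subseq[of lebesgue ?y] iy by auto
  show ?thesis
  proof (rule that[of \<alpha> "\<lambda>n. \<psi> (q n)" B])
    show "AE x in lebesgue. x \<in> \<Omega> \<longrightarrow> (\<lambda>n. \<psi> (q n) x) \<longlonglongrightarrow> u x powr \<alpha>"
      using q(2) w_pos
    proof eventually_elim
      case (elim x)
      show ?case
      proof
        assume x: "x \<in> \<Omega>"
        have "(\<lambda>n. \<bar>U x - \<psi> (q n) x\<bar> powr p * w x * (1 / w x)) \<longlonglongrightarrow> 0 * (1 / w x)"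
          using elim x by (intro tendsto_mult tendsto_const) simp
        then have "(\<lambda>n. \<bar>U x - \<psi> (q n) x\<bar> powr p) \<longlonglongrightarrow> 0" using elim by simp
        then have "(\<lambda>n. (\<bar>U x - \<psi> (q n) x\<bar> powr p) powr (1 / p)) \<longlonglongrightarrow> 0"
          using p by (intro tendsto_zero_powrI[where f="\<lambda>n. \<bar>U x - \<psi> (q n) x\<bar> powr p" and g="\<lambda>_. 1 / p" and b="1 / p"]) auto
        then have "(\<lambda>n. \<bar>U x - \<psi> (q n) x\<bar>) \<longlonglongrightarrow> 0"
          using p by (simp add: powr_powr)
        then have "(\<lambda>n. U x - \<psi> (q n) x) \<longlonglongrightarrow> 0" by (simp add: tendsto_rabs_zero_iff)
        from tendsto_diff[OF tendsto_const[of "U x"] this]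
        show "(\<lambda>n. \<psi> (q n) x) \<longlonglongrightarrow> u x powr \<alpha>" by (simp add: U_def)
      qed
    qed
  qed (use \<alpha>(1) \<psi>c bound in auto)
qed

end

section \<open>Comparison of two solutions\<close>

text \<open>Above the level \<epsilon> a power with exponent \<alpha> \<ge> 1 dominates a linear
  function; near 0 this fails for \<alpha> > 1, which is why the comparison is first made for u > v
  + \<epsilon>.\<close>

lemma powr_ge_linear:
  fixes u \<epsilon> \<alpha> :: real
  assumes "0 < \<epsilon>" "\<epsilon> < u" "1 \<le> \<alpha>"
  shows "\<epsilon> powr (\<alpha> - 1) * u \<le> u powr \<alpha>" "\<epsilon> powr \<alpha> \<le> u powr \<alpha>"
proof -
  have "\<epsilon> powr (\<alpha> - 1) * u \<le> u powr (\<alpha> - 1) * u"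
    using assms by (intro mult_right_mono powr_mono2) auto
  also have "\<dots> = u powr \<alpha>" using powr_mult_base[of u "\<alpha> - 1"] assms by (simp add: mult.commute)
  finally show "\<epsilon> powr (\<alpha> - 1) * u \<le> u powr \<alpha>" .
  show "\<epsilon> powr \<alpha> \<le> u powr \<alpha>" using assms by (intro powr_mono2) auto
qed

context weighted_problem
begin

text \<open>The energy bound below \<open>c * \<phi> n x\<close> passes to the limit by Fatou and
  then concerns the set below c u^\<alpha>. With c = 2 / \<epsilon>^(\<alpha>-1) that function is at
  least 2 u where u > \<epsilon>, so on the stated set the factor \<open>dG\<close> is at least
  \<open>dG \<epsilon>\<close>. The factor 2 allows v to be u itself: then v < 2 u - \<epsilon> just
  says u > \<epsilon>.\<close>

lemma energy_near_boundary:
  assumes u: "sol u" and v: "sol v" and \<epsilon>: "0 < \<epsilon>"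
    and \<alpha>: "1 \<le> \<alpha>" and \<phi>: "\<And>n::nat. \<phi> n \<in> Cc1 \<Omega>"
    and B: "\<And>n. (energy p w (grad (\<phi> n))) \<le> B"
    and lim: "AE x in lebesgue. x \<in> \<Omega> \<longrightarrow> (\<lambda>n. \<phi> n x) \<longlonglongrightarrow> u x powr \<alpha>"
  shows "integrable lebesgue (\<lambda>x. indicator {x \<in> \<Omega>. \<epsilon> < u x \<and> v x < 2 * u x - \<epsilon>} x * (norm (gr v x) powr p * w x))"
proof -
  let ?E = "{x \<in> \<Omega>. \<epsilon> < u x \<and> v x < 2 * u x - \<epsilon>}"
  define c where "c = 2 / \<epsilon> powr (\<alpha> - 1)"
  have c0: "0 < c" using \<epsilon> by (simp add: c_def)
  have cu: "2 * u x \<le> c * u x powr \<alpha>" if "\<epsilon> < u x" for x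
    using powr_ge_linear(1)[OF \<epsilon> that \<alpha>] \<epsilon> by (simp add: c_def field_simps)
  have c\<phi>: "(\<lambda>x. c * \<phi> n x) \<in> Cc1 \<Omega>" and gc: "grad (\<lambda>x. c * \<phi> n x) x = c *\<^sub>R grad (\<phi> n) x" for n x
  proof -
    have C: "Ck_on 1 UNIV (\<lambda>x::'a. c)" by (rule Ck_on_const)
    have "grad (\<lambda>x::'a. c) x = 0" by (rule grad_eqI) simp
    then show "(\<lambda>x. c * \<phi> n x) \<in> Cc1 \<Omega>" "grad (\<lambda>x. c * \<phi> n x) x = c *\<^sub>R grad (\<phi> n) x"
      using Cc1_mult[OF C \<phi>, of n] by simp_all
  qed
  define Bc where "Bc = 2 * (1 / 2) powr (1 - p) * (c powr p * B)"
  have e: "(\<integral>\<^sup>+x. ennreal (indicator \<Omega> x * (dG (c * \<phi> n x - v x) * (norm (gr v x) powr p * w x))) \<partial>lebesgue) \<le> ennreal Bc" for n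
  proof -
    have "(LINT x|lebesgue. norm (grad (\<lambda>x. c * \<phi> n x) x) powr p * w x) = (LINT x|lebesgue. c powr p * (norm (grad (\<phi> n) x) powr p * w x))"
    proof (intro Bochner_Integration.integral_cong refl)
      fix x
      have "norm (grad (\<lambda>x. c * \<phi> n x) x) powr p = c powr p * norm (grad (\<phi> n) x) powr p"
        unfolding gc norm_scaleR using c0 powr_mult[of c "norm (grad (\<phi> n) x)" p] by simp
      then show "norm (grad (\<lambda>x. c * \<phi> n x) x) powr p * w x = c powr p * (norm (grad (\<phi> n) x) powr p * w x)" by simp
    qed
    also have "\<dots> \<le> c powr p * B" using B[of n] by (simp add: mult_left_mono)
    finally have "2 * (1 / 2) powr (1 - p) * (LINT x|lebesgue. norm (grad (\<lambda>x. c * \<phi> n x) x) powr p * w x) \<le> Bc"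
      unfolding Bc_def by (intro mult_left_mono) auto
    then show ?thesis
      by (rule order_trans[OF energy_below_test_function[OF v c\<phi>] ennreal_leI])
  qed
  note mv = gr_measurable_\<Omega>[OF sol_weak_gradient[OF v]] and mu = gr_measurable_\<Omega>[OF sol_weak_gradient[OF u]]
  have m\<Omega>: "indicat_real \<Omega> \<in> borel_measurable lebesgue" using sets_\<Omega> by simp
  have mp: "(\<lambda>x. norm (indicat_real \<Omega> x *\<^sub>R gr v x) powr p * w x) \<in> borel_measurable lebesgue"
    using w_measurable mv(1) by (intro borel_measurable_times powr_real_measurable measurable_compose[OF _ borel_measurable_norm] borel_measurable_const)
  have mdG: "dG \<in> borel_measurable borel" by (rule borel_measurable_continuous_onI[OF continuous_on_dG])
  have mE: "indicat_real ?E \<in> borel_measurable lebesgue"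
  proof -
    let ?u = "\<lambda>x. indicat_real \<Omega> x * u x" and ?v = "\<lambda>x. indicat_real \<Omega> x * v x"
    have 1: "{x \<in> space lebesgue. \<epsilon> < ?u x} \<in> sets lebesgue"
      by (rule borel_measurable_less[OF borel_measurable_const mu(2)])
    have 2: "{x \<in> space lebesgue. ?v x < 2 * ?u x - \<epsilon>} \<in> sets lebesgue"
      by (rule borel_measurable_less[OF mv(2) borel_measurable_diff[OF borel_measurable_times[OF borel_measurable_const mu(2)] borel_measurable_const]])
    have "?E = \<Omega> \<inter> ({x \<in> space lebesgue. \<epsilon> < ?u x} \<inter> {x \<in> space lebesgue. ?v x < 2 * ?u x - \<epsilon>})" by auto
    then have "?E \<in> sets lebesgue" using sets.Int[OF sets_\<Omega> sets.Int[OF 1 2]] by (simp only:)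
    then show ?thesis by (rule borel_measurable_indicator)
  qed
  have fin: "(\<integral>\<^sup>+x. ennreal (indicator \<Omega> x * (dG (c * u x powr \<alpha> - v x) * (norm (gr v x) powr p * w x))) \<partial>lebesgue) \<le> ennreal Bc"
  proof (rule nn_integral_le_lim)
    fix n
    have m\<phi>: "\<phi> n \<in> borel_measurable lebesgue" using Cc1_integrable(1)[OF \<phi>] by simp
    have "(\<lambda>x. indicat_real \<Omega> x * dG (c * \<phi> n x - indicat_real \<Omega> x * v x) * (norm (indicat_real \<Omega> x *\<^sub>R gr v x) powr p * w x)) \<in> borel_measurable lebesgue"
      by (intro borel_measurable_times[OF borel_measurable_times[OF m\<Omega> measurable_compose[OF _ mdG]] mp]
          borel_measurable_diff borel_measurable_times[OF borel_measurable_const m\<phi>] mv(2))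
    moreover have "(\<lambda>x. indicat_real \<Omega> x * dG (c * \<phi> n x - indicat_real \<Omega> x * v x) * (norm (indicat_real \<Omega> x *\<^sub>R gr v x) powr p * w x))
      = (\<lambda>x. indicator \<Omega> x * (dG (c * \<phi> n x - v x) * (norm (gr v x) powr p * w x)))"
      by (auto simp: indicator_def fun_eq_iff)
    ultimately show "(\<lambda>x. indicator \<Omega> x * (dG (c * \<phi> n x - v x) * (norm (gr v x) powr p * w x))) \<in> borel_measurable lebesgue" by metis
  next
    show "AE x in lebesgue. (\<lambda>n. indicator \<Omega> x * (dG (c * \<phi> n x - v x) * (norm (gr v x) powr p * w x))) \<longlonglongrightarrow> indicator \<Omega> x * (dG (c * u x powr \<alpha> - v x) * (norm (gr v x) powr p * w x))"
      using lim
    proof eventually_elim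
      case (elim x)
      show ?case
      proof (cases "x \<in> \<Omega>")
        case True
        then have "(\<lambda>n. c * \<phi> n x - v x) \<longlonglongrightarrow> c * u x powr \<alpha> - v x" using elim by (intro tendsto_intros) auto
        then have "(\<lambda>n. dG (c * \<phi> n x - v x)) \<longlonglongrightarrow> dG (c * u x powr \<alpha> - v x)"
          by (intro continuous_on_tendsto_compose[OF continuous_on_dG]) auto
        then show ?thesis by (intro tendsto_mult tendsto_const)
      qed simp
    qed
  qed (rule e)
  have "(\<integral>\<^sup>+x. ennreal (indicator ?E x * (dG \<epsilon> * (norm (gr v x) powr p * w x))) \<partial>lebesgue) \<le> ennreal Bc"
  proof (rule order_trans[OF nn_integral_mono_AE fin])
    show "AE x in lebesgue. ennreal (indicator ?E x * (dG \<epsilon> * (norm (gr v x) powr p * w x))) \<le>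
      ennreal (indicator \<Omega> x * (dG (c * u x powr \<alpha> - v x) * (norm (gr v x) powr p * w x)))"
      using w_pos
    proof eventually_elim
      case (elim x)
      show ?case
      proof (cases "x \<in> ?E")
        case True
        then have "\<epsilon> \<le> c * u x powr \<alpha> - v x" using cu[of x] by auto
        then have "dG \<epsilon> \<le> dG (c * u x powr \<alpha> - v x)" by (rule dG_mono)
        then have "dG \<epsilon> * (norm (gr v x) powr p * w x) \<le> dG (c * u x powr \<alpha> - v x) * (norm (gr v x) powr p * w x)"
          using elim by (intro mult_right_mono) auto
        then show ?thesis using True by (auto intro: ennreal_leI)
      qed simp
    qed
  qed
  then have fin2: "(\<integral>\<^sup>+x. ennreal (indicator ?E x * (dG \<epsilon> * (norm (gr v x) powr p * w x))) \<partial>lebesgue) < \<infinity>"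
    by (rule le_less_trans) simp
  have "integrable lebesgue (\<lambda>x. indicator ?E x * (dG \<epsilon> * (norm (gr v x) powr p * w x)))"
  proof (rule integrableI_nonneg[OF _ _ fin2])
    have "(\<lambda>x. indicat_real ?E x * (dG \<epsilon> * (norm (indicat_real \<Omega> x *\<^sub>R gr v x) powr p * w x))) \<in> borel_measurable lebesgue"
      by (rule borel_measurable_times[OF mE borel_measurable_times[OF borel_measurable_const mp]])
    moreover have "(\<lambda>x. indicat_real ?E x * (dG \<epsilon> * (norm (indicat_real \<Omega> x *\<^sub>R gr v x) powr p * w x))) = (\<lambda>x. indicator ?E x * (dG \<epsilon> * (norm (gr v x) powr p * w x)))"
      by (auto simp: indicator_def fun_eq_iff)
    ultimately show "(\<lambda>x. indicator ?E x * (dG \<epsilon> * (norm (gr v x) powr p * w x))) \<in> borel_measurable lebesgue" by metis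
    show "AE x in lebesgue. 0 \<le> indicator ?E x * (dG \<epsilon> * (norm (gr v x) powr p * w x))"
      using w_pos by eventually_elim (simp add: dG_nonneg)
  qed
  from integrable_mult_right[OF this, of "1 / dG \<epsilon>"]
  have "integrable lebesgue (\<lambda>x. 1 / dG \<epsilon> * (indicator ?E x * (dG \<epsilon> * (norm (gr v x) powr p * w x))))" .
  moreover have "(\<lambda>x. 1 / dG \<epsilon> * (indicator ?E x * (dG \<epsilon> * (norm (gr v x) powr p * w x)))) = (\<lambda>x. indicator ?E x * (norm (gr v x) powr p * w x))"
    using dG_pos[OF \<epsilon>] by (auto simp: fun_eq_iff)
  ultimately show ?thesis by metis
qed

lemma powr_minus_antimono: "0 < b \<Longrightarrow> b \<le> a \<Longrightarrow> 0 \<le> c \<Longrightarrow> c / a powr \<delta> \<le> c / b powr \<delta>"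
  using \<delta> by (intro divide_left_mono powr_mono2) auto

text \<open>Test both equations with \<open>G b - G (b - a)\<close>, a smooth version of
  \<open>min a b\<^sup>+\<close> for \<open>a \<ge> 0\<close>, where \<open>b = u - v - \<epsilon>\<close> and \<open>a = C G(\<phi>)\<close>.\<close>

lemma comparison_step:
  assumes u: "sol u" and v: "sol v" and \<epsilon>: "0 < \<epsilon>" and C: "0 \<le> C" and \<phi>: "\<phi> \<in> Cc1 \<Omega>" and t: "0 < t"
    and iu: "integrable lebesgue (\<lambda>x. indicator {x \<in> \<Omega>. v x + \<epsilon> < u x} x * (norm (gr u x) powr p * w x))"
    and iv: "integrable lebesgue (\<lambda>x. indicator {x \<in> \<Omega>. v x + \<epsilon> < u x} x * (norm (gr v x) powr p * w x))"
  defines "b \<equiv> \<lambda>x. u x - v x - \<epsilon>" and "a \<equiv> \<lambda>x. C * G (\<phi> x)"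
    and "H \<equiv> \<lambda>x. indicator {x \<in> \<Omega>. v x + \<epsilon> < u x} x * ((norm (gr u x) powr p + norm (gr v x) powr p) * w x)"
    and "Dq \<equiv> \<lambda>x. (F x (gr u x) - F x (gr v x)) \<bullet> (gr u x - gr v x)"
  shows "(\<lambda>x. indicator \<Omega> x * ((dG (b x) - dG (b x - a x)) * Dq x)) \<in> borel_measurable lebesgue"
    and "(\<lambda>x. dG (b x - a x) * H x) \<in> borel_measurable lebesgue"
    and "(\<integral>\<^sup>+x. ennreal (indicator \<Omega> x * ((dG (b x) - dG (b x - a x)) * Dq x)) \<partial>lebesgue)
      \<le> ennreal (C * t * (LINT x|lebesgue. dG (b x - a x) * H x) + 2 * C * t powr (1 - p) * (energy p w (grad \<phi>)))"
proof -
  obtain K M where "support_bound \<Omega> K M \<phi>"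
    by (rule Cc1D[OF \<phi>])
  note KM = support_boundD[OF this]
  have \<phi>1: "Ck_on 1 UNIV \<phi>" using \<phi> unfolding Cc1_def mem_Collect_eq by (rule conjunct1)
  let ?E = "{x \<in> \<Omega>. v x + \<epsilon> < u x}"
  define q where "q x = gr u x - gr v x" for x
  define d where "d x = dG (b x - a x)" for x
  \<comment> \<open>The weak gradient of T by the chain rule. The factor d, the derivative of G at b
    - a, is what stands in front of the gradient of \<phi>; it vanishes once a exceeds b.\<close>
  define S where "S x = dG (b x) *\<^sub>R q x - d x *\<^sub>R (q x - (C * dG (\<phi> x)) *\<^sub>R grad \<phi> x)" for x
  define T where "T x = G (b x) - G (b x - a x)" for x
  have a0: "0 \<le> a x" for x using C G_nonneg by (simp add: a_def)
  have aM: "a x \<le> C * M" for x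
    using C G_le_max[of "\<phi> x"] KM(5)[of x] KM(7) unfolding a_def by (intro mult_left_mono) auto
  have aoff: "a x = 0" if "x \<notin> K" for x using KM(3)[OF that] by (simp add: a_def G_eq_0)
  have wb0: "has_weak_gradient \<Omega> (\<lambda>x. u x - v x) q"
    using has_weak_gradient_linear[OF open_\<Omega> sol_weak_gradient[OF u] sol_weak_gradient[OF v], of 1 "-1"]
    by (simp add: q_def[abs_def])
  have sh: "((\<lambda>t. G (t - \<epsilon>)) has_real_derivative dG (t - \<epsilon>)) (at t)" for t
  proof -
    have "((\<lambda>t. t - \<epsilon>) has_real_derivative 1) (at t)" by (auto intro!: derivative_eq_intros)
    from DERIV_chain2[OF G_has_derivative this] show ?thesis by simp
  qed
  have csh: "continuous_on UNIV (\<lambda>t. dG (t - \<epsilon>))"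
    by (rule continuous_on_compose2[OF continuous_on_dG]) (auto intro!: continuous_intros)
  have wGb: "has_weak_gradient \<Omega> (\<lambda>x. G (b x)) (\<lambda>x. dG (b x) *\<^sub>R q x)"
    using has_weak_gradient_chain[OF open_\<Omega> wb0 sh csh abs_dG_le_1] by (simp add: b_def)
  have wG\<phi>: "has_weak_gradient \<Omega> (\<lambda>x. G (\<phi> x)) (\<lambda>x. dG (\<phi> x) *\<^sub>R grad \<phi> x)"
    by (rule has_weak_gradient_chain[OF open_\<Omega> has_weak_gradient_C1[OF open_\<Omega> \<phi>1] G_has_derivative continuous_on_dG abs_dG_le_1])
  have wba: "has_weak_gradient \<Omega> (\<lambda>x. (u x - v x) - a x) (\<lambda>x. q x - (C * dG (\<phi> x)) *\<^sub>R grad \<phi> x)"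
    using has_weak_gradient_linear[OF open_\<Omega> wb0 wG\<phi>, of 1 "- C"] by (simp add: a_def)
  have wGba: "has_weak_gradient \<Omega> (\<lambda>x. G (b x - a x)) (\<lambda>x. d x *\<^sub>R (q x - (C * dG (\<phi> x)) *\<^sub>R grad \<phi> x))"
  proof -
    have eq: "u x - v x - a x - \<epsilon> = b x - a x" for x by (simp add: b_def)
    from has_weak_gradient_chain[OF open_\<Omega> wba sh csh abs_dG_le_1] show ?thesis
      by (simp only: eq d_def)
  qed
  have wT: "has_weak_gradient \<Omega> T S"
    using has_weak_gradient_linear[OF open_\<Omega> wGb wGba, of 1 "-1"] by (simp add: T_def[abs_def] S_def[abs_def])
  have offK: "T x = 0" "S x = 0" if "x \<notin> K" for x
    using aoff[OF that] KM(3,4)[OF that] by (simp_all add: T_def S_def d_def)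
  \<comment> \<open>G is monotone and 1-Lipschitz, so T lies between 0 and a. Thus a supplies the
    bound that \<open>sol_test\<close> asks for.\<close>
  have T01: "0 \<le> T x" "T x \<le> a x" for x
    using G_mono[of "b x - a x" "b x"] G_lipschitz[of "b x" "b x - a x"] a0[of x] by (auto simp: T_def)
  have TE: "T x = 0" if "b x \<le> 0" for x
    using that a0[of x] by (simp add: T_def G_eq_0)
  have supp: "AE x in lebesgue. x \<in> \<Omega> \<longrightarrow> x \<notin> K \<longrightarrow> T x = 0 \<and> S x = 0"
    using offK by (intro AE_I2) blast
  have bdd: "AE x in lebesgue. x \<in> \<Omega> \<longrightarrow> \<bar>T x\<bar> \<le> C * M"
  proof (intro AE_I2 impI)
    fix x show "\<bar>T x\<bar> \<le> C * M" using T01[of x] aM[of x] by linarith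
  qed
  have d01: "0 \<le> d x" "d x \<le> 1" "d x \<le> dG (b x)" for x
    using dG_nonneg dG_le_1 dG_mono[of "b x - a x" "b x"] a0[of x] by (auto simp: d_def)
  have ind: "(\<lambda>x. norm (indicat_real L x *\<^sub>R g x) powr p * w x) = (\<lambda>x. indicator L x * (norm (g x) powr p * w x))" for L :: "'a set" and g :: "'a \<Rightarrow> 'a"
    by (auto simp: indicator_def fun_eq_iff)
  have iuK: "integrable lebesgue (\<lambda>x. norm (indicat_real K x *\<^sub>R gr u x) powr p * w x)"
    and ivK: "integrable lebesgue (\<lambda>x. norm (indicat_real K x *\<^sub>R gr v x) powr p * w x)"
    unfolding ind by (rule sol_integrable_p[OF u KM(1,2)], rule sol_integrable_p[OF v KM(1,2)])
  note i\<phi> = Cc1_integrable_p(1)[OF \<phi>]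
  have iqK: "integrable lebesgue (\<lambda>x. norm (indicat_real K x *\<^sub>R q x) powr p * w x)"
  proof (rule integrable_powr_dominated(1)[OF _ _ iuK ivK])
    show "(\<lambda>x. indicat_real K x *\<^sub>R q x) \<in> borel_measurable lebesgue"
      using has_weak_gradientD(2)[OF open_\<Omega> wb0 KM(1,2)] by simp
    show "AE x in lebesgue. norm (indicat_real K x *\<^sub>R q x) \<le> norm (indicat_real K x *\<^sub>R gr u x) + norm (indicat_real K x *\<^sub>R gr v x)"
      by (intro AE_I2) (auto simp: q_def indicator_def norm_triangle_ineq4)
  qed
  have iC\<phi>: "integrable lebesgue (\<lambda>x. norm (C *\<^sub>R grad \<phi> x) powr p * w x)"
  proof -
    have "(\<lambda>x. norm (C *\<^sub>R grad \<phi> x) powr p * w x) = (\<lambda>x. C powr p * (norm (grad \<phi> x) powr p * w x))"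
      using C powr_mult[of C] by (auto simp: fun_eq_iff)
    then show ?thesis using i\<phi> by simp
  qed
  have "integrable lebesgue (\<lambda>x. norm (indicat_real K x *\<^sub>R S x) powr p * w x)"
  proof (rule integrable_powr_dominated(1)[OF _ _ iqK iC\<phi>])
    show "(\<lambda>x. indicat_real K x *\<^sub>R S x) \<in> borel_measurable lebesgue"
      using has_weak_gradientD(2)[OF open_\<Omega> wT KM(1,2)] by simp
    have "norm (S x) \<le> norm (q x) + norm (C *\<^sub>R grad \<phi> x)" for x
    proof -
      have "S x = (dG (b x) - d x) *\<^sub>R q x + (d x * dG (\<phi> x)) *\<^sub>R (C *\<^sub>R grad \<phi> x)"
        by (simp add: S_def algebra_simps)
      also have "norm \<dots> \<le> \<bar>dG (b x) - d x\<bar> * norm (q x) + \<bar>d x * dG (\<phi> x)\<bar> * norm (C *\<^sub>R grad \<phi> x)"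
        by (metis norm_scaleR norm_triangle_ineq)
      also have "\<dots> \<le> 1 * norm (q x) + 1 * norm (C *\<^sub>R grad \<phi> x)"
      proof (intro add_mono mult_right_mono)
        show "\<bar>dG (b x) - d x\<bar> \<le> 1" using d01[of x] dG_le_1[of "b x"] by linarith
        show "\<bar>d x * dG (\<phi> x)\<bar> \<le> 1"
          using d01[of x] dG_le_1[of "\<phi> x"] dG_nonneg[of "\<phi> x"] by (simp add: abs_mult mult_le_one)
      qed auto
      finally show ?thesis by simp
    qed
    then show "AE x in lebesgue. norm (indicat_real K x *\<^sub>R S x) \<le> norm (indicat_real K x *\<^sub>R q x) + norm (C *\<^sub>R grad \<phi> x)"
      by (intro AE_I2) (auto simp: indicator_def)
  qed
  then have Sp: "integrable lebesgue (\<lambda>x. indicator K x * (norm (S x) powr p * w x))" unfolding ind .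
  note tu = sol_test[OF u wT KM(1,2) supp bdd Sp] and tv = sol_test[OF v wT KM(1,2) supp bdd Sp]
  define D where "D x = F x (gr u x) - F x (gr v x)" for x
  have Dq: "Dq x = D x \<bullet> q x" for x by (simp add: Dq_def D_def q_def)
  have split: "indicator K x * (F x (gr u x) \<bullet> S x) - indicator K x * (F x (gr v x) \<bullet> S x) = indicator K x * (D x \<bullet> S x)" for x
    by (simp add: D_def inner_diff_left algebra_simps)
  have iDS: "integrable lebesgue (\<lambda>x. indicator K x * (D x \<bullet> S x))"
    using Bochner_Integration.integrable_diff[OF tu(1) tv(1)] by (simp only: split)
  \<comment> \<open>Subtracting the two equations: T vanishes unless u > v + \<epsilon>, and there f
    / u^\<delta> \<le> f / v^\<delta>. The singular terms thus enter with a favourable sign.\<close>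
  have DS0: "(LINT x|lebesgue. indicator K x * (D x \<bullet> S x)) \<le> 0"
  proof -
    have "(LINT x|lebesgue. indicator K x * (D x \<bullet> S x)) = (LINT x|lebesgue. indicator K x * (F x (gr u x) \<bullet> S x)) - (LINT x|lebesgue. indicator K x * (F x (gr v x) \<bullet> S x))"
      using Bochner_Integration.integral_diff[OF tu(1) tv(1)] by (simp only: split)
    also have "\<dots> = (LINT x|lebesgue. indicator K x * (f x / u x powr \<delta> * T x)) - (LINT x|lebesgue. indicator K x * (f x / v x powr \<delta> * T x))"
      by (simp only: tu(3) tv(3))
    also have "\<dots> \<le> 0"
    proof -
      have "(LINT x|lebesgue. indicator K x * (f x / u x powr \<delta> * T x)) \<le> (LINT x|lebesgue. indicator K x * (f x / v x powr \<delta> * T x))"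
      proof (rule integral_mono_AE[OF tu(2) tv(2)])
        show "AE x in lebesgue. indicator K x * (f x / u x powr \<delta> * T x) \<le> indicator K x * (f x / v x powr \<delta> * T x)"
          using rhs_nonneg sol_pos[OF v]
        proof eventually_elim
          case (elim x)
          show ?case
          proof (cases "x \<in> K \<and> 0 < b x")
            case True
            then have "f x / u x powr \<delta> \<le> f x / v x powr \<delta>"
              using elim KM(2) \<epsilon> by (intro powr_minus_antimono) (auto simp: b_def)
            from mult_right_mono[OF this T01(1)[of x]] show ?thesis using True by simp
          qed (use TE[of x] in auto)
        qed
      qed
      then show ?thesis by simp
    qed
    finally show ?thesis .
  qed
  have H0: "AE x in lebesgue. 0 \<le> H x" using w_pos by eventually_elim (simp add: H_def)
  have iH: "integrable lebesgue H"
    using Bochner_Integration.integrable_add[OF iu iv] by (simp add: H_def[abs_def] algebra_simps)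
  note mv = gr_measurable_\<Omega>[OF sol_weak_gradient[OF v]] and mu = gr_measurable_\<Omega>[OF sol_weak_gradient[OF u]]
  have m\<Omega>: "indicat_real \<Omega> \<in> borel_measurable lebesgue" using sets_\<Omega> by simp
  have mdG: "dG \<in> borel_measurable borel" by (rule borel_measurable_continuous_onI[OF continuous_on_dG])
  have mG: "G \<in> borel_measurable borel" by (rule borel_measurable_has_real_derivative[OF G_has_derivative])
  have ma: "a \<in> borel_measurable lebesgue"
    unfolding a_def using Cc1_integrable(1)[OF \<phi>]
    by (intro borel_measurable_times borel_measurable_const measurable_compose[OF _ mG]) simp
  define b' where "b' x = indicat_real \<Omega> x * u x - indicat_real \<Omega> x * v x - \<epsilon>" for x
  have mb': "b' \<in> borel_measurable lebesgue"
    unfolding b'_def[abs_def] by (intro borel_measurable_diff mu(2) mv(2) borel_measurable_const)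
  have bb': "b' x = b x" if "x \<in> \<Omega>" for x using that by (simp add: b_def b'_def)
  have md: "(\<lambda>x. dG (b' x - a x)) \<in> borel_measurable lebesgue" "(\<lambda>x. dG (b' x)) \<in> borel_measurable lebesgue"
    by (rule measurable_compose[OF borel_measurable_diff[OF mb' ma] mdG], rule measurable_compose[OF mb' mdG])
  show mDq: "(\<lambda>x. indicator \<Omega> x * ((dG (b x) - dG (b x - a x)) * Dq x)) \<in> borel_measurable lebesgue"
  proof -
    have "(\<lambda>x. indicat_real \<Omega> x * ((dG (b' x) - dG (b' x - a x)) *
      ((F x (indicat_real \<Omega> x *\<^sub>R gr u x) - F x (indicat_real \<Omega> x *\<^sub>R gr v x)) \<bullet> (indicat_real \<Omega> x *\<^sub>R gr u x - indicat_real \<Omega> x *\<^sub>R gr v x)))) \<in> borel_measurable lebesgue"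
      by (intro borel_measurable_times[OF m\<Omega>] borel_measurable_times[OF borel_measurable_diff[OF md(2,1)]] borel_measurable_inner
          borel_measurable_diff F_measurable mu(1) mv(1))
    moreover have "(\<lambda>x. indicat_real \<Omega> x * ((dG (b' x) - dG (b' x - a x)) *
      ((F x (indicat_real \<Omega> x *\<^sub>R gr u x) - F x (indicat_real \<Omega> x *\<^sub>R gr v x)) \<bullet> (indicat_real \<Omega> x *\<^sub>R gr u x - indicat_real \<Omega> x *\<^sub>R gr v x))))
      = (\<lambda>x. indicator \<Omega> x * ((dG (b x) - dG (b x - a x)) * Dq x))"
      using bb' by (auto simp: indicator_def fun_eq_iff Dq_def)
    ultimately show ?thesis by metis
  qed
  have dH: "(\<lambda>x. dG (b' x - a x) * H x) = (\<lambda>x. d x * H x)"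
    using bb' by (auto simp: H_def d_def indicator_def fun_eq_iff)
  have mH: "H \<in> borel_measurable lebesgue" using iH by simp
  from borel_measurable_times[OF md(1) mH]
  show "(\<lambda>x. dG (b x - a x) * H x) \<in> borel_measurable lebesgue"
    using dH by (simp add: d_def)
  have idH: "integrable lebesgue (\<lambda>x. d x * H x)"
    using integrable_mult_bounded[OF iH md(1) abs_dG_le_1] dH by simp
  define Y where "Y x = indicator \<Omega> x * ((dG (b x) - d x) * Dq x)" for x
  \<comment> \<open>Majorant of the error containing the gradient of \<phi>. The factor d is kept
    with the energies of u and v, whose term then vanishes in the limit, and is estimated by 1 with
    the energy of \<phi>, which is merely bounded.\<close>
  define Z where "Z x = C * t * (d x * H x) + 2 * C * t powr (1 - p) * (norm (grad \<phi> x) powr p * w x)" for x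
  have iZ: "integrable lebesgue Z"
    unfolding Z_def[abs_def] using idH i\<phi> by (intro Bochner_Integration.integrable_add integrable_mult_right)
  have Y0: "AE x in lebesgue. 0 \<le> Y x"
    using F_strictly_monotone
  proof eventually_elim
    case (elim x)
    have "0 \<le> Dq x" if "x \<in> \<Omega>"
      using elim that by (cases "gr u x = gr v x") (auto simp: Dq_def intro: less_imp_le)
    then show ?case using d01(3)[of x] by (auto simp: Y_def indicator_def)
  qed
  have Yle: "AE x in lebesgue. Y x \<le> indicator K x * (D x \<bullet> S x) + Z x"
    using w_pos sol_pos[OF v]
  proof eventually_elim
    case (elim x)
    have Z0: "0 \<le> Z x"
      using elim C t d01[of x] by (simp add: Z_def H_def)
    show ?case
    proof (cases "x \<in> K")
      case False
      then show ?thesis using Z0 aoff[OF False] by (simp add: Y_def d_def)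
    next
      case True
      then have x: "x \<in> \<Omega>" using KM(2) by blast
      have DS: "D x \<bullet> S x = (dG (b x) - d x) * Dq x + C * dG (\<phi> x) * d x * (D x \<bullet> grad \<phi> x)"
        by (simp add: S_def Dq inner_diff_right algebra_simps)
      have "- (C * dG (\<phi> x) * d x * (D x \<bullet> grad \<phi> x)) \<le> Z x"
      \<comment> \<open>Where b \<le> 0 also b - a \<le> 0 and d vanishes, so the error lives on the
        set where u and v have finite energy.\<close>
      proof (cases "0 < b x")
        case False
        then have "d x = 0" using a0[of x] by (simp add: d_def dG_eq_0)
        then show ?thesis using Z0 by simp
      next
        case b: True
        then have E: "x \<in> ?E" using x by (simp add: b_def)
        let ?g = "norm (grad \<phi> x)" and ?s = "t powr (1 - p)"
        have nD: "norm (D x) \<le> norm (gr u x) powr (p - 1) * w x + norm (gr v x) powr (p - 1) * w x"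
          using norm_triangle_ineq4[of "F x (gr u x)" "F x (gr v x)"] elim by (simp add: D_def norm_F)
        have "- (D x \<bullet> grad \<phi> x) \<le> norm (D x) * ?g"
          using norm_cauchy_schwarz[of "- D x" "grad \<phi> x"] by simp
        also have "\<dots> \<le> (norm (gr u x) powr (p - 1) * w x + norm (gr v x) powr (p - 1) * w x) * ?g"
          by (intro mult_right_mono nD) simp
        also have "\<dots> = (norm (gr u x) powr (p - 1) * ?g + norm (gr v x) powr (p - 1) * ?g) * w x"
          by (simp add: algebra_simps)
        also have "\<dots> \<le> ((t * norm (gr u x) powr p + ?s * ?g powr p) + (t * norm (gr v x) powr p + ?s * ?g powr p)) * w x"
          using elim t by (intro mult_right_mono add_mono young_powr[OF p]) auto
        also have "\<dots> = t * H x + 2 * ?s * (?g powr p * w x)"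
          using E by (simp add: H_def algebra_simps)
        finally have 1: "- (D x \<bullet> grad \<phi> x) \<le> t * H x + 2 * ?s * (?g powr p * w x)" .
        have RH0: "0 \<le> t * H x" "0 \<le> 2 * ?s * (?g powr p * w x)" using elim t by (auto simp: H_def)
        have c01: "0 \<le> C * dG (\<phi> x) * d x" "C * dG (\<phi> x) * d x \<le> C * d x" "C * d x \<le> C"
          using C d01[of x] dG_nonneg[of "\<phi> x"] dG_le_1[of "\<phi> x"]
          by (auto simp: mult_left_le mult_left_le_one_le mult.assoc intro!: mult_left_mono)
        have "- (C * dG (\<phi> x) * d x * (D x \<bullet> grad \<phi> x)) = (C * dG (\<phi> x) * d x) * (- (D x \<bullet> grad \<phi> x))" by simp
        also have "\<dots> \<le> (C * dG (\<phi> x) * d x) * (t * H x + 2 * ?s * (?g powr p * w x))"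
          by (intro mult_left_mono 1 c01)
        also have "\<dots> \<le> (C * d x) * (t * H x) + C * (2 * ?s * (?g powr p * w x))"
          unfolding distrib_left
          by (rule add_mono[OF mult_right_mono[OF c01(2) RH0(1)] mult_right_mono[OF order_trans[OF c01(2,3)] RH0(2)]])
        also have "\<dots> = Z x" by (simp add: Z_def algebra_simps)
        finally show ?thesis .
      qed
      then show ?thesis using True x DS by (simp add: Y_def)
    qed
  qed
  have iY: "integrable lebesgue Y"
  proof (rule Bochner_Integration.integrable_bound[OF Bochner_Integration.integrable_add[OF iDS iZ]])
    show "Y \<in> borel_measurable lebesgue" using mDq by (simp add: Y_def[abs_def] d_def)
    show "AE x in lebesgue. norm (Y x) \<le> norm (indicator K x * (D x \<bullet> S x) + Z x)"
      using Y0 Yle by eventually_elim simp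
  qed
  have "(LINT x|lebesgue. Y x) \<le> (LINT x|lebesgue. indicator K x * (D x \<bullet> S x) + Z x)"
    by (rule integral_mono_AE[OF iY Bochner_Integration.integrable_add[OF iDS iZ] Yle])
  also have "\<dots> = (LINT x|lebesgue. indicator K x * (D x \<bullet> S x)) + (LINT x|lebesgue. Z x)"
    by (rule Bochner_Integration.integral_add[OF iDS iZ])
  also have "\<dots> \<le> (LINT x|lebesgue. Z x)" using DS0 by simp
  also have "\<dots> = C * t * (LINT x|lebesgue. d x * H x) + 2 * C * t powr (1 - p) * (energy p w (grad \<phi>))"
    unfolding Z_def using idH i\<phi> by simp
  finally have fin: "(LINT x|lebesgue. Y x) \<le> C * t * (LINT x|lebesgue. d x * H x) + 2 * C * t powr (1 - p) * (energy p w (grad \<phi>))" .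
  have "(\<integral>\<^sup>+x. ennreal (Y x) \<partial>lebesgue) = ennreal (LINT x|lebesgue. Y x)"
    by (rule nn_integral_eq_integral[OF iY Y0])
  also have "\<dots> \<le> ennreal (C * t * (LINT x|lebesgue. d x * H x) + 2 * C * t powr (1 - p) * (energy p w (grad \<phi>)))"
    by (rule ennreal_leI[OF fin])
  finally show "(\<integral>\<^sup>+x. ennreal (indicator \<Omega> x * ((dG (b x) - dG (b x - a x)) * Dq x)) \<partial>lebesgue)
      \<le> ennreal (C * t * (LINT x|lebesgue. dG (b x - a x) * H x) + 2 * C * t powr (1 - p) * (energy p w (grad \<phi>)))"
    by (simp only: Y_def d_def)
qed

text \<open>Limit of the comparison step along the boundary sequence. Since C G(u^\<alpha>) \<ge> u
  > u - v - \<epsilon> where u > \<epsilon>, the truncation disappears, and the integral of dG(u - v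
  - \<epsilon>) times the monotonicity expression is at most every e > 0. Strict monotonicity then
  forces equal gradients.\<close>

lemma gradients_agree_above:
  assumes u: "sol u" and v: "sol v" and \<epsilon>: "0 < \<epsilon>"
  shows "AE x in lebesgue. x \<in> \<Omega> \<longrightarrow> v x + \<epsilon> < u x \<longrightarrow> gr u x = gr v x"
proof -
  obtain \<alpha> \<phi> B where \<alpha>: "1 \<le> \<alpha>" and \<phi>: "\<And>n::nat. \<phi> n \<in> Cc1 \<Omega>"
    and B: "\<And>n. (energy p w (grad (\<phi> n))) \<le> B"
    and lim: "AE x in lebesgue. x \<in> \<Omega> \<longrightarrow> (\<lambda>n. \<phi> n x) \<longlonglongrightarrow> u x powr \<alpha>"
    by (rule boundary_sequence[OF u]) (rule that)
  let ?E = "{x \<in> \<Omega>. v x + \<epsilon> < u x}"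
  have mE: "?E \<in> sets lebesgue"
  proof -
    note mv = gr_measurable_\<Omega>(2)[OF sol_weak_gradient[OF v]] and mu = gr_measurable_\<Omega>(2)[OF sol_weak_gradient[OF u]]
    have 1: "{x \<in> space lebesgue. indicat_real \<Omega> x * v x + \<epsilon> < indicat_real \<Omega> x * u x} \<in> sets lebesgue"
      by (rule borel_measurable_less[OF borel_measurable_add[OF mv borel_measurable_const] mu])
    have "?E = \<Omega> \<inter> {x \<in> space lebesgue. indicat_real \<Omega> x * v x + \<epsilon> < indicat_real \<Omega> x * u x}" by auto
    then show ?thesis using sets.Int[OF sets_\<Omega> 1] by (simp only:)
  qed
  have iE: "integrable lebesgue (\<lambda>x. indicator ?E x * (norm (gr z x) powr p * w x))" if z: "sol z"
    and zle: "AE x in lebesgue. x \<in> ?E \<longrightarrow> \<epsilon> < u x \<and> z x < 2 * u x - \<epsilon>" for z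
  proof -
    let ?E' = "{x \<in> \<Omega>. \<epsilon> < u x \<and> z x < 2 * u x - \<epsilon>}"
    have 1: "integrable lebesgue (\<lambda>x. indicator ?E' x * (norm (gr z x) powr p * w x))"
      by (rule energy_near_boundary[OF u z \<epsilon> \<alpha> \<phi> B lim])
    have "integrable lebesgue (\<lambda>x. indicat_real ?E x *\<^sub>R (indicat_real ?E' x * (norm (gr z x) powr p * w x)))"
      by (rule integrable_mult_bounded[OF 1 borel_measurable_indicator[OF mE], of 1]) (simp add: indicator_def)
    then show ?thesis
    proof (rule integrable_cong_AE_lebesgue(1))
      show "AE x in lebesgue. indicat_real ?E x *\<^sub>R (indicat_real ?E' x * (norm (gr z x) powr p * w x)) = indicator ?E x * (norm (gr z x) powr p * w x)"
        using zle by eventually_elim (auto simp: indicator_def)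
    qed
  qed
  \<comment> \<open>Here the estimate near the boundary is applied with u in both roles; u > v +
    \<epsilon> and v > 0 give u > \<epsilon>.\<close>
  have iu: "integrable lebesgue (\<lambda>x. indicator ?E x * (norm (gr u x) powr p * w x))"
  proof (rule iE[OF u])
    show "AE x in lebesgue. x \<in> ?E \<longrightarrow> \<epsilon> < u x \<and> u x < 2 * u x - \<epsilon>"
      using sol_pos[OF v]
    proof eventually_elim
      case (elim x)
      then show ?case using \<epsilon> by auto
    qed
  qed
  have iv: "integrable lebesgue (\<lambda>x. indicator ?E x * (norm (gr v x) powr p * w x))"
  proof (rule iE[OF v])
    show "AE x in lebesgue. x \<in> ?E \<longrightarrow> \<epsilon> < u x \<and> v x < 2 * u x - \<epsilon>"
      using sol_pos[OF v]
    proof eventually_elim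
      case (elim x)
      then show ?case using \<epsilon> by auto
    qed
  qed
  define \<tau> where "\<tau> = \<epsilon> powr \<alpha>"
  have \<tau>: "0 < \<tau>" using \<epsilon> by (simp add: \<tau>_def)
  \<comment> \<open>The first factor undoes the slope lost in \<open>G_lower\<close> above \<tau>, a
    lower bound of u^\<alpha> for u > \<epsilon>; the second undoes the slope in
    \<open>powr_ge_linear\<close>.\<close>
  define C where "C = (\<tau> + 2) / \<tau> * (1 / \<epsilon> powr (\<alpha> - 1))"
  have C: "0 \<le> C" using \<tau> by (simp add: C_def)
  have CG: "z \<le> C * G (z powr \<alpha>)" if z: "\<epsilon> < z" for z
  proof -
    have "z powr \<alpha> * (\<tau> / (\<tau> + 2)) \<le> G (z powr \<alpha>)"
      using powr_ge_linear(2)[OF \<epsilon> z \<alpha>] by (intro G_lower[OF \<tau>]) (simp add: \<tau>_def)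
    then have "C * (z powr \<alpha> * (\<tau> / (\<tau> + 2))) \<le> C * G (z powr \<alpha>)" using C by (rule mult_left_mono)
    moreover have "C * (z powr \<alpha> * (\<tau> / (\<tau> + 2))) = z powr \<alpha> * (1 / \<epsilon> powr (\<alpha> - 1))"
    proof -
      have "(\<tau> + 2) / \<tau> * (\<tau> / (\<tau> + 2)) = 1" using \<tau> by simp
      moreover have "C * (z powr \<alpha> * (\<tau> / (\<tau> + 2)))
        = ((\<tau> + 2) / \<tau> * (\<tau> / (\<tau> + 2))) * (z powr \<alpha> * (1 / \<epsilon> powr (\<alpha> - 1)))"
        by (simp only: C_def mult_ac)
      ultimately show ?thesis by (simp only: mult_1)
    qed
    moreover have "z \<le> z powr \<alpha> * (1 / \<epsilon> powr (\<alpha> - 1))"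
      using powr_ge_linear(1)[OF \<epsilon> z \<alpha>] \<epsilon> by (simp add: field_simps)
    ultimately show ?thesis by linarith
  qed
  define b where "b x = u x - v x - \<epsilon>" for x
  define a where "a n x = C * G (\<phi> n x)" for n x
  define H where "H x = indicator ?E x * ((norm (gr u x) powr p + norm (gr v x) powr p) * w x)" for x
  define Dq where "Dq x = (F x (gr u x) - F x (gr v x)) \<bullet> (gr u x - gr v x)" for x
  note step = comparison_step[OF u v \<epsilon> C \<phi> _ iu iv, folded b_def a_def H_def Dq_def]
  have iH: "integrable lebesgue H"
    using Bochner_Integration.integrable_add[OF iu iv] by (simp add: H_def[abs_def] algebra_simps)
  have alim: "AE x in lebesgue. x \<in> \<Omega> \<longrightarrow> (\<lambda>n. dG (b x - a n x)) \<longlonglongrightarrow> 0"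
    using lim sol_pos[OF v]
  proof eventually_elim
    case (elim x)
    show ?case
    proof
      assume x: "x \<in> \<Omega>"
      have "(\<lambda>n. G (\<phi> n x)) \<longlonglongrightarrow> G (u x powr \<alpha>)"
        by (rule isCont_tendsto_compose[OF DERIV_isCont[OF G_has_derivative]]) (use elim x in blast)
      then have "(\<lambda>n. b x - a n x) \<longlonglongrightarrow> b x - C * G (u x powr \<alpha>)"
        unfolding a_def by (intro tendsto_intros)
      then have "(\<lambda>n. dG (b x - a n x)) \<longlonglongrightarrow> dG (b x - C * G (u x powr \<alpha>))"
        by (intro continuous_on_tendsto_compose[OF continuous_on_dG]) auto
      moreover have "b x - C * G (u x powr \<alpha>) \<le> 0"
      proof (cases "\<epsilon> < u x")
        case True
        then show ?thesis using CG[OF True] elim x \<epsilon> by (simp add: b_def)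
      next
        case False
        then have "b x \<le> 0" using elim x by (simp add: b_def)
        moreover have "0 \<le> C * G (u x powr \<alpha>)" using C G_nonneg by simp
        ultimately show ?thesis by linarith
      qed
      ultimately show "(\<lambda>n. dG (b x - a n x)) \<longlonglongrightarrow> 0" by (simp add: dG_eq_0)
    qed
  qed
  have Hlim: "(\<lambda>n. LINT x|lebesgue. dG (b x - a n x) * H x) \<longlonglongrightarrow> (LINT x::'a|lebesgue. 0)"
  proof (rule integral_dominated_convergence[where f="\<lambda>_. 0 :: real" and w="\<lambda>x. norm (H x)"])
    show "(\<lambda>x. dG (b x - a n x) * H x) \<in> borel_measurable lebesgue" for n
      by (rule step(2)) (rule zero_less_one)
    show "AE x in lebesgue. (\<lambda>n. dG (b x - a n x) * H x) \<longlonglongrightarrow> 0"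
      using alim
    proof eventually_elim
      case (elim x)
      show ?case
      proof (cases "x \<in> \<Omega>")
        case True
        then show ?thesis using elim by (intro tendsto_mult_left_zero) blast
      qed (simp add: H_def)
    qed
    show "AE x in lebesgue. norm (dG (b x - a n x) * H x) \<le> norm (H x)" for n
      by (intro AE_I2) (simp add: abs_mult mult_left_le_one_le abs_dG_le_1)
  qed (use iH in auto)
  have small: "(\<integral>\<^sup>+x. ennreal (indicator \<Omega> x * (dG (b x) * Dq x)) \<partial>lebesgue) \<le> ennreal e" if e: "0 < e" for e
  proof -
    have B0: "0 \<le> B"
    proof -
      have "0 \<le> (energy p w (grad (\<phi> 0)))"
        using w_pos by (intro integral_nonneg_AE) (auto elim!: eventually_mono)
      then show ?thesis using B[of 0] by linarith
    qed
    define k where "k = (C + 1) * (B + 1)"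
    have k: "0 < k" "C * B \<le> k" using C B0 by (auto simp: k_def intro!: mult_pos_pos mult_mono)
    \<comment> \<open>Fixed before n: by \<open>C * B\<close> \<le> k it makes the part with the
      energy of \<phi> at most e / 2. Only then is n taken so large that the other part is below e /
      2.\<close>
    define t where "t = (e / (4 * k)) powr (1 / (1 - p))"
    have t: "0 < t" using e k by (simp add: t_def)
    have "t powr (1 - p) = e / (4 * k)"
      using p e k by (simp add: t_def powr_powr)
    then have "t powr (1 - p) * k = e / 4" using k by simp
    moreover have "t powr (1 - p) * (C * B) \<le> t powr (1 - p) * k"
      by (intro mult_left_mono k) simp
    ultimately have tB: "2 * C * t powr (1 - p) * B \<le> e / 2" by (simp add: mult_ac)
    have "(\<lambda>n. C * t * (LINT x|lebesgue. dG (b x - a n x) * H x)) \<longlonglongrightarrow> C * t * 0"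
      using Hlim by (intro tendsto_mult tendsto_const) simp
    then have "\<forall>\<^sub>F n in sequentially. C * t * (LINT x|lebesgue. dG (b x - a n x) * H x) < e / 2"
      using e by (intro order_tendstoD(2)) auto
    then obtain N where N: "\<And>n. N \<le> n \<Longrightarrow> C * t * (LINT x|lebesgue. dG (b x - a n x) * H x) < e / 2"
      by (auto simp: eventually_sequentially)
    show ?thesis
    proof (rule nn_integral_le_lim[where N=N])
      show "(\<lambda>x. indicator \<Omega> x * ((dG (b x) - dG (b x - a n x)) * Dq x)) \<in> borel_measurable lebesgue" for n
        by (rule step(1)) (rule zero_less_one)
      show "AE x in lebesgue. (\<lambda>n. indicator \<Omega> x * ((dG (b x) - dG (b x - a n x)) * Dq x)) \<longlonglongrightarrow> indicator \<Omega> x * (dG (b x) * Dq x)"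
        using alim
      proof eventually_elim
        case (elim x)
        show ?case
        proof (cases "x \<in> \<Omega>")
          case True
          then have "(\<lambda>n. dG (b x) - dG (b x - a n x)) \<longlonglongrightarrow> dG (b x) - 0" using elim by (intro tendsto_diff tendsto_const) blast
          then have "(\<lambda>n. (dG (b x) - dG (b x - a n x)) * Dq x) \<longlonglongrightarrow> (dG (b x) - 0) * Dq x" by (intro tendsto_mult tendsto_const)
          then show ?thesis using True by simp
        qed simp
      qed
      fix n assume "N \<le> n"
      have "C * t * (LINT x|lebesgue. dG (b x - a n x) * H x) + 2 * C * t powr (1 - p) * (energy p w (grad (\<phi> n))) \<le> e"
      proof -
        have "2 * C * t powr (1 - p) * (energy p w (grad (\<phi> n))) \<le> 2 * C * t powr (1 - p) * B"
          using C B[of n] by (intro mult_left_mono) auto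
        then show ?thesis using tB N[OF \<open>N \<le> n\<close>] by linarith
      qed
      then show "(\<integral>\<^sup>+x. ennreal (indicator \<Omega> x * ((dG (b x) - dG (b x - a n x)) * Dq x)) \<partial>lebesgue) \<le> ennreal e"
        by (rule order_trans[OF step(3)[OF t] ennreal_leI])
    qed
  qed
  \<comment> \<open>Measurability is inherited from the approximating integrands, of which this is
    the almost everywhere limit.\<close>
  have mD: "(\<lambda>x. ennreal (indicator \<Omega> x * (dG (b x) * Dq x))) \<in> borel_measurable lebesgue"
  proof -
    have "(\<lambda>x. indicator \<Omega> x * (dG (b x) * Dq x)) \<in> borel_measurable lebesgue"
    proof (rule borel_measurable_AE)
      show "(\<lambda>x. lim (\<lambda>n. indicator \<Omega> x * ((dG (b x) - dG (b x - a n x)) * Dq x))) \<in> borel_measurable lebesgue"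
        by (rule borel_measurable_lim_metric) (rule step(1), rule zero_less_one)
      show "AE x in lebesgue. lim (\<lambda>n. indicator \<Omega> x * ((dG (b x) - dG (b x - a n x)) * Dq x)) = indicator \<Omega> x * (dG (b x) * Dq x)"
        using alim
      proof eventually_elim
        case (elim x)
        show ?case
        proof (cases "x \<in> \<Omega>")
          case True
          then have "(\<lambda>n. dG (b x) - dG (b x - a n x)) \<longlonglongrightarrow> dG (b x) - 0" using elim by (intro tendsto_diff tendsto_const) blast
          then have "(\<lambda>n. (dG (b x) - dG (b x - a n x)) * Dq x) \<longlonglongrightarrow> (dG (b x) - 0) * Dq x" by (intro tendsto_mult tendsto_const)
          then show ?thesis using True limI by simp
        qed simp
      qed
    qed
    then show ?thesis by (rule measurable_compose[OF _ measurable_ennreal])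
  qed
  have "(\<integral>\<^sup>+x. ennreal (indicator \<Omega> x * (dG (b x) * Dq x)) \<partial>lebesgue) \<le> 0"
  proof (rule ennreal_le_epsilon)
    fix e :: real assume "0 < e"
    then show "(\<integral>\<^sup>+x. ennreal (indicator \<Omega> x * (dG (b x) * Dq x)) \<partial>lebesgue) \<le> 0 + ennreal e" using small by simp
  qed
  then have "AE x in lebesgue. ennreal (indicator \<Omega> x * (dG (b x) * Dq x)) = 0"
    using nn_integral_0_iff_AE[OF mD] by simp
  then show ?thesis using F_strictly_monotone
  proof eventually_elim
    case (elim x)
    show ?case
    proof (intro impI, rule ccontr)
      assume x: "x \<in> \<Omega>" "v x + \<epsilon> < u x" and ne: "gr u x \<noteq> gr v x"
      have "0 < Dq x" using elim(2) x(1) ne by (simp add: Dq_def)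
      moreover have "0 < dG (b x)" using x by (intro dG_pos) (simp add: b_def)
      ultimately have "0 < dG (b x) * Dq x" by simp
      moreover have "dG (b x) * Dq x \<le> 0" using elim(1) x(1) by (simp add: ennreal_eq_0_iff)
      ultimately show False by simp
    qed
  qed
qed

text \<open>With gradients agreeing above every level, G(u - v) has zero gradient and is constant on
  the connected set \<Omega>. A positive constant would mean u > v almost everywhere with equal
  gradients. Both equations then have the same left-hand side, so f (1 / v^\<delta> - 1 /
  u^\<delta>) integrates to 0 against a cutoff; being nonnegative it vanishes, which forces f =
  0.\<close>

lemma sol_le:
  assumes u: "sol u" and v: "sol v" and f_not_0: "\<not> (AE x in lebesgue. x \<in> \<Omega> \<longrightarrow> f x = 0)"
  shows "AE x in lebesgue. x \<in> \<Omega> \<longrightarrow> u x \<le> v x"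
proof -
  \<comment> \<open>Countably many levels exhaust the set u > v, so the exceptional sets still form
    a null set.\<close>
  have "AE x in lebesgue. \<forall>n. x \<in> \<Omega> \<longrightarrow> v x + 1 / real (Suc n) < u x \<longrightarrow> gr u x = gr v x"
    unfolding AE_all_countable by (intro allI gradients_agree_above[OF u v]) simp
  then have agree: "AE x in lebesgue. x \<in> \<Omega> \<longrightarrow> v x < u x \<longrightarrow> gr u x = gr v x"
  proof eventually_elim
    case (elim x)
    show ?case
    proof (intro impI)
      assume x: "x \<in> \<Omega>" "v x < u x"
      then obtain n where "1 / real (Suc n) < u x - v x"
        using reals_Archimedean[of "u x - v x"] by (auto simp: inverse_eq_divide)
      then have "v x + 1 / real (Suc n) < u x" by simp
      then show "gr u x = gr v x" using elim x by blast
    qed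
  qed
  have wb: "has_weak_gradient \<Omega> (\<lambda>x. u x - v x) (\<lambda>x. gr u x - gr v x)"
    using has_weak_gradient_linear[OF open_\<Omega> sol_weak_gradient[OF u] sol_weak_gradient[OF v], of 1 "-1"] by simp
  note wG = has_weak_gradient_chain[OF open_\<Omega> wb G_has_derivative continuous_on_dG abs_dG_le_1]
  have "AE x in lebesgue. x \<in> \<Omega> \<longrightarrow> dG (u x - v x) *\<^sub>R (gr u x - gr v x) = 0"
    using agree
  proof eventually_elim
    case (elim x)
    then show ?case by (cases "v x < u x") (auto simp: dG_eq_0)
  qed
  then obtain c where c: "AE x in lebesgue. x \<in> \<Omega> \<longrightarrow> G (u x - v x) = c"
    by (rule weak_gradient_0_const[OF open_\<Omega> connected_\<Omega> wG])
  show ?thesis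
  proof (cases "0 < c")
    case False
    show ?thesis using c
    proof eventually_elim
      case (elim x)
      show ?case using elim False G_pos_iff[of "u x - v x"] by auto
    qed
  next
    case True
    have lt: "AE x in lebesgue. x \<in> \<Omega> \<longrightarrow> v x < u x"
      using c
    proof eventually_elim
      case (elim x)
      show ?case using elim True G_pos_iff[of "u x - v x"] by auto
    qed
    have gr_eq: "AE x in lebesgue. x \<in> \<Omega> \<longrightarrow> gr u x = gr v x"
      using lt agree by eventually_elim blast
    have f0_on: "AE x in lebesgue. x \<in> K \<longrightarrow> f x = 0" if K: "compact K" "K \<subseteq> \<Omega>" for K
    proof -
      obtain \<psi> where \<psi>: "\<psi> \<in> Cc1 \<Omega>" "\<And>x. x \<in> K \<Longrightarrow> \<psi> x = 1" "\<And>x. 0 \<le> \<psi> x"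
        by (rule exists_cutoff[OF open_\<Omega> K]) (rule that)
      obtain L M where "support_bound \<Omega> L M \<psi>"
        by (rule Cc1D[OF \<psi>(1)])
      note L = support_boundD[OF this]
      have i: "integrable lebesgue (\<lambda>x. indicator L x * (f x / z x powr \<delta>) * \<psi> x)"
        and e: "(LINT x|lebesgue. (indicator L x *\<^sub>R F x (gr z x)) \<bullet> grad \<psi> x) = (LINT x|lebesgue. indicator L x * (f x / z x powr \<delta>) * \<psi> x)"
        if "sol z" for z
        by (rule sol_weak_form(1)[OF that \<psi>(1) L(1,2)], erule L(3), erule L(4))
           (rule sol_weak_form(2)[OF that \<psi>(1) L(1,2)], erule L(3), erule L(4))
      define J where "J x = indicator L x * (f x / v x powr \<delta>) * \<psi> x - indicator L x * (f x / u x powr \<delta>) * \<psi> x" for x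
      have iJ: "integrable lebesgue J"
        unfolding J_def[abs_def] by (rule Bochner_Integration.integrable_diff[OF i[OF v] i[OF u]])
      have same: "(LINT x|lebesgue. (indicator L x *\<^sub>R F x (gr u x)) \<bullet> grad \<psi> x) = (LINT x|lebesgue. (indicator L x *\<^sub>R F x (gr v x)) \<bullet> grad \<psi> x)"
      proof -
        have ae: "AE x in lebesgue. (indicat_real L x *\<^sub>R F x (gr u x)) \<bullet> grad \<psi> x = (indicat_real L x *\<^sub>R F x (gr v x)) \<bullet> grad \<psi> x"
          using gr_eq by eventually_elim (use L(2) in \<open>auto simp: indicator_def\<close>)
        have m: "(\<lambda>x. (indicat_real L x *\<^sub>R F x (gr z x)) \<bullet> grad \<psi> x) \<in> borel_measurable lebesgue" if z: "sol z" for z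
        proof -
          have "(\<lambda>x. indicat_real L x *\<^sub>R gr z x) \<in> borel_measurable lebesgue"
            using has_weak_gradientD(2)[OF open_\<Omega> sol_weak_gradient[OF z] L(1,2)] by simp
          from borel_measurable_inner[OF F_measurable[OF this] Cc1_integrable_p(2)[OF \<psi>(1)]]
          have "(\<lambda>x. F x (indicat_real L x *\<^sub>R gr z x) \<bullet> grad \<psi> x) \<in> borel_measurable lebesgue" .
          moreover have "(\<lambda>x. F x (indicat_real L x *\<^sub>R gr z x) \<bullet> grad \<psi> x) = (\<lambda>x. (indicat_real L x *\<^sub>R F x (gr z x)) \<bullet> grad \<psi> x)"
            by (auto simp: F_def indicator_def fun_eq_iff)
          ultimately show ?thesis by metis
        qed
        show ?thesis by (rule integral_cong_AE[OF m[OF u] m[OF v] ae])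
      qed
      have J_int: "(LINT x|lebesgue. J x) = 0"
      proof -
        have "(LINT x|lebesgue. J x) = (LINT x|lebesgue. indicator L x * (f x / v x powr \<delta>) * \<psi> x) - (LINT x|lebesgue. indicator L x * (f x / u x powr \<delta>) * \<psi> x)"
          unfolding J_def by (rule Bochner_Integration.integral_diff[OF i[OF v] i[OF u]])
        then show ?thesis using e[OF u] e[OF v] same by simp
      qed
      have J0: "AE x in lebesgue. 0 \<le> J x"
        using rhs_nonneg lt sol_pos[OF v]
      proof eventually_elim
        case (elim x)
        show ?case
        proof (cases "x \<in> L")
          case True
          then have "x \<in> \<Omega>" using L(2) by blast
          then have "f x / u x powr \<delta> \<le> f x / v x powr \<delta>"
            using elim by (intro powr_minus_antimono) auto
          from mult_right_mono[OF this \<psi>(3)[of x]] show ?thesis using True by (simp add: J_def)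
        qed (simp add: J_def)
      qed
      have "AE x in lebesgue. J x = 0"
        using integral_nonneg_eq_0_iff_AE[OF iJ J0] J_int by simp
      then show ?thesis using lt sol_pos[OF v]
      proof eventually_elim
        case (elim x)
        show ?case
        proof
          assume x: "x \<in> K"
          have "x \<in> L"
          proof (rule ccontr)
            assume "x \<notin> L"
            then show False using L(3)[of x] \<psi>(2)[OF x] by simp
          qed
          then have x\<Omega>: "x \<in> \<Omega>" using L(2) by blast
          have "f x * (1 / v x powr \<delta> - 1 / u x powr \<delta>) = 0"
            using elim(1) \<open>x \<in> L\<close> \<psi>(2)[OF x] by (simp add: J_def algebra_simps)
          moreover have "v x powr \<delta> < u x powr \<delta>" using elim x\<Omega> \<delta> by (intro powr_less_mono2) auto
          moreover have "0 < v x powr \<delta>" using elim x\<Omega> by simp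
          ultimately show "f x = 0" by (auto simp: field_simps)
        qed
      qed
    qed
    obtain C where C: "\<And>n::nat. compact (C n)" "\<And>n. C n \<subseteq> \<Omega>" "\<And>n. C n \<subseteq> interior (C (Suc n))"
      "\<Union> (range C) = \<Omega>" "\<And>K. compact K \<Longrightarrow> K \<subseteq> \<Omega> \<Longrightarrow> \<exists>N. \<forall>n\<ge>N. K \<subseteq> C n"
      by (rule open_Union_compact_subsets[OF open_\<Omega>]) (rule that)
    have "AE x in lebesgue. \<forall>n. x \<in> C n \<longrightarrow> f x = 0"
      unfolding AE_all_countable using f0_on[OF C(1,2)] by blast
    then have "AE x in lebesgue. x \<in> \<Omega> \<longrightarrow> f x = 0"
      by eventually_elim (use C(4) in blast)
    then show ?thesis using f_not_0 by contradiction
  qed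
qed

end

theorem theorem4p2:
  fixes \<Omega> :: "'a::euclidean_space set"
    and p s \<delta> :: real
    and w f :: "'a \<Rightarrow> real"
    and A :: "'a \<Rightarrow> 'a \<Rightarrow> 'a"
  assumes "DIM('a) \<ge> 2"
    and "bounded_smooth_domain \<Omega>"
    and "1 < p"
    and "1 / (p - 1) \<le> s" and "real DIM('a) / p < s"
    and "1 < \<delta>"
    and "As_weight p s \<Omega> w"
    and "structural_conditions p \<Omega> w A"
    and "f \<in> borel_measurable (lebesgue_on \<Omega>)"
    and "AE x in lebesgue_on \<Omega>. 0 \<le> f x"
    and "\<not> (AE x in lebesgue_on \<Omega>. f x = 0)"
    and "(1 \<le> p_sub p s \<and> p_sub p s < real DIM('a) \<and>
            f \<in> Lspace (holder_conjugate (sobolev_exponent (real DIM('a)) (p_sub p s))) \<Omega>) \<or>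
         (p_sub p s = real DIM('a) \<and> (\<exists>m>1. f \<in> Lspace m \<Omega>)) \<or>
         (p_sub p s > real DIM('a) \<and> f \<in> Lspace 1 \<Omega>)"
  shows "\<forall>u v. weak_solution p \<Omega> w A \<delta> f u \<and> weak_solution p \<Omega> w A \<delta> f v \<longrightarrow>
           (AE x in lebesgue_on \<Omega>. u x = v x)"
proof -
  interpret weighted_problem \<Omega> p \<delta> w f A
    using assms(2,3,6,7,8,10) by unfold_locales (auto simp: bounded_smooth_domain_def As_weight_def)
  have f_not_0: "\<not> (AE x in lebesgue. x \<in> \<Omega> \<longrightarrow> f x = 0)"
    using assms(11) unfolding AE_lebesgue_on_iff[OF sets_\<Omega>] .
  show ?thesis
  proof (intro allI impI, elim conjE)
    fix u v assume u: "sol u" and v: "sol v"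
    from sol_le[OF u v f_not_0] sol_le[OF v u f_not_0]
    have "AE x in lebesgue. x \<in> \<Omega> \<longrightarrow> u x = v x"
      by eventually_elim (meson order_antisym)
    then show "AE x in lebesgue_on \<Omega>. u x = v x"
      unfolding AE_lebesgue_on_iff[OF sets_\<Omega>] .
  qed
qed

end
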